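(* There exists a probability measure $\nu$ on $\mathbb{R}$ such that the family of probability measures on $\mathrm{SL}_2(\mathbb{R})$ $$\mu_E=\int_{\mathbb{R}}\delta_{S_{x-E}}\,d\nu(x),\qquad S_v=\begin{bmatrix} v&-1\\1&0\end{bmatrix},\quad E\in\mathbb{R},$$ satisfies: (1) for every $m>0$, $\displaystyle\sup_{|E|\le m}\int\exp\big((\log\|g\|)^{1/3}\big)\,d\mu_E(g)<\infty$; (2) for every $\alpha>0$ and every $E\in\mathbb{R}$, $\displaystyle\int\|g\|^\alpha\,d\mu_E(g)=\infty$; (3) for every $E\in\mathbb{R}$, $\mu_E$ is strongly irreducible and $L_1(\mu_E)>L_2(\mu_E)$; (4) the function $\mathbb{R}\ni E\mapsto L_1(\mu_E)$ is not locally $\alpha$-Hölder continuous for any $\alpha>0$.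
   Context: For a probability measure $\mu$ on $\mathrm{SL}_2(\mathbb{R})$ with $\int\log\|g\|\,d\mu<\infty$, $L_1(\mu)=\lim_{n\to\infty}\frac1n\int\log\|g\|\,d\mu^{n}(g)$, where $\mu^{n}$ is the $n$-th convolution power, and $L_2(\mu)=-L_1(\mu)$ is the second Lyapunov exponent. $\mu$ is strongly irreducible if there is no finite non-empty subset of the projective line $\mathbb{P}^1$ invariant under all matrices in $\mathrm{supp}(\mu)$. A function $f:\mathbb{R}\to\mathbb{R}$ is locally $\alpha$-Hölder continuous if for every $a\in\mathbb{R}$ there are $r>0$ and $C<\infty$ with $|f(x)-f(y)|\le C|x-y|^\alpha$ for all $x,y\in(a-r,a+r)$. *)

theory Defs
  imports "HOL-Probability.Probability"
begin

text \<open>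
  \<open>SL\<^sub>2(\<real>)\<close> is the set of real \<open>2 \<times> 2\<close> matrices of determinant 1 with the topology and Borel
  structure inherited from the space of all matrices; a probability measure on it is a
  probability measure with the \<open>\<sigma>\<close>-algebra of \<open>SL2_borel\<close>.
\<close>

definition SL2 :: "(real^2^2) set" where
  "SL2 = {A. det A = 1}"

definition SL2_borel :: "(real^2^2) measure" where
  "SL2_borel = restrict_space borel SL2"

text \<open>
  The Euclidean operator norm. The library's \<open>norm\<close> on \<open>real^2^2\<close> is the Frobenius norm instead.
  On \<open>SL2\<close> the operator norm is at least 1, so its logarithm is nonnegative.
\<close>

definition op_norm :: "real^2^2 \<Rightarrow> real" where
  "op_norm A = onorm ((*v) A)"

definition mconv :: "(real^2^2) measure \<Rightarrow> (real^2^2) measure \<Rightarrow> (real^2^2) measure" where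
  "mconv M N = distr (M \<Otimes>\<^sub>M N) SL2_borel (\<lambda>(A, B). A ** B)"

primrec conv_power :: "(real^2^2) measure \<Rightarrow> nat \<Rightarrow> (real^2^2) measure" where
  "conv_power \<mu> 0 = return SL2_borel (mat 1)"
| "conv_power \<mu> (Suc n) = mconv \<mu> (conv_power \<mu> n)"

text \<open>
  The Lyapunov exponents are meaningful when \<open>\<integral> ln \<parallel>g\<parallel> d\<mu> < \<infinity>\<close>; the limit then exists by
  subadditivity.
\<close>

definition lyapunov1 :: "(real^2^2) measure \<Rightarrow> real" where
  "lyapunov1 \<mu> = lim (\<lambda>n. (1 / real n) * (\<integral>A. ln (op_norm A) \<partial>conv_power \<mu> n))"

definition lyapunov2 :: "(real^2^2) measure \<Rightarrow> real" where
  "lyapunov2 \<mu> = - lyapunov1 \<mu>"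

text \<open>The topological support of a measure on \<open>SL2\<close>, with neighbourhoods relative to \<open>SL2\<close>.\<close>

definition SL2_supp :: "(real^2^2) measure \<Rightarrow> (real^2^2) set" where
  "SL2_supp \<mu> = {A \<in> SL2. \<forall>U. open U \<and> A \<in> U \<longrightarrow> emeasure \<mu> (U \<inter> SL2) > 0}"

text \<open>Points of the projective line are the lines through the origin in \<open>\<real>\<^sup>2\<close>.\<close>

definition proj_line :: "(real^2) set set" where
  "proj_line = {L. subspace L \<and> dim L = 1}"

definition proj_act :: "real^2^2 \<Rightarrow> (real^2) set \<Rightarrow> (real^2) set" where
  "proj_act A L = (*v) A ` L"

definition strongly_irreducible :: "(real^2^2) measure \<Rightarrow> bool" where
  "strongly_irreducible \<mu> \<longleftrightarrow>
     \<not> (\<exists>F. F \<subseteq> proj_line \<and> finite F \<and> F \<noteq> {} \<and> (\<forall>A \<in> SL2_supp \<mu>. proj_act A ` F \<subseteq> F))"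

definition locally_holder :: "real \<Rightarrow> (real \<Rightarrow> real) \<Rightarrow> bool" where
  "locally_holder \<alpha> f \<longleftrightarrow>
     (\<forall>a. \<exists>r>0. \<exists>C. \<forall>x\<in>{a-r<..<a+r}. \<forall>y\<in>{a-r<..<a+r}. \<bar>f x - f y\<bar> \<le> C * \<bar>x - y\<bar> powr \<alpha>)"

definition S_mat :: "real \<Rightarrow> real^2^2" where
  "S_mat v = vector [vector [v, -1], vector [1, 0]]"

text \<open>The mixture \<open>\<integral> \<delta>\<close> over \<open>S_mat (x - E)\<close>, as a bind in the Giry monad.\<close>

definition mu_E :: "real measure \<Rightarrow> real \<Rightarrow> (real^2^2) measure" where
  "mu_E \<nu> E = \<nu> \<bind> (\<lambda>x. return SL2_borel (S_mat (x - E)))"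

lemma S_mat_in_SL2: "S_mat v \<in> SL2"
  by (simp add: S_mat_def SL2_def det_2)

lemma continuous_S_mat: "continuous_on UNIV S_mat"
proof -
  have eq: "S_mat v = (\<chi> i j. if i = 1 \<and> j = 1 then v else if i = 1 then -1 else if j = 1 then 1 else 0)"
    for v
    by (simp add: vec_eq_iff S_mat_def forall_2)
  have "continuous_on UNIV
      (\<lambda>v. (\<chi> i j. if i = 1 \<and> j = 1 then v else if i = 1 then -1 else if j = 1 then 1 else 0) :: real^2^2)"
  proof (intro continuous_on_vec_lambda)
    fix i j :: 2
    show "continuous_on UNIV
        (\<lambda>v::real. if i = 1 \<and> j = 1 then v else if i = 1 then -1 else if j = 1 then 1 else 0)"
      by (cases "i = 1"; cases "j = 1"; simp)
  qed
  then show ?thesis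
    by (simp add: continuous_on_cong [OF refl eq])
qed

lemma measurable_S_mat [measurable]: "S_mat \<in> borel \<rightarrow>\<^sub>M SL2_borel"
  unfolding SL2_borel_def
  by (intro measurable_restrict_space2 borel_measurable_continuous_onI continuous_S_mat)
    (simp add: S_mat_in_SL2)

lemma mu_E_eq_distr:
  assumes "prob_space \<nu>" "sets \<nu> = sets borel"
  shows "mu_E \<nu> E = distr \<nu> SL2_borel (\<lambda>x. S_mat (x - E))"
proof -
  have [measurable_cong]: "sets \<nu> = sets borel" by fact
  show ?thesis
    unfolding mu_E_def
    by (rule bind_return_distr') (auto simp: prob_space.not_empty[OF assms(1)])
qed

lemma prob_space_mu_E:
  assumes "prob_space \<nu>" "sets \<nu> = sets borel"
  shows "prob_space (mu_E \<nu> E)"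
proof -
  have [measurable_cong]: "sets \<nu> = sets borel" by fact
  show ?thesis
    unfolding mu_E_eq_distr[OF assms] by (rule prob_space.prob_space_distr[OF assms(1)]) simp
qed

end

theory Submission
  imports Defs "HOL-Computational_Algebra.Fundamental_Theorem_Algebra"
begin

text \<open>
  The matrix \<open>S_mat (x - E)\<close> is the one-step transfer matrix of the discrete Schroedinger equation
  \<open>u (n + 1) + u (n - 1) = (x\<^sub>n - E) u n\<close> with independent potential values of law \<open>\<nu>\<close>. The
  law chosen here (\<open>potential_law\<close>) is that of \<open>b\<^sub>k u\<close>, where \<open>u\<close> is uniform on \<open>[-1, 1]\<close> and the
  scale \<open>b\<^sub>k = exp (40 \<plusminus> k\<^sup>2)\<close>, with sign + for even and - for odd \<open>k\<close>, is chosen with probability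
  \<open>2\<^sup>-\<^sup>k\<^sup>-\<^sup>1\<close>. Since \<open>2\<^sup>-\<^sup>k\<close> decays more slowly than every power of \<open>exp (- k\<^sup>2)\<close>, but
  \<open>exp ((k\<^sup>2)\<^sup>1\<^sup>/\<^sup>3)\<close> grows more slowly than \<open>2\<^sup>k\<close>, the two moment statements hold. The law has
  full support, so that every \<open>S_mat v\<close> lies in the support of \<open>mu_E\<close>; as \<open>v\<close> varies these matrices
  move a line to infinitely many lines, whence strong irreducibility.

  The Lyapunov exponent is positive because the logarithmic potential \<open>a \<mapsto> \<integral> ln \<bar>x - a\<bar> d\<nu>\<close>
  is bounded below by a positive constant: averaging over one matrix factor increases
  \<open>ln (max \<bar>a\<bar> (\<kappa> \<bar>b\<bar>))\<close> of a row vector \<open>(a, b)\<close> by at least a positive amount,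
  uniformly in the vector (\<open>log_size_step\<close>, \<open>lyapunov1_positive\<close>).

  The exponent \<open>L\<close> fails to be Hoelder at the energy 0, simultaneously for all exponents. A site is
  called isolated at level \<open>\<eta>\<close> if its potential is at most \<open>\<eta>\<close> in size and both neighbours have
  potential at least \<open>3 / \<eta>\<close>. Such a site carries an eigenvalue of the Schroedinger operator of order
  \<open>\<eta>\<close>, so isolated sites make the density of states near 0 at least the probability
  \<open>q \<eta> = isolation_prob \<eta>\<close>, which for this law is larger than every power of \<open>\<eta>\<close> along a sequence
  \<open>\<eta> \<rightarrow> 0\<close>. To see this in \<open>L\<close> itself, let \<open>D(w)\<close> be the characteristic polynomial of a
  finite piece of the operator. Two facts are combined.

  \<^item> The polynomial \<open>D\<close> has real roots, and for a Cauchy distributed \<open>s\<close> the mean of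
    \<open>ln \<bar>\<epsilon> s - t\<bar>\<close> is \<open>ln \<bar>\<epsilon> \<i> - t\<bar>\<close>. Hence the mean of \<open>ln \<bar>D(\<epsilon> s)\<bar>\<close> equals
    \<open>ln \<bar>D(\<epsilon> \<i>)\<bar>\<close> (\<open>continuant_jensen\<close>).
  \<^item> Moving the energy from \<open>\<eta> \<i>\<close> to \<open>\<epsilon> \<i>\<close> with \<open>\<epsilon> = 6 \<eta>\<close> at one site never decreases \<open>\<bar>D\<bar>\<close>, and
    at an isolated site it at least doubles \<open>\<bar>D\<bar>\<close> (\<open>raise_one_site\<close>, \<open>continuant_growth\<close>). The reason
    is that \<open>D\<close> factors at each site through \<open>v - m\<close>, where \<open>m\<close> is a sum of two continued fractions
    with nonnegative imaginary part, which at an isolated site are of size at most \<open>\<eta> / 2\<close>.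

  Since \<open>\<bar>D(\<eta> \<i>)\<bar>\<close> controls the norm of the transfer matrix at energy 0 up to a constant, this gives
  a pointwise inequality for the transfer matrices (\<open>transfer_growth\<close>) and, after taking means and
  letting the length tend to infinity, \<open>L(0) + ln 2 * q \<eta> \<le> mean of L(6 \<eta> s)\<close>
  (\<open>lyapunov1_average_gain\<close>). If \<open>L\<close> were Hoelder near 0, then, as \<open>L\<close> grows only logarithmically,
  the right-hand side would be at most \<open>L(0) + O(\<eta>\<^sup>\<beta>)\<close> for some \<open>\<beta> > 0\<close>, which contradicts the
  size of \<open>q \<eta>\<close>.
\<close>

section \<open>Linear recurrences and their Herglotz ratios\<close>

text \<open>The action on column vectors of the product of the matrices with rows \<open>(v, -1)\<close> and \<open>(1, 0)\<close>. It is
  kept separate from matrices and polymorphic because it is needed for real potentials, for complex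
  energies, and for polynomials in the energy.\<close>

primrec act :: "'a::comm_ring_1 list \<Rightarrow> 'a \<times> 'a \<Rightarrow> 'a \<times> 'a" where
  "act [] u = u"
| "act (v # vs) u = (v * fst (act vs u) - snd (act vs u), fst (act vs u))"

text \<open>The determinant of the tridiagonal matrix with diagonal \<open>vs\<close> and off-diagonal entries 1; with
  diagonal \<open>x\<^sub>j - w\<close> it is the characteristic polynomial of a finite Schroedinger operator.\<close>

definition continuant :: "'a::comm_ring_1 list \<Rightarrow> 'a" where
  "continuant vs = fst (act vs (1, 0))"

lemma act_append: "act (l @ r) u = act l (act r u)"
  by (induction l) auto

lemma act_linear:
  "act vs (a, b) = (a * fst (act vs (1, 0)) + b * fst (act vs (0, 1)),
                    a * snd (act vs (1, 0)) + b * snd (act vs (0, 1)))"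
  by (induction vs) (auto simp: algebra_simps)

lemma act_minus: "act vs (- a, - b) = (- fst (act vs (a, b)), - snd (act vs (a, b)))"
  by (induction vs) (auto simp: algebra_simps)

lemma act_of_real:
  "act (map complex_of_real vs) (of_real a, of_real b) =
   (of_real (fst (act vs (a, b))), of_real (snd (act vs (a, b))))"
  by (induction vs) auto

lemma continuant_of_real: "continuant (map complex_of_real vs) = of_real (continuant vs)"
  using act_of_real[of vs 1 0] by (simp add: continuant_def)

lemma act_snoc_01: "act (vs @ [v]) (0, 1) = (- fst (act vs (1, 0)), - snd (act vs (1, 0)))"
  using act_minus[of vs 1 0] by (simp add: act_append)

text \<open>The continued fraction step \<open>m \<mapsto> 1 / (v - m)\<close> preserves the closed upper half-plane when \<open>v\<close> lies
  below the real axis, and its values are bounded by the inverse of the depth of \<open>v\<close>.\<close>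

lemma herglotz_inverse:
  fixes v m :: complex
  assumes "\<eta> > 0" "Im v \<le> - \<eta>" "Im m \<ge> 0"
  shows "v - m \<noteq> 0" "Im (1 / (v - m)) \<ge> 0" "norm (1 / (v - m)) \<le> 1 / \<eta>"
proof -
  have I: "Im (v - m) \<le> - \<eta>" using assms by simp
  then have "v - m \<noteq> 0" using assms(1) by auto
  then show "v - m \<noteq> 0" .
  show "Im (1 / (v - m)) \<ge> 0" using I assms(1) by (simp add: Im_divide divide_nonneg_nonneg)
  have "\<eta> \<le> norm (v - m)" using I abs_Im_le_cmod[of "v - m"] by linarith
  then show "norm (1 / (v - m)) \<le> 1 / \<eta>"
    using assms(1) by (simp add: norm_divide frac_le)
qed

text \<open>The ratio \<open>m\<close> obeys \<open>m' = 1 / (v - m)\<close> when a letter is added on the left of the list.\<close>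

lemma herglotz_right:
  fixes vs :: "complex list"
  assumes "\<eta> > 0" "\<forall>v\<in>set vs. Im v \<le> - \<eta>"
  defines "m \<equiv> snd (act vs (1, 0)) / fst (act vs (1, 0))"
  shows "continuant vs \<noteq> 0" "Im m \<ge> 0" "norm m \<le> 1 / \<eta>"
proof -
  have "fst (act vs (1, 0)) \<noteq> 0 \<and>
     Im (snd (act vs (1, 0)) / fst (act vs (1, 0))) \<ge> 0 \<and>
     norm (snd (act vs (1, 0)) / fst (act vs (1, 0))) \<le> 1 / \<eta>"
    using assms(2)
  proof (induction vs)
    case Nil
    then show ?case using assms(1) by simp
  next
    case (Cons v vs)
    define a b where "a = fst (act vs (1, 0))" and "b = snd (act vs (1, 0))"
    have IH: "a \<noteq> 0" "Im (b / a) \<ge> 0" using Cons by (auto simp: a_def b_def)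
    have v: "Im v \<le> - \<eta>" using Cons by simp
    note H = herglotz_inverse[OF assms(1) v IH(2)]
    have e: "v * a - b = a * (v - b / a)" using IH by (simp add: field_simps)
    have e2: "a / (v * a - b) = 1 / (v - b / a)"
      unfolding e using IH H by (simp add: field_simps)
    show ?case using H IH e e2 by (simp add: a_def[symmetric] b_def[symmetric])
  qed
  then show "continuant vs \<noteq> 0" "Im m \<ge> 0" "norm m \<le> 1 / \<eta>"
    by (auto simp: continuant_def m_def)
qed

text \<open>The same recursion for the other end of the list: \<open>fst (act vs (a, b))\<close> is a linear functional of
  \<open>(a, b)\<close>, and its coefficient ratio changes by a continued fraction step when a letter is
  added on the right.\<close>

lemma herglotz_left:
  fixes vs :: "complex list"
  assumes "\<eta> > 0" "\<forall>v\<in>set vs. Im v \<le> - \<eta>"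
  defines "m \<equiv> - fst (act vs (0, 1)) / fst (act vs (1, 0))"
  shows "Im m \<ge> 0" "norm m \<le> 1 / \<eta>"
proof -
  have "fst (act vs (1, 0)) \<noteq> 0 \<and>
     Im (- fst (act vs (0, 1)) / fst (act vs (1, 0))) \<ge> 0 \<and>
     norm (- fst (act vs (0, 1)) / fst (act vs (1, 0))) \<le> 1 / \<eta>"
    using assms(2)
  proof (induction vs rule: rev_induct)
    case Nil
    then show ?case using assms(1) by simp
  next
    case (snoc v vs)
    define a b where "a = fst (act vs (1, 0))" and "b = - fst (act vs (0, 1))"
    have IH: "a \<noteq> 0" "Im (b / a) \<ge> 0" using snoc by (auto simp: a_def b_def)
    have v: "Im v \<le> - \<eta>" using snoc by simp
    note H = herglotz_inverse[OF assms(1) v IH(2)]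
    have e: "v * a - b = a * (v - b / a)" using IH by (simp add: field_simps)
    have e2: "a / (v * a - b) = 1 / (v - b / a)"
      unfolding e using IH H by (simp add: field_simps)
    have f1: "fst (act (vs @ [v]) (1, 0)) = v * a - b"
      using act_linear[of vs v 1] by (simp add: act_append a_def b_def)
    have f2: "- fst (act (vs @ [v]) (0, 1)) = a"
      by (simp add: act_snoc_01 a_def)
    show ?case unfolding f1 f2 using H IH e e2 by simp
  qed
  then show "Im m \<ge> 0" "norm m \<le> 1 / \<eta>"
    by (auto simp: m_def)
qed

text \<open>As a function of a single entry \<open>v\<close> the determinant is affine, and its zero is the sum of the two
  continued fractions coming from either side.\<close>

lemma continuant_split:
  fixes l r :: "'a::field list"
  assumes "continuant l \<noteq> 0" "continuant r \<noteq> 0"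
  shows "continuant (l @ v # r) = continuant l * continuant r *
    (v - snd (act r (1, 0)) / fst (act r (1, 0)) - (- fst (act l (0, 1)) / fst (act l (1, 0))))"
proof -
  obtain a b where ab: "act r (1, 0) = (a, b)" by (cases "act r (1, 0)")
  define p q where "p = fst (act l (1, 0))" and "q = fst (act l (0, 1))"
  have "p \<noteq> 0" "a \<noteq> 0" using assms by (auto simp: continuant_def p_def ab)
  have "continuant (l @ v # r) = (v * a - b) * p + a * q"
    using act_linear[of l "v * a - b" a]
    by (simp add: continuant_def act_append ab p_def q_def)
  also have "\<dots> = p * a * (v - b / a - (- q / p))"
    using \<open>p \<noteq> 0\<close> \<open>a \<noteq> 0\<close> by (simp add: field_simps)
  finally show ?thesis
    by (simp add: continuant_def ab p_def q_def)
qed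

section \<open>Raising the imaginary part of the energy one site at a time\<close>

text \<open>By the splitting formula the modulus is proportional to \<open>\<bar>x - \<i> \<delta> - m\<bar>\<close> with \<open>Im m \<ge> 0\<close>, so it
  increases with \<open>\<delta>\<close>. If the neighbours are so large that both continued fractions are at most
  \<open>\<eta> / 2\<close>, then at \<open>\<delta> = \<eta>\<close> this quantity is at most \<open>3 \<eta>\<close>, while at \<open>\<delta> = 6 \<eta>\<close> it is at
  least \<open>6 \<eta>\<close>.\<close>

lemma raise_one_site:
  fixes l r :: "complex list" and x \<eta> \<epsilon> :: real
  assumes \<eta>: "\<eta> > 0" "6 * \<eta> = \<epsilon>"
    and l: "\<forall>v\<in>set l. Im v \<le> - \<eta>" and r: "\<forall>v\<in>set r. Im v \<le> - \<eta>"
  shows "norm (continuant (l @ Complex x (- \<eta>) # r)) \<le> norm (continuant (l @ Complex x (- \<epsilon>) # r))"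
    and "\<bar>x\<bar> \<le> \<eta> \<Longrightarrow> l = l' @ [v] \<Longrightarrow> r = w # r' \<Longrightarrow> norm v \<ge> 3 / \<eta> \<Longrightarrow> norm w \<ge> 3 / \<eta> \<Longrightarrow>
      2 * norm (continuant (l @ Complex x (- \<eta>) # r)) \<le> norm (continuant (l @ Complex x (- \<epsilon>) # r))"
proof -
  define mr where "mr = snd (act r (1, 0)) / fst (act r (1, 0))"
  define ml where "ml = - fst (act l (0, 1)) / fst (act l (1, 0))"
  define m where "m = mr + ml"
  note R = herglotz_right[OF \<eta>(1) r, folded mr_def]
  note L = herglotz_left[OF \<eta>(1) l, folded ml_def] herglotz_right(1)[OF \<eta>(1) l]
  have s: "continuant (l @ v # r) = continuant l * continuant r * (v - m)" for v
    using continuant_split[OF L(3) R(1)] by (simp add: m_def mr_def ml_def algebra_simps)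
  have n: "norm (continuant (l @ v # r)) = norm (continuant l * continuant r) * norm (v - m)" for v
    unfolding s norm_mult ..
  have Im: "Im m \<ge> 0" using R L by (simp add: m_def)
  have "norm (Complex x (- \<eta>) - m) \<le> norm (Complex x (- \<epsilon>) - m)"
    unfolding cmod_def
  proof (intro real_sqrt_le_mono add_mono abs_le_square_iff[THEN iffD1])
    show "\<bar>Im (Complex x (- \<eta>) - m)\<bar> \<le> \<bar>Im (Complex x (- \<epsilon>) - m)\<bar>" using \<eta> Im by simp
  qed simp
  then show "norm (continuant (l @ Complex x (- \<eta>) # r)) \<le> norm (continuant (l @ Complex x (- \<epsilon>) # r))"
    unfolding n by (intro mult_left_mono) auto
  {
    assume x: "\<bar>x\<bar> \<le> \<eta>" and ll: "l = l' @ [v]" and rr: "r = w # r'"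
      and v: "norm v \<ge> 3 / \<eta>" and w: "norm w \<ge> 3 / \<eta>"
    (* One continued fraction step with a large letter: the previous ratio is at most 1 / eta. *)
    have bound: "norm (1 / (v - k)) \<le> \<eta> / 2" if "norm v \<ge> 3 / \<eta>" "norm k \<le> 1 / \<eta>" for v k :: complex
    proof -
      have "2 / \<eta> \<le> norm (v - k)"
        using that norm_triangle_ineq2[of v k] by (simp add: diff_divide_distrib[symmetric] field_simps)
      then have "1 / norm (v - k) \<le> 1 / (2 / \<eta>)" using \<eta> by (intro divide_left_mono mult_pos_pos) (auto intro: less_le_trans)
      then show ?thesis by (simp add: norm_divide)
    qed
    have "norm mr \<le> \<eta> / 2"
    proof -
      have r': "\<forall>v\<in>set r'. Im v \<le> - \<eta>" using r rr by simp
      note R' = herglotz_right[OF \<eta>(1) r']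
      have ne: "fst (act r' (1, 0)) \<noteq> 0" using R'(1) by (simp add: continuant_def)
      have "mr = 1 / (w - snd (act r' (1, 0)) / fst (act r' (1, 0)))"
        using ne by (simp add: mr_def rr divide_simps)
      then show ?thesis using bound[OF w R'(3)] by simp
    qed
    moreover have "norm ml \<le> \<eta> / 2"
    proof -
      have l': "\<forall>v\<in>set l'. Im v \<le> - \<eta>" using l ll by simp
      note L' = herglotz_left[OF \<eta>(1) l'] 
      have ne: "fst (act l' (1, 0)) \<noteq> 0" using herglotz_right(1)[OF \<eta>(1) l'] by (simp add: continuant_def)
      have f1: "fst (act l (1, 0)) = v * fst (act l' (1, 0)) + fst (act l' (0, 1))"
        using act_linear[of l' v 1] by (simp add: act_append ll)
      have f2: "- fst (act l (0, 1)) = fst (act l' (1, 0))"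
        by (simp add: act_snoc_01 ll)
      have "ml = 1 / (v - (- fst (act l' (0, 1)) / fst (act l' (1, 0))))"
        unfolding ml_def f1 f2 using ne by (simp add: divide_simps)
      then show ?thesis using bound[OF v L'(2)] by simp
    qed
    ultimately have m: "norm m \<le> \<eta>"
      unfolding m_def by (rule order_trans[OF norm_triangle_le[OF add_mono]]) simp
    have "norm (Complex x (- \<eta>) - m) \<le> norm (Complex x (- \<eta>)) + norm m" by (rule norm_triangle_ineq4)
    also have "norm (Complex x (- \<eta>)) \<le> \<bar>x\<bar> + \<bar>- \<eta>\<bar>" using cmod_le[of "Complex x (- \<eta>)"] by simp
    finally have 1: "norm (Complex x (- \<eta>) - m) \<le> 3 * \<eta>" using x m \<eta> by simp
    have 2: "6 * \<eta> \<le> norm (Complex x (- \<epsilon>) - m)"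
      using abs_Im_le_cmod[of "Complex x (- \<epsilon>) - m"] Im \<eta> by simp
    have "2 * norm (Complex x (- \<eta>) - m) \<le> norm (Complex x (- \<epsilon>) - m)" using 1 2 by simp
    then have "norm (continuant l * continuant r) * (2 * norm (Complex x (- \<eta>) - m))
      \<le> norm (continuant l * continuant r) * norm (Complex x (- \<epsilon>) - m)"
      by (rule mult_left_mono) simp
    then show "2 * norm (continuant (l @ Complex x (- \<eta>) # r)) \<le> norm (continuant (l @ Complex x (- \<epsilon>) # r))"
      unfolding n by (simp add: algebra_simps) 
  }
qed

definition isolated :: "real \<Rightarrow> nat \<Rightarrow> (nat \<Rightarrow> real) \<Rightarrow> nat \<Rightarrow> bool" where
  "isolated \<eta> n x j \<longleftrightarrow> 0 < j \<and> Suc j < n \<and> \<bar>x j\<bar> \<le> \<eta> \<and> \<bar>x (j - 1)\<bar> \<ge> 3 / \<eta> \<and> \<bar>x (Suc j)\<bar> \<ge> 3 / \<eta>"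

lemma rev_upt_split: "k < n \<Longrightarrow> rev [0..<n] = rev [Suc k..<n] @ k # rev [0..<k]"
  using upt_add_eq_append[of 0 "Suc k" "n - Suc k"] by simp

text \<open>The sites are raised one after another; the hybrid \<open>h k\<close> has already been raised at the sites below
  \<open>k\<close>. Each isolated site contributes a factor 2 at its own step, whatever the state of the
  other sites, because the estimate at one site only uses that all imaginary parts are at most \<open>- \<eta>\<close>.\<close>

lemma continuant_growth:
  fixes x :: "nat \<Rightarrow> real"
  assumes \<eta>: "\<eta> > 0" "6 * \<eta> = \<epsilon>"
  shows "ln (norm (continuant (map (\<lambda>j. Complex (x j) (- \<eta>)) (rev [0..<n])))) +
      ln 2 * (\<Sum>j<n. of_bool (isolated \<eta> n x j))
    \<le> ln (norm (continuant (map (\<lambda>j. Complex (x j) (- \<epsilon>)) (rev [0..<n]))))"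
proof -
  define e where "e k j = (if j < k then \<epsilon> else \<eta>)" for k j :: nat
  define h where "h k = continuant (map (\<lambda>j. Complex (x j) (- e k j)) (rev [0..<n]))" for k
  have eps: "e k j \<ge> \<eta>" for k j using \<eta> by (simp add: e_def)
  have h0: "h k \<noteq> 0" for k
    unfolding h_def by (rule herglotz_right(1)[OF \<eta>(1)]) (use eps in auto)
  have step: "ln (norm (h k)) + ln 2 * of_bool (isolated \<eta> n x k) \<le> ln (norm (h (Suc k)))" if k: "k < n" for k
  proof -
    define l where "l = map (\<lambda>j. Complex (x j) (- \<eta>)) (rev [Suc k..<n])"
    define r where "r = map (\<lambda>j. Complex (x j) (- \<epsilon>)) (rev [0..<k])"
    have hk: "h k = continuant (l @ Complex (x k) (- \<eta>) # r)"
      unfolding h_def rev_upt_split[OF k] l_def r_def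
      by (rule arg_cong[where f = continuant]) (auto simp: e_def)
    have hSk: "h (Suc k) = continuant (l @ Complex (x k) (- \<epsilon>) # r)"
      unfolding h_def rev_upt_split[OF k] l_def r_def
      by (rule arg_cong[where f = continuant]) (auto simp: e_def)
    have lI: "\<forall>v\<in>set l. Im v \<le> - \<eta>" by (auto simp: l_def)
    have rI: "\<forall>v\<in>set r. Im v \<le> - \<eta>" using \<eta> by (auto simp: r_def)
    note S = raise_one_site[OF \<eta> lI rI, of "x k"]
    show ?thesis
    proof (cases "isolated \<eta> n x k")
      case False
      then show ?thesis using S(1) h0[of k] h0[of "Suc k"] by (simp add: hk hSk)
    next
      case True
      then have k2: "0 < k" "Suc k < n" "\<bar>x k\<bar> \<le> \<eta>" "3 / \<eta> \<le> \<bar>x (k - 1)\<bar>" "3 / \<eta> \<le> \<bar>x (Suc k)\<bar>"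
        by (auto simp: isolated_def)
      have "[Suc k..<n] = Suc k # [Suc (Suc k)..<n]" using k2 by (simp add: upt_conv_Cons)
      then have l: "l = map (\<lambda>j. Complex (x j) (- \<eta>)) (rev [Suc (Suc k)..<n]) @ [Complex (x (Suc k)) (- \<eta>)]"
        by (simp add: l_def)
      have "[0..<k] = [0..<k - 1] @ [k - 1]"
        using k2 upt_Suc_append[of 0 "k - 1"] by simp
      then have r: "r = Complex (x (k - 1)) (- \<epsilon>) # map (\<lambda>j. Complex (x j) (- \<epsilon>)) (rev [0..<k - 1])"
        by (simp add: r_def)
      have big: "3 / \<eta> \<le> norm (Complex y z)" if "3 / \<eta> \<le> \<bar>y\<bar>" for y z
        using that abs_Re_le_cmod[of "Complex y z"] by simp
      have "2 * norm (h k) \<le> norm (h (Suc k))"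
        unfolding hk hSk using S(2)[OF k2(3) l r] k2 big by blast
      then have "ln (2 * norm (h k)) \<le> ln (norm (h (Suc k)))"
        using h0[of k] h0[of "Suc k"] by simp
      then show ?thesis using True h0[of k] by (simp add: ln_mult)
    qed
  qed
  have A: "ln (norm (h 0)) + ln 2 * (\<Sum>j<k. of_bool (isolated \<eta> n x j)) \<le> ln (norm (h k))" if "k \<le> n" for k
    using that
  proof (induction k)
    case (Suc k)
    then show ?case using step[of k] by (simp add: distrib_left)
  qed simp
  have B: "h n = continuant (map (\<lambda>j. Complex (x j) (- \<epsilon>)) (rev [0..<n]))"
    unfolding h_def by (rule arg_cong[where f = continuant]) (auto simp: e_def)
  have C: "h 0 = continuant (map (\<lambda>j. Complex (x j) (- \<eta>)) (rev [0..<n]))"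
    unfolding h_def by (rule arg_cong[where f = continuant]) (auto simp: e_def)
  show ?thesis using A[of n] unfolding B C by blast
qed

section \<open>The Cauchy law\<close>

lemma integrable_inverse_sqrt:
  assumes "c \<ge> 0"
  shows "integrable lborel (\<lambda>y::real. indicator {0..c} y * y powr (-1/2))"
    and "(\<integral>y. indicator {0..c} y * y powr (-1/2) \<partial>lborel) = 2 * c powr (1/2)"
proof -
  have h: "((\<lambda>y. y powr (-1/2)) has_integral (c powr (-1/2 + 1) / (-1/2 + 1))) {0..c}"
    using assms by (intro has_integral_powr_from_0) auto
  have "(\<lambda>y. y powr (-1/2)) absolutely_integrable_on {0..c}"
    using h by (intro nonnegative_absolutely_integrable_1) auto
  then have i: "set_integrable lebesgue {0..c} (\<lambda>y. y powr (-1/2))" .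
  then have "integrable lebesgue (\<lambda>y::real. indicator {0..c} y * y powr (-1/2))"
    by (simp add: set_integrable_def)
  then show I: "integrable lborel (\<lambda>y::real. indicator {0..c} y * y powr (-1/2))"
    by (subst (asm) integrable_completion) auto
  have "(\<integral>y. indicator {0..c} y * y powr (-1/2) \<partial>lborel) = (\<integral>y. indicator {0..c} y * y powr (-1/2) \<partial>lebesgue)"
    by (subst integral_completion) auto
  also have "\<dots> = integral {0..c} (\<lambda>y. y powr (-1/2))"
    using set_lebesgue_integral_eq_integral(2)[OF i] by (simp add: set_lebesgue_integral_def)
  also have "\<dots> = 2 * c powr (1/2)"
    using h by (simp add: integral_unique)
  finally show "(\<integral>y. indicator {0..c} y * y powr (-1/2) \<partial>lborel) = 2 * c powr (1/2)" .
qed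

lemma neg_ln_le_inverse_sqrt:
  assumes "y > (0::real)"
  shows "- ln y \<le> 2 * y powr (-1/2)"
proof -
  have "ln (y powr (-1/2)) \<le> y powr (-1/2) - 1" using assms by (intro ln_le_minus_one) auto
  then show ?thesis using assms by (simp add: ln_powr)
qed

abbreviation half_turn :: "real set" where "half_turn \<equiv> {- pi / 2..<pi / 2}"

text \<open>The part of the shifted period that leaves the fundamental interval is moved back by \<open>pi\<close>.\<close>

lemma periodic_integral_shift:
  fixes h :: "real \<Rightarrow> real"
  assumes [measurable]: "h \<in> borel_measurable borel"
    and per: "\<And>y. h (y + pi) = h y"
    and int: "integrable lborel (\<lambda>y. indicator half_turn y * h y)"
    and \<psi>: "0 \<le> \<psi>" "\<psi> \<le> pi"
  shows "integrable lborel (\<lambda>y. indicator half_turn y * h (y + \<psi>))"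
    and "(\<integral>y. indicator half_turn y * h (y + \<psi>) \<partial>lborel) = (\<integral>y. indicator half_turn y * h y \<partial>lborel)"
proof -
  define A B where "A = {- pi / 2 + \<psi>..<pi / 2}" and "B = {- pi / 2..<- pi / 2 + \<psi>}"
  have iA: "integrable lborel (\<lambda>y. indicator A y * h y)"
    by (rule Bochner_Integration.integrable_bound[OF int]) (use \<psi> in \<open>auto simp: A_def indicator_def\<close>)
  have iB: "integrable lborel (\<lambda>y. indicator B y * h y)"
    by (rule Bochner_Integration.integrable_bound[OF int]) (use \<psi> in \<open>auto simp: B_def indicator_def\<close>)
  have split: "indicator half_turn y * h y = indicator A y * h y + indicator B y * h y" for y
    using \<psi> by (auto simp: A_def B_def indicator_def)
  have shift: "indicator half_turn y * h (y + \<psi>) =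
     indicator A (\<psi> + 1 * y) * h (\<psi> + 1 * y) +
     indicator B ((\<psi> - pi) + 1 * y) * h ((\<psi> - pi) + 1 * y)" for y
  proof -
    have "h ((\<psi> - pi) + y) = h (y + \<psi>)" using per[of "(\<psi> - pi) + y"] by (simp add: algebra_simps)
    then show ?thesis using \<psi> by (auto simp: A_def B_def indicator_def algebra_simps)
  qed
  have iA': "integrable lborel (\<lambda>y. indicator A (\<psi> + 1 * y) * h (\<psi> + 1 * y))"
    using lborel_integrable_real_affine[OF iA, of 1 \<psi>] by simp
  have iB': "integrable lborel (\<lambda>y. indicator B ((\<psi> - pi) + 1 * y) * h ((\<psi> - pi) + 1 * y))"
    using lborel_integrable_real_affine[OF iB, of 1 "\<psi> - pi"] by simp
  show "integrable lborel (\<lambda>y. indicator half_turn y * h (y + \<psi>))"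
    unfolding shift using iA' iB' by (rule Bochner_Integration.integrable_add)
  have "(\<integral>y. indicator half_turn y * h (y + \<psi>) \<partial>lborel) =
     (\<integral>y. indicator A (\<psi> + 1 * y) * h (\<psi> + 1 * y) \<partial>lborel) +
     (\<integral>y. indicator B ((\<psi> - pi) + 1 * y) * h ((\<psi> - pi) + 1 * y) \<partial>lborel)"
    unfolding shift using iA' iB' by (rule Bochner_Integration.integral_add)
  also have "\<dots> = (\<integral>y. indicator A y * h y \<partial>lborel) + (\<integral>y. indicator B y * h y \<partial>lborel)"
    using lborel_integral_real_affine[of 1 "\<lambda>y. indicator A y * h y" \<psi>]
      lborel_integral_real_affine[of 1 "\<lambda>y. indicator B y * h y" "\<psi> - pi"] by simp
  also have "\<dots> = (\<integral>y. indicator half_turn y * h y \<partial>lborel)"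
    unfolding split using iA iB by (rule Bochner_Integration.integral_add[symmetric])
  finally show "(\<integral>y. indicator half_turn y * h (y + \<psi>) \<partial>lborel) = (\<integral>y. indicator half_turn y * h y \<partial>lborel)" .
qed

text \<open>A crude form of the Jordan inequality, which suffices to make \<open>cos\<^sup>-\<^sup>1\<^sup>/\<^sup>2\<close> integrable at the
  endpoints of the half turn.\<close>

lemma sin_ge_quarter:
  assumes "0 \<le> y" "y \<le> pi / 2"
  shows "y / 4 \<le> sin y"
proof (cases "y \<le> pi / 3")
  case True
  have "sin 0 - 0 / 2 \<le> sin y - y / 2"
  proof (rule DERIV_nonneg_imp_nondecreasing[where f = "\<lambda>y. sin y - y / 2"])
    show "0 \<le> y" by fact
  next
    fix x :: real assume x: "0 \<le> x" "x \<le> y"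
    have "cos (pi / 3) \<le> cos x" using x True by (intro cos_monotone_0_pi_le) auto
    then show "\<exists>d. ((\<lambda>y. sin y - y / 2) has_real_derivative d) (at x) \<and> 0 \<le> d"
      by (intro exI[of _ "cos x - 1/2"]) (auto intro!: derivative_eq_intros simp: cos_60)
  qed
  then show ?thesis using assms by simp
next
  case False
  have "sin (pi / 3) \<le> sin y" using False assms by (intro sin_monotone_2pi_le) auto
  moreover have "sqrt 3 \<ge> (1::real)" by (rule real_sqrt_ge_one) simp
  ultimately have "1 / 2 \<le> sin y" by (simp only: sin_60)
  moreover have "y \<le> 2" using assms pi_less_4 by linarith
  ultimately show ?thesis by linarith
qed

lemma inverse_sqrt_cos_bound:
  assumes "- pi / 2 < \<theta>" "\<theta> < pi / 2"
  shows "0 < cos \<theta>"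
    "cos \<theta> powr (-1/2) \<le> 2 * ((pi / 2 - \<theta>) powr (-1/2) + (pi / 2 + \<theta>) powr (-1/2))"
proof -
  show c: "0 < cos \<theta>" using assms by (intro cos_gt_zero_pi) auto
  have "(pi / 2 - \<bar>\<theta>\<bar>) / 4 \<le> sin (pi / 2 - \<bar>\<theta>\<bar>)" using assms by (intro sin_ge_quarter) auto
  also have "\<dots> = cos \<theta>" by (simp add: sin_diff)
  finally have "cos \<theta> powr (-1/2) \<le> ((pi / 2 - \<bar>\<theta>\<bar>) / 4) powr (-1/2)"
    using assms by (intro powr_mono2') auto
  also have "\<dots> = 2 * (pi / 2 - \<bar>\<theta>\<bar>) powr (-1/2)"
  proof -
    have "(4::real) powr (-1/2) = 1 / 2"
      by (simp add: powr_minus powr_half_sqrt divide_inverse[symmetric] inverse_eq_divide)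
    moreover have "((pi / 2 - \<bar>\<theta>\<bar>) / 4) powr (-1/2) = (pi / 2 - \<bar>\<theta>\<bar>) powr (-1/2) / 4 powr (-1/2)"
      by (rule powr_divide)
    ultimately show ?thesis by (simp only:) (simp add: field_simps)
  qed
  also have "\<dots> \<le> 2 * ((pi / 2 - \<theta>) powr (-1/2) + (pi / 2 + \<theta>) powr (-1/2))"
    by (cases "\<theta> \<ge> 0") auto
  finally show "cos \<theta> powr (-1/2) \<le> 2 * ((pi / 2 - \<theta>) powr (-1/2) + (pi / 2 + \<theta>) powr (-1/2))" .
qed

lemma integrable_inverse_sqrt_cos:
  "integrable lborel (\<lambda>\<theta>. indicator half_turn \<theta> * \<bar>cos \<theta>\<bar> powr (-1/2))"
proof -
  note i = integrable_inverse_sqrt(1)[of pi]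
  have "integrable lborel (\<lambda>\<theta>. 2 * (indicator {0..pi} (pi / 2 + (-1) * \<theta>) * (pi / 2 + (-1) * \<theta>) powr (-1/2)
     + indicator {0..pi} (pi / 2 + 1 * \<theta>) * (pi / 2 + 1 * \<theta>) powr (-1/2)))"
    by (intro integrable_mult_right Bochner_Integration.integrable_add lborel_integrable_real_affine i) auto
  then show ?thesis
  proof (rule Bochner_Integration.integrable_bound)
    have *: "norm (indicator half_turn \<theta> * \<bar>cos \<theta>\<bar> powr (-1/2))
      \<le> norm (2 * (indicator {0..pi} (pi / 2 + (-1) * \<theta>) * (pi / 2 + (-1) * \<theta>) powr (-1/2)
     + indicator {0..pi} (pi / 2 + 1 * \<theta>) * (pi / 2 + 1 * \<theta>) powr (-1/2)))" if "\<theta> \<noteq> - pi / 2" for \<theta> :: real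
    proof (cases "\<theta> \<in> half_turn")
      case True
      then have t: "- pi / 2 < \<theta>" "\<theta> < pi / 2" using that by auto
      then show ?thesis using inverse_sqrt_cos_bound[OF t] by (simp add: indicator_def)
    qed simp
    have "AE \<theta> in lborel. \<theta> \<noteq> - pi / 2" by (rule AE_lborel_singleton)
    then show "AE \<theta> in lborel. norm (indicator half_turn \<theta> * \<bar>cos \<theta>\<bar> powr (-1/2))
      \<le> norm (2 * (indicator {0..pi} (pi / 2 + (-1) * \<theta>) * (pi / 2 + (-1) * \<theta>) powr (-1/2)
     + indicator {0..pi} (pi / 2 + 1 * \<theta>) * (pi / 2 + 1 * \<theta>) powr (-1/2)))"
      by (rule AE_mp) (use * in auto)
  qed simp
qed

lemma integrable_ln_cos:
  "integrable lborel (\<lambda>\<theta>. indicator half_turn \<theta> * ln \<bar>cos \<theta>\<bar>)"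
proof (rule Bochner_Integration.integrable_bound[OF integrable_mult_right[OF integrable_inverse_sqrt_cos, of 2]])
  have "norm (indicator half_turn \<theta> * ln \<bar>cos \<theta>\<bar>) \<le> norm (2 * (indicator half_turn \<theta> * \<bar>cos \<theta>\<bar> powr (-1/2)))" for \<theta> :: real
  proof (cases "cos \<theta> = 0")
    case False
    then have "ln \<bar>cos \<theta>\<bar> \<le> 0" by (simp add: abs_cos_le_one)
    then show ?thesis using neg_ln_le_inverse_sqrt[of "\<bar>cos \<theta>\<bar>"] False by (auto simp: indicator_def)
  qed simp
  then show "AE \<theta> in lborel. norm (indicator half_turn \<theta> * ln \<bar>cos \<theta>\<bar>) \<le> norm (2 * (indicator half_turn \<theta> * \<bar>cos \<theta>\<bar> powr (-1/2)))"
    by auto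
qed simp

text \<open>The standard Cauchy distribution. Writing it as the image of a uniform angle turns averages of
  \<open>ln \<bar>\<epsilon> s - t\<bar>\<close> into integrals of \<open>ln \<bar>cos\<bar>\<close> over a full period.\<close>

definition cauchy_law :: "real measure" where
  "cauchy_law = distr (uniform_measure lborel half_turn) borel tan"

lemma sets_cauchy_law [measurable_cong]: "sets cauchy_law = sets borel"
  by (simp add: cauchy_law_def)

lemma measurable_tan [measurable]: "tan \<in> borel_measurable (borel :: real measure)"
  unfolding tan_def [abs_def] by measurable

lemma emeasure_half_turn: "emeasure lborel half_turn = ennreal pi"
  by simp

lemma prob_space_cauchy_law: "prob_space cauchy_law"
  unfolding cauchy_law_def
  by (intro prob_space.prob_space_distr prob_space_uniform_measure) (auto simp: emeasure_half_turn)

lemma uniform_half_turn: "uniform_measure lborel half_turn = density lborel (\<lambda>\<theta>. ennreal (indicator half_turn \<theta> / pi))"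
  unfolding uniform_measure_def
  by (rule arg_cong[where f = "density lborel"])
    (auto simp: fun_eq_iff emeasure_half_turn indicator_def divide_ennreal[symmetric] ennreal_1[symmetric] simp del: ennreal_1)

lemma cauchy_law_integrable_iff:
  fixes f :: "real \<Rightarrow> real"
  assumes [measurable]: "f \<in> borel_measurable borel"
  shows "integrable cauchy_law f \<longleftrightarrow> integrable lborel (\<lambda>\<theta>. indicator half_turn \<theta> * f (tan \<theta>))"
proof -
  have "integrable cauchy_law f \<longleftrightarrow> integrable (uniform_measure lborel half_turn) (\<lambda>\<theta>. f (tan \<theta>))"
    unfolding cauchy_law_def by (rule integrable_distr_eq) auto
  also have "\<dots> \<longleftrightarrow> integrable lborel (\<lambda>\<theta>. (indicator half_turn \<theta> / pi) *\<^sub>R f (tan \<theta>))"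
    unfolding uniform_half_turn by (rule integrable_density) auto
  also have "(\<lambda>\<theta>. (indicator half_turn \<theta> / pi) *\<^sub>R f (tan \<theta>)) = (\<lambda>\<theta>. (indicator half_turn \<theta> * f (tan \<theta>)) / pi)"
    by (auto simp: fun_eq_iff)
  also have "\<dots> = (\<lambda>\<theta>. (1 / pi) * (indicator half_turn \<theta> * f (tan \<theta>)))"
    by (auto simp: fun_eq_iff)
  finally show ?thesis by (subst (asm) integrable_mult_left_iff) auto
qed

lemma cauchy_law_integral:
  fixes f :: "real \<Rightarrow> real"
  assumes [measurable]: "f \<in> borel_measurable borel"
  shows "(\<integral>s. f s \<partial>cauchy_law) = (\<integral>\<theta>. indicator half_turn \<theta> * f (tan \<theta>) \<partial>lborel) / pi"
proof -
  have "(\<integral>s. f s \<partial>cauchy_law) = (\<integral>\<theta>. f (tan \<theta>) \<partial>uniform_measure lborel half_turn)"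
    unfolding cauchy_law_def by (rule integral_distr) auto
  also have "\<dots> = (\<integral>\<theta>. (indicator half_turn \<theta> / pi) *\<^sub>R f (tan \<theta>) \<partial>lborel)"
    unfolding uniform_half_turn by (rule integral_density) auto
  also have "(\<lambda>\<theta>. (indicator half_turn \<theta> / pi) *\<^sub>R f (tan \<theta>)) = (\<lambda>\<theta>. (indicator half_turn \<theta> * f (tan \<theta>)) / pi)"
    by (auto simp: fun_eq_iff)
  finally show ?thesis by simp
qed

lemma cauchy_law_integrable_sqrt: "integrable cauchy_law (\<lambda>s. \<bar>s\<bar> powr (1/2))"
proof (subst cauchy_law_integrable_iff)
  show "integrable lborel (\<lambda>\<theta>. indicator half_turn \<theta> * \<bar>tan \<theta>\<bar> powr (1/2))"
  proof (rule Bochner_Integration.integrable_bound[OF integrable_inverse_sqrt_cos])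
    have "\<bar>tan \<theta>\<bar> powr (1/2) \<le> \<bar>cos \<theta>\<bar> powr (-1/2)" for \<theta> :: real
    proof -
      have "\<bar>tan \<theta>\<bar> \<le> 1 / \<bar>cos \<theta>\<bar>" by (simp add: tan_def abs_divide divide_right_mono)
      then have "\<bar>tan \<theta>\<bar> powr (1/2) \<le> (1 / \<bar>cos \<theta>\<bar>) powr (1/2)" by (intro powr_mono2) auto
      also have "\<dots> = \<bar>cos \<theta>\<bar> powr (-1/2)"
        by (cases "cos \<theta> = 0") (auto simp: powr_divide powr_minus inverse_eq_divide)
      finally show ?thesis .
    qed
    then show "AE \<theta> in lborel. norm (indicator half_turn \<theta> * \<bar>tan \<theta>\<bar> powr (1/2)) \<le> norm (indicator half_turn \<theta> * \<bar>cos \<theta>\<bar> powr (-1/2))"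
      by (auto simp: indicator_def)
  qed simp
qed simp

lemma cauchy_law_singleton: "AE s in cauchy_law. s \<noteq> t"
proof -
  have "AE \<theta> in uniform_measure lborel half_turn. tan \<theta> \<noteq> t"
    unfolding uniform_half_turn
  proof (subst AE_density)
    have "AE \<theta> in lborel. \<theta> \<noteq> - pi / 2 \<and> \<theta> \<noteq> arctan t"
      by (intro AE_conjI AE_lborel_singleton)
    then show "AE \<theta> in lborel. 0 < ennreal (indicator half_turn \<theta> / pi) \<longrightarrow> tan \<theta> \<noteq> t"
    proof (rule AE_mp, intro AE_I2 impI)
      fix \<theta> :: real assume "\<theta> \<noteq> - pi / 2 \<and> \<theta> \<noteq> arctan t" "0 < ennreal (indicator half_turn \<theta> / pi)"
      then have "- pi / 2 < \<theta>" "\<theta> < pi / 2" "\<theta> \<noteq> arctan t"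
        by (cases "\<theta> \<in> half_turn"; simp)+
      then show "tan \<theta> \<noteq> t" using arctan_unique[of \<theta> t] by auto
    qed
  qed simp
  then show ?thesis
    unfolding cauchy_law_def by (subst AE_distr_iff) auto
qed

text \<open>With \<open>s = tan \<theta>\<close> and \<open>\<phi> = arctan (t / \<epsilon>)\<close> one has
  \<open>\<epsilon> s - t = \<bar>t + \<i> \<epsilon>\<bar> sin (\<theta> - \<phi>) / cos \<theta>\<close>. The integrals of \<open>ln \<bar>sin (\<theta> - \<phi>)\<bar>\<close> and of
  \<open>ln (cos \<theta>)\<close> over a period agree and cancel.\<close>

lemma cauchy_law_ln:
  assumes "\<epsilon> > 0"
  shows "integrable cauchy_law (\<lambda>s. ln \<bar>\<epsilon> * s - t\<bar>)"
    and "(\<integral>s. ln \<bar>\<epsilon> * s - t\<bar> \<partial>cauchy_law) = ln (norm (Complex t \<epsilon>))"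
proof -
  define \<phi> where "\<phi> = arctan (t / \<epsilon>)"
  define c where "c = ln (norm (Complex t \<epsilon>))"
  define \<psi> where "\<psi> = pi / 2 - \<phi>"
  have \<phi>: "- pi / 2 < \<phi>" "\<phi> < pi / 2" using arctan_bounded[of "t / \<epsilon>"] by (auto simp: \<phi>_def)
  have N: "norm (Complex t \<epsilon>) = \<epsilon> * sqrt (1 + (t / \<epsilon>)\<^sup>2)"
  proof -
    have "\<epsilon> * sqrt (1 + (t / \<epsilon>)\<^sup>2) = sqrt (\<epsilon>\<^sup>2 * (1 + (t / \<epsilon>)\<^sup>2))"
      using assms by (simp add: real_sqrt_mult)
    also have "\<epsilon>\<^sup>2 * (1 + (t / \<epsilon>)\<^sup>2) = t\<^sup>2 + \<epsilon>\<^sup>2" using assms by (simp add: field_simps)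
    finally show ?thesis by (simp add: cmod_def)
  qed
  have S0: "sqrt (1 + (t / \<epsilon>)\<^sup>2) > 0" by (simp add: add_pos_nonneg)
  have tan_eq: "ln \<bar>\<epsilon> * tan \<theta> - t\<bar> = c + ln \<bar>cos (\<theta> + \<psi>)\<bar> - ln \<bar>cos \<theta>\<bar>"
    if "\<theta> \<in> half_turn" "\<theta> \<noteq> - pi / 2" "\<theta> \<noteq> \<phi>" for \<theta>
  proof -
    have c0: "cos \<theta> > 0" using that by (intro cos_gt_zero_pi) auto
    have "sin (\<theta> - \<phi>) \<noteq> 0"
    proof
      assume "sin (\<theta> - \<phi>) = 0"
      moreover have "- pi < \<theta> - \<phi>" "\<theta> - \<phi> < pi" using that \<phi> by auto
      ultimately have "\<theta> - \<phi> = 0" using sin_eq_0_pi by blast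
      then show False using that by simp
    qed
    have "cos (\<theta> + \<psi>) = - sin (\<theta> - \<phi>)" by (simp add: \<psi>_def cos_add sin_add cos_diff sin_diff)
    moreover have "\<epsilon> * tan \<theta> - t = norm (Complex t \<epsilon>) * sin (\<theta> - \<phi>) / cos \<theta>"
      unfolding N sin_diff \<phi>_def cos_arctan sin_arctan tan_def
      using c0 S0 assms by (simp add: field_simps)
    ultimately have "\<bar>\<epsilon> * tan \<theta> - t\<bar> = norm (Complex t \<epsilon>) * \<bar>cos (\<theta> + \<psi>)\<bar> / \<bar>cos \<theta>\<bar>"
      by (simp add: abs_mult)
    moreover have "norm (Complex t \<epsilon>) > 0" using assms by (simp add: complex_eq_iff)
    ultimately show ?thesis
      using c0 \<open>sin (\<theta> - \<phi>) \<noteq> 0\<close> \<open>cos (\<theta> + \<psi>) = - sin (\<theta> - \<phi>)\<close>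
      by (simp add: c_def ln_mult ln_div)
  qed
  (* Shift the argument so that the sine becomes a cosine; 0 <= psi <= pi. *)
  have per: "ln \<bar>cos (y + pi)\<bar> = ln \<bar>cos y\<bar>" for y :: real by simp
  note P = periodic_integral_shift[OF _ per integrable_ln_cos, of \<psi>]
  have \<psi>: "0 \<le> \<psi>" "\<psi> \<le> pi" using \<phi> by (auto simp: \<psi>_def)
  have iS: "integrable lborel (\<lambda>\<theta>. indicator half_turn \<theta> * ln \<bar>cos (\<theta> + \<psi>)\<bar>)"
    using P(1) \<psi> by simp
  have i0: "integrable lborel (\<lambda>\<theta>. c * indicator half_turn \<theta>)"
    by (intro integrable_mult_right integrable_real_indicator) (auto simp: emeasure_half_turn)
  have AE: "AE \<theta> in lborel. indicator half_turn \<theta> * ln \<bar>\<epsilon> * tan \<theta> - t\<bar> =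
     c * indicator half_turn \<theta> + indicator half_turn \<theta> * ln \<bar>cos (\<theta> + \<psi>)\<bar> - indicator half_turn \<theta> * ln \<bar>cos \<theta>\<bar>"
  proof -
    have "AE \<theta> in lborel. \<theta> \<noteq> - pi / 2 \<and> \<theta> \<noteq> \<phi>" by (intro AE_conjI AE_lborel_singleton)
    then show ?thesis
      by (rule AE_mp) (use tan_eq in \<open>auto simp: indicator_def\<close>)
  qed
  have iall: "integrable lborel (\<lambda>\<theta>. c * indicator half_turn \<theta> + indicator half_turn \<theta> * ln \<bar>cos (\<theta> + \<psi>)\<bar> - indicator half_turn \<theta> * ln \<bar>cos \<theta>\<bar>)"
    by (intro Bochner_Integration.integrable_diff Bochner_Integration.integrable_add i0 iS integrable_ln_cos)
  show "integrable cauchy_law (\<lambda>s. ln \<bar>\<epsilon> * s - t\<bar>)"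
    by (subst cauchy_law_integrable_iff, measurable, subst integrable_cong_AE[OF _ _ AE]) (use iall in auto)
  have "(\<integral>s. ln \<bar>\<epsilon> * s - t\<bar> \<partial>cauchy_law) =
    (\<integral>\<theta>. c * indicator half_turn \<theta> + indicator half_turn \<theta> * ln \<bar>cos (\<theta> + \<psi>)\<bar> - indicator half_turn \<theta> * ln \<bar>cos \<theta>\<bar> \<partial>lborel) / pi"
    by (subst cauchy_law_integral, measurable, subst integral_cong_AE[OF _ _ AE]) auto
  also have "(\<integral>\<theta>. c * indicator half_turn \<theta> + indicator half_turn \<theta> * ln \<bar>cos (\<theta> + \<psi>)\<bar> - indicator half_turn \<theta> * ln \<bar>cos \<theta>\<bar> \<partial>lborel)
    = (\<integral>\<theta>. c * indicator half_turn \<theta> \<partial>lborel) + (\<integral>\<theta>. indicator half_turn \<theta> * ln \<bar>cos (\<theta> + \<psi>)\<bar> \<partial>lborel) - (\<integral>\<theta>. indicator half_turn \<theta> * ln \<bar>cos \<theta>\<bar> \<partial>lborel)"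
    using i0 iS integrable_ln_cos by simp
  also have "\<dots> = c * pi"
    using P(2) \<psi> by (simp add: measure_def emeasure_half_turn)
  finally show "(\<integral>s. ln \<bar>\<epsilon> * s - t\<bar> \<partial>cauchy_law) = ln (norm (Complex t \<epsilon>))"
    by (simp add: c_def)
qed

section \<open>Real roots and averaging over real energies\<close>

lemma poly_act:
  fixes ps :: "complex poly list"
  shows "act (map (\<lambda>p. poly p w) ps) (poly a w, poly b w) =
    (poly (fst (act ps (a, b))) w, poly (snd (act ps (a, b))) w)"
  by (induction ps) auto

lemma continuant_cnj: "continuant (map cnj vs) = cnj (continuant vs)"
proof -
  have "act (map cnj vs) (cnj a, cnj b) = (cnj (fst (act vs (a, b))), cnj (snd (act vs (a, b))))" for a b
    by (induction vs) auto
  from this[of 1 0] show ?thesis by (simp add: continuant_def)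
qed

text \<open>These are the eigenvalues of a real symmetric matrix. Off the real axis the continued fractions stay
  in a half-plane, so no factor of the determinant vanishes.\<close>

lemma continuant_real_energy:
  assumes "continuant (map (\<lambda>x. complex_of_real x - w) xs) = 0"
  shows "Im w = 0"
proof (rule ccontr)
  assume "Im w \<noteq> 0"
  then consider "Im w > 0" | "Im w < 0" by linarith
  then show False
  proof cases
    case 1
    then show False
      using herglotz_right(1)[of "Im w" "map (\<lambda>x. complex_of_real x - w) xs"] assms by auto
  next
    case 2
    have "map cnj (map (\<lambda>x. complex_of_real x - w) xs) = map (\<lambda>x. complex_of_real x - cnj w) xs" by simp
    then have "continuant (map (\<lambda>x. complex_of_real x - cnj w) xs) = 0"
      using continuant_cnj[of "map (\<lambda>x. complex_of_real x - w) xs"] assms by (simp del: map_map)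
    then show False
      using herglotz_right(1)[of "- Im w" "map (\<lambda>x. complex_of_real x - cnj w) xs"] 2 by auto
  qed
qed

lemma continuant_factorization:
  obtains c :: complex and ts :: "real multiset" where "c \<noteq> 0"
    "\<And>w. continuant (map (\<lambda>x. complex_of_real x - w) xs) = c * (\<Prod>t\<in>#ts. (w - of_real t))"
proof -
  define P where "P = fst (act (map (\<lambda>x. [:complex_of_real x, -1:]) xs) (1, 0))"
  have P: "poly P w = continuant (map (\<lambda>x. complex_of_real x - w) xs)" for w
    using poly_act[of w "map (\<lambda>x. [:complex_of_real x, -1:]) xs" 1 0]
    by (simp add: P_def continuant_def comp_def)
  have "poly P \<i> \<noteq> 0" using continuant_real_energy[of \<i> xs] P by auto
  then have "P \<noteq> 0" by auto
  then obtain A where A: "P = smult (lead_coeff P) (\<Prod>x\<in>#A. [:-x, 1:])"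
    using alg_closed_imp_factorization by blast
  have PA: "poly P w = lead_coeff P * (\<Prod>x\<in>#A. (w - x))" for w
    by (subst A) (simp add: poly_prod_mset multiset.map_comp comp_def)
  have "Im x = 0" if "x \<in># A" for x
  proof -
    have "poly P x = 0" unfolding PA using that by auto
    then show ?thesis using continuant_real_energy P by metis
  qed
  then have "image_mset (\<lambda>x. complex_of_real (Re x)) A = image_mset id A"
    by (intro image_mset_cong) (auto simp: complex_eq_iff)
  then have AR: "A = image_mset complex_of_real (image_mset Re A)"
    by (simp add: multiset.map_comp comp_def)
  show thesis
  proof (rule that)
    show "lead_coeff P \<noteq> 0" using \<open>P \<noteq> 0\<close> by simp
    show "continuant (map (\<lambda>x. complex_of_real x - w) xs) =
      lead_coeff P * (\<Prod>t\<in>#image_mset Re A. (w - of_real t))" for w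
      unfolding P[symmetric] PA by (subst AR) (simp add: multiset.map_comp comp_def)
  qed
qed

lemma shift_down: "map (\<lambda>x. Complex x (- \<eta>)) xs = map (\<lambda>x. complex_of_real x - Complex 0 \<eta>) xs"
  by (simp add: complex_eq_iff)

lemma prod_mset_mono_nonneg:
  fixes f g :: "'a \<Rightarrow> real"
  assumes "\<And>t. 0 \<le> f t \<and> f t \<le> g t"
  shows "0 \<le> (\<Prod>t\<in>#T. f t) \<and> (\<Prod>t\<in>#T. f t) \<le> (\<Prod>t\<in>#T. g t)"
proof (induction T)
  case (add t T)
  have "0 \<le> g t" using assms[of t] by linarith
  then show ?case using add assms[of t] by (auto intro!: mult_mono)
qed simp

lemma prod_mset_positive:
  fixes f :: "'a \<Rightarrow> real"
  shows "(\<And>t. t \<in># T \<Longrightarrow> 0 < f t) \<Longrightarrow> 0 < (\<Prod>t\<in>#T. f t)"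
  by (induction T) auto

lemma norm_prod_mset: "norm (\<Prod>t\<in>#T. f t :: complex) = (\<Prod>t\<in>#T. norm (f t))"
  by (induction T) (auto simp: norm_mult)

text \<open>Every root is real, so each linear factor grows when the energy leaves the real axis vertically.\<close>

lemma continuant_le_complex_energy:
  "\<bar>continuant xs\<bar> \<le> norm (continuant (map (\<lambda>x. Complex x (- \<eta>)) xs))"
proof -
  obtain c ts where c: "c \<noteq> 0"
    and f: "\<And>w. continuant (map (\<lambda>x. complex_of_real x - w) xs) = c * (\<Prod>t\<in>#ts. (w - of_real t))"
    using continuant_factorization[of xs] by blast
  have "\<bar>continuant xs\<bar> = norm (continuant (map (\<lambda>x. complex_of_real x - 0) xs))"
    using continuant_of_real[of xs] by simp
  also have "\<dots> = norm c * (\<Prod>t\<in>#ts. norm (0 - complex_of_real t))"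
    unfolding f norm_mult norm_prod_mset ..
  also have "\<dots> \<le> norm c * (\<Prod>t\<in>#ts. norm (Complex 0 \<eta> - complex_of_real t))"
  proof (intro mult_left_mono prod_mset_mono_nonneg[THEN conjunct2])
    fix t show "0 \<le> norm (0 - complex_of_real t) \<and> norm (0 - complex_of_real t) \<le> norm (Complex 0 \<eta> - complex_of_real t)"
      using abs_Re_le_cmod[of "Complex 0 \<eta> - complex_of_real t"] by simp
  qed simp
  also have "\<dots> = norm (continuant (map (\<lambda>x. Complex x (- \<eta>)) xs))"
    unfolding shift_down f norm_mult norm_prod_mset ..
  finally show ?thesis .
qed

text \<open>The Cauchy law is the Poisson kernel of the upper half-plane, and \<open>ln \<bar>D\<bar>\<close> is harmonic
  there because all roots are real. Through the factorisation this reduces to one linear factor.\<close>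

lemma continuant_jensen:
  assumes \<epsilon>: "\<epsilon> > 0"
  shows "integrable cauchy_law (\<lambda>s. ln \<bar>continuant (map (\<lambda>x. x - \<epsilon> * s) xs)\<bar>)"
    and "(\<integral>s. ln \<bar>continuant (map (\<lambda>x. x - \<epsilon> * s) xs)\<bar> \<partial>cauchy_law) =
      ln (norm (continuant (map (\<lambda>x. Complex x (- \<epsilon>)) xs)))"
proof -
  interpret prob_space cauchy_law by (rule prob_space_cauchy_law)
  obtain c ts where c: "c \<noteq> 0"
    and f: "\<And>w. continuant (map (\<lambda>x. complex_of_real x - w) xs) = c * (\<Prod>t\<in>#ts. (w - of_real t))"
    using continuant_factorization[of xs] by blast
  define F where "F s = ln \<bar>continuant (map (\<lambda>x. x - \<epsilon> * s) xs)\<bar>" for s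
  define G where "G s = ln (norm c) + (\<Sum>t\<in>#ts. ln \<bar>\<epsilon> * s - t\<bar>)" for s
  have F: "F s = ln (norm (c * (\<Prod>t\<in>#ts. (complex_of_real (\<epsilon> * s) - of_real t))))" for s
  proof -
    have "complex_of_real (continuant (map (\<lambda>x. x - \<epsilon> * s) xs)) = continuant (map (\<lambda>x. complex_of_real x - of_real (\<epsilon> * s)) xs)"
      using continuant_of_real[of "map (\<lambda>x. x - \<epsilon> * s) xs"] by (simp add: comp_def)
    then show ?thesis unfolding F_def f[symmetric] by (metis norm_of_real)
  qed
  have ln_prod: "ln (\<Prod>t\<in>#T. g t) = (\<Sum>t\<in>#T. ln (g t))" if "\<And>t. t \<in># T \<Longrightarrow> 0 < g t" for T and g :: "real \<Rightarrow> real"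
    using that
  proof (induction T)
    case (add t T)
    have "0 < (\<Prod>t\<in>#T. g t)" by (rule prod_mset_positive) (use add in auto)
    moreover have "0 < g t" using add.prems by simp
    ultimately have "ln (g t * (\<Prod>t\<in>#T. g t)) = ln (g t) + ln (\<Prod>t\<in>#T. g t)" by (simp add: ln_mult_pos)
    then show ?case using add by simp
  qed simp
  have pos: "ln (norm (c * (\<Prod>t\<in>#ts. (w - complex_of_real t)))) = ln (norm c) + (\<Sum>t\<in>#ts. ln (norm (w - complex_of_real t)))"
    if "\<forall>t\<in>#ts. w \<noteq> of_real t" for w
  proof -
    have "0 < (\<Prod>t\<in>#ts. norm (w - complex_of_real t))" by (rule prod_mset_positive) (use that in auto)
    then show ?thesis unfolding norm_mult norm_prod_mset using c that by (simp add: ln_mult_pos ln_prod)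
  qed
  have FG: "F s = G s" if "\<forall>t\<in>#ts. s \<noteq> t / \<epsilon>" for s
  proof -
    have ne: "\<forall>t\<in>#ts. complex_of_real (\<epsilon> * s) \<noteq> of_real t" using that \<epsilon> by (auto simp del: of_real_mult)
    have "norm (complex_of_real (\<epsilon> * s) - of_real t) = \<bar>\<epsilon> * s - t\<bar>" for t
      by (metis norm_of_real of_real_diff)
    then show ?thesis unfolding F pos[OF ne] G_def by simp
  qed
  have "AE s in cauchy_law. \<forall>t\<in>set_mset ts. s \<noteq> t / \<epsilon>"
    by (intro AE_ball_countable') (auto intro: cauchy_law_singleton countable_finite)
  then have AE: "AE s in cauchy_law. F s = G s" by (rule AE_mp) (use FG in auto)
  have G: "integrable cauchy_law (\<lambda>s. \<Sum>t\<in>#T. ln \<bar>\<epsilon> * s - t\<bar>) \<and>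
    (\<integral>s. (\<Sum>t\<in>#T. ln \<bar>\<epsilon> * s - t\<bar>) \<partial>cauchy_law) = (\<Sum>t\<in>#T. ln (norm (Complex t \<epsilon>)))" for T
    by (induction T) (use cauchy_law_ln[OF \<epsilon>] in auto)
  have Gi: "integrable cauchy_law G"
    unfolding G_def using G by auto
  have [measurable]: "F \<in> borel_measurable cauchy_law"
  proof -
    have "(\<lambda>s. fst (act (map (\<lambda>x. x - \<epsilon> * s) xs) (1, 0))) \<in> borel_measurable borel \<and>
      (\<lambda>s. snd (act (map (\<lambda>x. x - \<epsilon> * s) xs) (1, 0))) \<in> borel_measurable borel"
      by (induction xs) auto
    then have [measurable]: "(\<lambda>s. fst (act (map (\<lambda>x. x - \<epsilon> * s) xs) (1, 0))) \<in> borel_measurable borel" ..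
    show ?thesis unfolding F_def continuant_def by measurable
  qed
  have "integrable cauchy_law F"
    using Gi by (subst integrable_cong_AE[OF _ _ AE]) auto
  then show "integrable cauchy_law (\<lambda>s. ln \<bar>continuant (map (\<lambda>x. x - \<epsilon> * s) xs)\<bar>)"
    unfolding F_def .
  have "(\<integral>s. F s \<partial>cauchy_law) = (\<integral>s. G s \<partial>cauchy_law)"
    using Gi by (intro integral_cong_AE AE) auto
  also have "\<dots> = ln (norm c) + (\<Sum>t\<in>#ts. ln (norm (Complex t \<epsilon>)))"
    unfolding G_def using G[of ts] by (simp add: prob_space)
  also have "\<dots> = ln (norm (continuant (map (\<lambda>x. Complex x (- \<epsilon>)) xs)))"
  proof -
    have "norm (Complex 0 \<epsilon> - of_real t) = norm (Complex t \<epsilon>)" for t by (simp add: cmod_def)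
    moreover have "\<forall>t\<in>#ts. Complex 0 \<epsilon> \<noteq> of_real t" using \<epsilon> by (auto simp: complex_eq_iff)
    ultimately show ?thesis unfolding shift_down f by (subst pos) auto
  qed
  finally show "(\<integral>s. ln \<bar>continuant (map (\<lambda>x. x - \<epsilon> * s) xs)\<bar> \<partial>cauchy_law) =
      ln (norm (continuant (map (\<lambda>x. Complex x (- \<epsilon>)) xs)))"
    unfolding F_def .
qed

section \<open>The operator norm on SL(2,R)\<close>

lemma S_mat_nth: "S_mat v $ 1 $ 1 = v" "S_mat v $ 1 $ 2 = -1" "S_mat v $ 2 $ 1 = 1" "S_mat v $ 2 $ 2 = 0"
  by (auto simp: S_mat_def)

lemma op_norm_le_entries: "op_norm A \<le> \<bar>A$1$1\<bar> + \<bar>A$1$2\<bar> + \<bar>A$2$1\<bar> + \<bar>A$2$2\<bar>"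
  unfolding op_norm_def using onorm_le_matrix_component_sum[of A] by (simp add: sum_2)

lemma entry_le_op_norm: "\<bar>A $ i $ j\<bar> \<le> op_norm A"
  unfolding op_norm_def by (rule matrix_component_le_onorm)

lemma op_norm_nonneg: "0 \<le> op_norm A"
  unfolding op_norm_def by (rule onorm_pos_le) (simp add: matrix_vector_mul_bounded_linear)

lemma op_norm_mult: "op_norm (A ** B) \<le> op_norm A * op_norm B"
proof -
  have "(*v) (A ** B) = (*v) A \<circ> (*v) B" by (auto simp: matrix_vector_mul_assoc)
  then show ?thesis unfolding op_norm_def
    by (simp only:) (intro onorm_compose matrix_vector_mul_bounded_linear)
qed

text \<open>The determinant is at most the product of the lengths of the two columns.\<close>

lemma op_norm_ge_1:
  assumes "A \<in> SL2"
  shows "1 \<le> op_norm A"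
proof -
  have col: "norm (column j A) \<le> op_norm A" for j
    unfolding op_norm_def by (rule norm_column_le_onorm)
  have n2: "(norm (column j A))\<^sup>2 = (A$1$j)\<^sup>2 + (A$2$j)\<^sup>2" for j
    by (simp add: norm_vec_def L2_set_def sum_2 column_def)
  have "1 = (A$1$1 * A$2$2 - A$1$2 * A$2$1)\<^sup>2" using assms by (simp add: SL2_def det_2)
  also have "\<dots> \<le> ((A$1$1)\<^sup>2 + (A$2$1)\<^sup>2) * ((A$1$2)\<^sup>2 + (A$2$2)\<^sup>2)"
  proof -
    have "((A$1$1)\<^sup>2 + (A$2$1)\<^sup>2) * ((A$1$2)\<^sup>2 + (A$2$2)\<^sup>2) =
      (A$1$1 * A$2$2 - A$1$2 * A$2$1)\<^sup>2 + (A$1$1 * A$1$2 + A$2$1 * A$2$2)\<^sup>2"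
      by (simp add: power2_eq_square algebra_simps)
    then show ?thesis by simp
  qed
  also have "\<dots> = (norm (column 1 A) * norm (column 2 A))\<^sup>2"
    by (simp add: n2 power_mult_distrib)
  also have "\<dots> \<le> (op_norm A * op_norm A)\<^sup>2"
    by (intro power_mono mult_mono col op_norm_nonneg) auto
  finally have "1 \<le> ((op_norm A)\<^sup>2)\<^sup>2" by (simp add: power2_eq_square)
  then show ?thesis using op_norm_nonneg[of A] 
    by (meson power2_le_imp_le one_le_power order_trans zero_le_one not_le power_less_one_iff zero_less_numeral zero_le_power2)
qed

lemma continuous_op_norm: "continuous_on UNIV op_norm"
proof -
  have diff: "op_norm A - op_norm B \<le> (\<Sum>i\<in>UNIV. \<Sum>j\<in>UNIV. \<bar>A$i$j - B$i$j\<bar>)" for A B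
  proof -
    have "(*v) A = (\<lambda>x. (A - B) *v x + B *v x)"
      by (auto simp: matrix_vector_mult_diff_rdistrib)
    then have "op_norm A \<le> op_norm (A - B) + op_norm B"
      unfolding op_norm_def by (simp only:) (intro onorm_triangle matrix_vector_mul_bounded_linear)
    also have "op_norm (A - B) \<le> (\<Sum>i\<in>UNIV. \<Sum>j\<in>UNIV. \<bar>(A - B)$i$j\<bar>)"
      unfolding op_norm_def by (rule onorm_le_matrix_component_sum)
    finally show ?thesis by simp
  qed
  have "(op_norm \<longlongrightarrow> op_norm B) (at B)" for B
  proof (rule tendsto_rabs_zero_cancel[THEN Lim_null[THEN iffD2]])
    have "((\<lambda>A. \<Sum>i\<in>UNIV. \<Sum>j\<in>UNIV. \<bar>A$i$j - B$i$j\<bar>) \<longlongrightarrow> (\<Sum>i\<in>UNIV. \<Sum>j\<in>UNIV. \<bar>B$i$j - B$i$j\<bar>)) (at B)"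
      by (intro tendsto_intros)
    then have "((\<lambda>A. \<Sum>i\<in>UNIV. \<Sum>j\<in>UNIV. \<bar>A$i$j - B$i$j\<bar>) \<longlongrightarrow> 0) (at B)" by simp
    then show "((\<lambda>A. \<bar>op_norm A - op_norm B\<bar>) \<longlongrightarrow> 0) (at B)"
    proof (rule Lim_null_comparison[rotated], intro always_eventually allI)
      fix A show "norm \<bar>op_norm A - op_norm B\<bar> \<le> (\<Sum>i\<in>UNIV. \<Sum>j\<in>UNIV. \<bar>A$i$j - B$i$j\<bar>)"
        using diff[of A B] diff[of B A] by (auto simp: abs_minus_commute)
    qed
  qed
  then show ?thesis by (simp add: continuous_on_def)
qed

lemma measurable_op_norm [measurable]: "op_norm \<in> borel_measurable SL2_borel"
  unfolding SL2_borel_def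
  by (intro measurable_restrict_space1 borel_measurable_continuous_onI continuous_op_norm)

lemma space_SL2_borel: "space SL2_borel = SL2"
  by (simp add: SL2_borel_def space_restrict_space)

lemma SL2_mult: "A \<in> SL2 \<Longrightarrow> B \<in> SL2 \<Longrightarrow> A ** B \<in> SL2"
  by (simp add: SL2_def det_mul)

lemma SL2_1: "mat 1 \<in> SL2"
  by (simp add: SL2_def)

lemma measurable_matrix_mult [measurable (raw)]:
  assumes f: "f \<in> M \<rightarrow>\<^sub>M SL2_borel" and g: "g \<in> M \<rightarrow>\<^sub>M SL2_borel"
  shows "(\<lambda>x. f x ** g x) \<in> M \<rightarrow>\<^sub>M SL2_borel"
proof -
  have f': "f \<in> borel_measurable M" "f \<in> space M \<rightarrow> SL2"
    using f unfolding SL2_borel_def measurable_restrict_space2_iff by auto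
  have g': "g \<in> borel_measurable M" "g \<in> space M \<rightarrow> SL2"
    using g unfolding SL2_borel_def measurable_restrict_space2_iff by auto
  show ?thesis
    unfolding SL2_borel_def
  proof (rule measurable_restrict_space2)
    show "(\<lambda>x. f x ** g x) \<in> space M \<rightarrow> SL2" using f'(2) g'(2) SL2_mult by auto
    have "continuous_on UNIV (\<lambda>x::(real^2^2) \<times> (real^2^2). fst x ** snd x)"
      unfolding matrix_matrix_mult_def by (intro continuous_intros continuous_on_vec_lambda)
    then show "(\<lambda>x. f x ** g x) \<in> borel_measurable M"
      using borel_measurable_continuous_Pair[OF f'(1) g'(1), of "(**)"] by (simp add: case_prod_beta)
  qed
qed

lemma op_norm_S_mat: "op_norm (S_mat (x - E)) \<le> (1 + \<bar>x\<bar>) * (2 + \<bar>E\<bar>)"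
proof -
  have "op_norm (S_mat (x - E)) \<le> \<bar>x - E\<bar> + 2"
    using op_norm_le_entries[of "S_mat (x - E)"] by (simp add: S_mat_nth)
  also have "\<dots> \<le> (1 + \<bar>x\<bar>) * (2 + \<bar>E\<bar>)"
    using mult_nonneg_nonneg[of "\<bar>x\<bar>" "\<bar>E\<bar>"] abs_triangle_ineq4[of x E]
    by (simp add: algebra_simps) (smt (verit) abs_ge_zero mult_nonneg_nonneg)
  finally show ?thesis .
qed

section \<open>Transfer matrices\<close>

primrec transfer :: "nat \<Rightarrow> real \<Rightarrow> (nat \<Rightarrow> real) \<Rightarrow> real^2^2" where
  "transfer 0 E x = mat 1"
| "transfer (Suc n) E x = S_mat (x n - E) ** transfer n E x"

lemma transfer_entries:
  fixes x :: "nat \<Rightarrow> real"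
  defines "vs \<equiv> \<lambda>n E. map (\<lambda>j. x j - E) (rev [0..<n])"
  shows "transfer n E x $ 1 $ 1 = fst (act (vs n E) (1, 0))"
    and "transfer n E x $ 2 $ 1 = snd (act (vs n E) (1, 0))"
    and "transfer n E x $ 1 $ 2 = fst (act (vs n E) (0, 1))"
    and "transfer n E x $ 2 $ 2 = snd (act (vs n E) (0, 1))"
proof -
  have "transfer n E x $ 1 $ 1 = fst (act (vs n E) (1, 0)) \<and>
    transfer n E x $ 2 $ 1 = snd (act (vs n E) (1, 0)) \<and>
    transfer n E x $ 1 $ 2 = fst (act (vs n E) (0, 1)) \<and>
    transfer n E x $ 2 $ 2 = snd (act (vs n E) (0, 1))"
    by (induction n)
      (auto simp: vs_def mat_def matrix_matrix_mult_def sum_2 S_mat_nth algebra_simps)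
  then show "transfer n E x $ 1 $ 1 = fst (act (vs n E) (1, 0))"
    and "transfer n E x $ 2 $ 1 = snd (act (vs n E) (1, 0))"
    and "transfer n E x $ 1 $ 2 = fst (act (vs n E) (0, 1))"
    and "transfer n E x $ 2 $ 2 = snd (act (vs n E) (0, 1))" by auto
qed

text \<open>The entries of the transfer matrix are determinants of pieces lacking an end site. Each is dominated
  by its value at the energy \<open>\<i> \<eta>\<close>, and there removing one end site costs at most a factor
  \<open>1 / \<eta>\<close> by the Herglotz bounds.\<close>

lemma op_norm_transfer_le:
  fixes x :: "nat \<Rightarrow> real"
  assumes \<eta>: "0 < \<eta>" "\<eta> \<le> 1"
  shows "op_norm (transfer n 0 x) \<le> 4 / \<eta>\<^sup>2 * norm (continuant (map (\<lambda>j. Complex (x j) (- \<eta>)) (rev [0..<n])))"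
proof -
  define c :: "real list \<Rightarrow> complex list" where "c = map (\<lambda>x. Complex x (- \<eta>))"
  have Im: "\<forall>v\<in>set (c ys). Im v \<le> - \<eta>" for ys by (auto simp: c_def)
  define vs where "vs = map x (rev [0..<n])"
  have cvs: "map (\<lambda>j. Complex (x j) (- \<eta>)) (rev [0..<n]) = c vs" by (simp add: c_def vs_def)
  have ne: "fst (act (c ys) (1, 0)) \<noteq> 0" for ys
    using herglotz_right(1)[OF \<eta>(1) Im[of ys]] by (simp add: continuant_def)
  have a: "\<bar>fst (act ys (1, 0))\<bar> \<le> norm (fst (act (c ys) (1, 0)))" for ys
    using continuant_le_complex_energy[of ys \<eta>] by (simp add: continuant_def c_def)
  have b: "\<bar>snd (act ys (1, 0))\<bar> \<le> norm (fst (act (c ys) (1, 0))) / \<eta>" for ys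
  proof -
    have "\<bar>snd (act ys (1, 0))\<bar> \<le> norm (snd (act (c ys) (1, 0)))"
      using a by (cases ys) (auto simp: c_def)
    also have "\<dots> \<le> norm (fst (act (c ys) (1, 0))) / \<eta>"
      using herglotz_right(3)[OF \<eta>(1) Im[of ys]] ne[of ys] \<eta> by (simp add: norm_divide field_simps)
    finally show ?thesis .
  qed
  define N where "N = norm (fst (act (c vs) (1, 0)))"
  have i2: "1 \<le> 1 / \<eta>" "1 / \<eta> \<le> 1 / \<eta>\<^sup>2" using \<eta> by (auto simp: field_simps power2_eq_square)
  have N0: "N \<ge> 0" by (simp add: N_def)
  have e0: "\<bar>fst (act vs (1, 0))\<bar> \<le> N / \<eta>\<^sup>2" "\<bar>snd (act vs (1, 0))\<bar> \<le> N / \<eta>\<^sup>2"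
    using a[of vs] b[of vs] i2 N0 mult_left_mono[OF i2(2) N0] mult_left_mono[OF i2(1) N0]
    by (auto simp: N_def[symmetric])
  have e1: "\<bar>fst (act vs (0, 1))\<bar> \<le> N / \<eta>\<^sup>2 \<and> \<bar>snd (act vs (0, 1))\<bar> \<le> N / \<eta>\<^sup>2"
  proof (cases vs rule: rev_cases)
    case Nil
    then show ?thesis using i2 by (simp add: N_def c_def)
  next
    case (snoc us v)
    have cs: "c vs = c us @ [Complex v (- \<eta>)]" by (simp add: snoc c_def)
    have "norm (fst (act (c vs) (0, 1))) \<le> N / \<eta>"
      using herglotz_left(2)[OF \<eta>(1) Im[of vs]] ne[of vs] \<eta> by (simp add: norm_divide N_def field_simps)
    then have u: "norm (fst (act (c us) (1, 0))) \<le> N / \<eta>"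
      unfolding cs act_snoc_01 by simp
    have "\<bar>fst (act vs (0, 1))\<bar> \<le> N / \<eta>"
      unfolding snoc act_snoc_01 using a[of us] u by simp
    moreover have "N / \<eta> \<le> N / \<eta>\<^sup>2" using mult_left_mono[OF i2(2) N0] by simp
    moreover have "\<bar>snd (act vs (0, 1))\<bar> \<le> N / \<eta>\<^sup>2"
    proof -
      have "\<bar>snd (act vs (0, 1))\<bar> \<le> norm (fst (act (c us) (1, 0))) / \<eta>"
        unfolding snoc act_snoc_01 using b[of us] by simp
      also have "\<dots> \<le> N / \<eta> / \<eta>" using u \<eta> by (intro divide_right_mono) auto
      finally show ?thesis by (simp add: power2_eq_square)
    qed
    ultimately show ?thesis by linarith
  qed
  have "op_norm (transfer n 0 x) \<le> 4 * (N / \<eta>\<^sup>2)"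
    using op_norm_le_entries[of "transfer n 0 x"] e0 e1
    by (simp add: transfer_entries vs_def)
  then show ?thesis unfolding cvs by (simp add: N_def continuant_def)
qed

lemma transfer_SL2: "transfer n E x \<in> SL2"
  by (induction n) (auto simp: SL2_1 SL2_mult S_mat_in_SL2)

lemma transfer_cong: "(\<And>j. j < n \<Longrightarrow> x j = y j) \<Longrightarrow> transfer n E x = transfer n E y"
  by (induction n) auto

lemma measurable_transfer:
  assumes "E \<in> borel_measurable M" "\<And>j. j < n \<Longrightarrow> (\<lambda>\<omega>. x \<omega> j) \<in> borel_measurable M"
  shows "(\<lambda>\<omega>. transfer n (E \<omega>) (x \<omega>)) \<in> M \<rightarrow>\<^sub>M SL2_borel"
  using assms(2)
proof (induction n)
  case 0
  then show ?case by (simp add: space_SL2_borel SL2_1)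
next
  case (Suc n)
  have [measurable]: "(\<lambda>\<omega>. transfer n (E \<omega>) (x \<omega>)) \<in> M \<rightarrow>\<^sub>M SL2_borel" "(\<lambda>\<omega>. x \<omega> n) \<in> borel_measurable M"
    using Suc by auto
  note assms(1)[measurable]
  show ?case by simp
qed

text \<open>The deterministic core of the argument: the norm at energy 0 is bounded through the determinant at
  \<open>\<i> \<eta>\<close>, which is compared with the one at \<open>6 \<i> \<eta>\<close> by raising sites, and the latter is an
  average over real energies. The inequality is stated for extended nonnegative integrals so that means
  over the potential can be taken by Tonelli's theorem.\<close>

lemma transfer_growth:
  fixes x :: "nat \<Rightarrow> real"
  assumes \<eta>: "0 < \<eta>" "\<eta> \<le> 1"
  shows "ennreal (ln (op_norm (transfer n 0 x)) + ln 2 * (\<Sum>j<n. of_bool (isolated \<eta> n x j)))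
    \<le> (\<integral>\<^sup>+s. ennreal (ln (op_norm (transfer n (6 * \<eta> * s) x))) \<partial>cauchy_law) + ennreal (ln (4 / \<eta>\<^sup>2))"
proof -
  define \<epsilon> where "\<epsilon> = 6 * \<eta>"
  have \<epsilon>: "\<epsilon> > 0" "6 * \<eta> = \<epsilon>" using \<eta> by (auto simp: \<epsilon>_def)
  define K where "K \<delta> = continuant (map (\<lambda>j. Complex (x j) (- \<delta>)) (rev [0..<n]))" for \<delta>
  have K0: "K \<eta> \<noteq> 0" unfolding K_def by (rule herglotz_right(1)[OF \<eta>(1)]) auto
  define D where "D s = continuant (map (\<lambda>y. y - \<epsilon> * s) (map x (rev [0..<n])))" for s
  have J: "integrable cauchy_law (\<lambda>s. ln \<bar>D s\<bar>)" "(\<integral>s. ln \<bar>D s\<bar> \<partial>cauchy_law) = ln (norm (K \<epsilon>))"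
    using continuant_jensen[OF \<epsilon>(1), of "map x (rev [0..<n])"] by (auto simp: D_def K_def comp_def)
  have D: "ln \<bar>D s\<bar> \<le> ln (op_norm (transfer n (\<epsilon> * s) x))" for s
  proof (cases "D s = 0")
    case True
    then show ?thesis using op_norm_ge_1[OF transfer_SL2, of n "\<epsilon> * s" x] by simp
  next
    case False
    have "\<bar>D s\<bar> = \<bar>transfer n (\<epsilon> * s) x $ 1 $ 1\<bar>"
      by (simp add: transfer_entries D_def continuant_def comp_def)
    also have "\<dots> \<le> op_norm (transfer n (\<epsilon> * s) x)" by (rule entry_le_op_norm)
    finally show ?thesis using False by simp
  qed
  have "ln (op_norm (transfer n 0 x)) \<le> ln (4 / \<eta>\<^sup>2 * norm (K \<eta>))"
    using op_norm_transfer_le[OF \<eta>, of n x] op_norm_ge_1[OF transfer_SL2, of n 0 x] unfolding K_def by simp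
  also have "\<dots> = ln (4 / \<eta>\<^sup>2) + ln (norm (K \<eta>))"
    using K0 \<eta> by (intro ln_mult_pos) auto
  also have "ln (norm (K \<eta>)) \<le> ln (norm (K \<epsilon>)) - ln 2 * (\<Sum>j<n. of_bool (isolated \<eta> n x j))"
    using continuant_growth[OF \<eta>(1) \<epsilon>(2), where n=n and x=x] unfolding K_def by linarith
  finally have "ln (op_norm (transfer n 0 x)) + ln 2 * (\<Sum>j<n. of_bool (isolated \<eta> n x j))
    \<le> (\<integral>s. ln \<bar>D s\<bar> \<partial>cauchy_law) + ln (4 / \<eta>\<^sup>2)" unfolding J by linarith
  then have "ennreal (ln (op_norm (transfer n 0 x)) + ln 2 * (\<Sum>j<n. of_bool (isolated \<eta> n x j)))
    \<le> ennreal ((\<integral>s. ln \<bar>D s\<bar> \<partial>cauchy_law) + ln (4 / \<eta>\<^sup>2))" by (rule ennreal_leI)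
  also have "\<dots> \<le> ennreal (\<integral>s. ln \<bar>D s\<bar> \<partial>cauchy_law) + ennreal (ln (4 / \<eta>\<^sup>2))"
  proof -
    have "\<eta>\<^sup>2 \<le> 1" using \<eta> by (simp add: power_le_one)
    then have "0 \<le> ln (4 / \<eta>\<^sup>2)" using \<eta> by (intro ln_ge_zero) (auto simp: field_simps)
    then show ?thesis
      by (cases "(\<integral>s. ln \<bar>D s\<bar> \<partial>cauchy_law) \<ge> 0") (auto simp: ennreal_neg intro!: ennreal_leI)
  qed
  also have "ennreal (\<integral>s. ln \<bar>D s\<bar> \<partial>cauchy_law) \<le> (\<integral>\<^sup>+s. ennreal (ln (op_norm (transfer n (\<epsilon> * s) x))) \<partial>cauchy_law)"
  proof -
    have "(\<integral>s. ln \<bar>D s\<bar> \<partial>cauchy_law) \<le> (\<integral>s. max 0 (ln \<bar>D s\<bar>) \<partial>cauchy_law)"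
      using J by (intro integral_mono) auto
    then have "ennreal (\<integral>s. ln \<bar>D s\<bar> \<partial>cauchy_law) \<le> ennreal (\<integral>s. max 0 (ln \<bar>D s\<bar>) \<partial>cauchy_law)" by (rule ennreal_leI)
    also have "\<dots> = (\<integral>\<^sup>+s. ennreal (max 0 (ln \<bar>D s\<bar>)) \<partial>cauchy_law)"
      using J by (intro nn_integral_eq_integral[symmetric]) auto
    also have "\<dots> \<le> (\<integral>\<^sup>+s. ennreal (ln (op_norm (transfer n (\<epsilon> * s) x))) \<partial>cauchy_law)"
      using D op_norm_ge_1[OF transfer_SL2] by (intro nn_integral_mono ennreal_leI) (simp add: ln_ge_zero)
    finally show ?thesis .
  qed
  finally show ?thesis by (simp add: \<epsilon>_def add_right_mono)
qed

section \<open>Random products and the Lyapunov exponent\<close>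

text \<open>Fekete's lemma for nonnegative sequences: divide \<open>n\<close> by an index \<open>m\<close> whose average is nearly optimal;
  the remainder contributes a bounded amount.\<close>

lemma convergent_subadditive_average:
  fixes a :: "nat \<Rightarrow> real"
  assumes nn: "\<And>n. 0 \<le> a n" and sub: "\<And>m n. a (m + n) \<le> a m + a n"
  shows "convergent (\<lambda>n. a n / real n)"
proof -
  define l where "l = (INF n\<in>{1..}. a n / real n)"
  have bdd: "bdd_below ((\<lambda>n. a n / real n) ` {1..})"
    by (rule bdd_belowI[of _ 0]) (use nn in auto)
  have mult: "a (q * m) \<le> real q * a m + a 0" for q m
  proof (induction q)
    case (Suc q) then show ?case using sub[of m "q * m"] by (simp add: algebra_simps)
  qed simp
  have "(\<lambda>n. a n / real n) \<longlonglongrightarrow> l"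
  proof (rule LIMSEQ_I)
    fix e :: real assume e: "0 < e"
    obtain m where m: "m \<ge> 1" "a m / real m < l + e / 2"
      using cInf_lessD[of "(\<lambda>n. a n / real n) ` {1..}" "l + e / 2"] e by (auto simp: l_def)
    define C where "C = (\<Sum>r<m. a r) + a 0"
    obtain N where N: "real N > 2 * C / e" using reals_Archimedean2 by blast
    have "norm (a n / real n - l) < e" if n: "n \<ge> max 1 N" for n
    proof -
      have n1: "real n \<ge> 1" "real n > 2 * C / e" using n N by auto
      have ge: "l \<le> a n / real n" unfolding l_def by (rule cINF_lower[OF bdd]) (use n in auto)
      have "a n \<le> a ((n div m) * m) + a (n mod m)" using sub[of "(n div m) * m" "n mod m"] by simp
      also have "a (n mod m) \<le> C - a 0" unfolding C_def
        using member_le_sum[of "n mod m" "{..<m}" a] m nn by simp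
      also have "a ((n div m) * m) \<le> real (n div m) * a m + a 0" by (rule mult)
      also have "real (n div m) * a m = real (n div m * m) * (a m / real m)" using m by simp
      also have "\<dots> \<le> real n * (a m / real m)"
        using nn[of m] by (intro mult_right_mono) (auto simp del: of_nat_mult)
      finally have "a n / real n \<le> a m / real m + C / real n" using n1 by (simp add: field_simps)
      moreover have "C / real n < e / 2" using n1 e by (simp add: field_simps)
      ultimately have "a n / real n < l + e" using m(2) by linarith
      then show ?thesis using ge by simp
    qed
    then show "\<exists>no. \<forall>n\<ge>no. norm (a n / real n - l) < e" by blast
  qed
  then show ?thesis by (rule convergentI)
qed

lemma prob_space_conv_power:
  assumes "prob_space \<mu>" "sets \<mu> = sets SL2_borel"
  shows "prob_space (conv_power \<mu> n)" "sets (conv_power \<mu> n) = sets SL2_borel"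
proof -
  show s: "sets (conv_power \<mu> n) = sets SL2_borel" for n
    by (cases n) (auto simp: mconv_def)
  show "prob_space (conv_power \<mu> n)"
  proof (induction n)
    case 0
    then show ?case by (auto intro!: prob_space_return simp: space_SL2_borel SL2_1)
  next
    case (Suc n)
    interpret A: prob_space \<mu> by fact
    interpret B: prob_space "conv_power \<mu> n" by fact
    interpret P: pair_prob_space \<mu> "conv_power \<mu> n" ..
    note [measurable_cong] = assms(2) s
    show ?case unfolding conv_power.simps mconv_def
      by (rule P.prob_space_distr) measurable
  qed
qed

lemma nn_integral_conv_power_Suc:
  assumes \<mu>: "prob_space \<mu>" "sets \<mu> = sets SL2_borel"
    and [measurable]: "f \<in> borel_measurable SL2_borel"
  shows "(\<integral>\<^sup>+A. f A \<partial>conv_power \<mu> (Suc n)) = (\<integral>\<^sup>+A. (\<integral>\<^sup>+B. f (A ** B) \<partial>conv_power \<mu> n) \<partial>\<mu>)"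
proof -
  interpret A: prob_space \<mu> by fact
  note P = prob_space_conv_power[OF \<mu>]
  interpret B: prob_space "conv_power \<mu> n" by (rule P)
  note [measurable_cong] = \<mu>(2) P(2)
  have "(\<integral>\<^sup>+A. f A \<partial>conv_power \<mu> (Suc n)) = (\<integral>\<^sup>+p. f (case p of (A, B) \<Rightarrow> A ** B) \<partial>(\<mu> \<Otimes>\<^sub>M conv_power \<mu> n))"
    unfolding conv_power.simps mconv_def by (rule nn_integral_distr) measurable
  also have "\<dots> = (\<integral>\<^sup>+A. (\<integral>\<^sup>+B. f (A ** B) \<partial>conv_power \<mu> n) \<partial>\<mu>)"
    by (subst B.nn_integral_fst[symmetric]) auto
  finally show ?thesis .
qed

text \<open>The power is defined by multiplying on the left one factor at a time; associativity of the matrix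
  product lets a product of length \<open>m + n\<close> be cut at any place, which yields subadditivity.\<close>

lemma nn_integral_conv_power_add:
  assumes \<mu>: "prob_space \<mu>" "sets \<mu> = sets SL2_borel"
    and f: "f \<in> borel_measurable SL2_borel"
  shows "(\<integral>\<^sup>+A. f A \<partial>conv_power \<mu> (m + n)) =
    (\<integral>\<^sup>+A. (\<integral>\<^sup>+B. f (A ** B) \<partial>conv_power \<mu> n) \<partial>conv_power \<mu> m)"
  using f
proof (induction m arbitrary: f)
  case 0
  note [measurable] = 0
  note P = prob_space_conv_power[OF \<mu>]
  interpret B: prob_space "conv_power \<mu> n" by (rule P)
  note [measurable_cong] = \<mu>(2) P(2)
  show ?case by (subst conv_power.simps, subst nn_integral_return) (auto simp: space_SL2_borel SL2_1)
next
  case (Suc m)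
  note [measurable] = Suc.prems
  note P = prob_space_conv_power[OF \<mu>]
  interpret B: prob_space "conv_power \<mu> n" by (rule P)
  note [measurable_cong] = \<mu>(2) P(2)
  have "(\<integral>\<^sup>+A. f A \<partial>conv_power \<mu> (Suc m + n)) = (\<integral>\<^sup>+A. (\<integral>\<^sup>+C. f (A ** C) \<partial>conv_power \<mu> (m + n)) \<partial>\<mu>)"
    unfolding add_Suc by (rule nn_integral_conv_power_Suc[OF \<mu>]) fact
  also have "\<dots> = (\<integral>\<^sup>+A. (\<integral>\<^sup>+C. (\<integral>\<^sup>+D. f (A ** (C ** D)) \<partial>conv_power \<mu> n) \<partial>conv_power \<mu> m) \<partial>\<mu>)"
  proof (rule nn_integral_cong)
    fix A assume "A \<in> space \<mu>"
    then have [measurable]: "(\<lambda>x. A) \<in> SL2_borel \<rightarrow>\<^sub>M SL2_borel"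
      using sets_eq_imp_space_eq[OF \<mu>(2)] by simp
    show "(\<integral>\<^sup>+C. f (A ** C) \<partial>conv_power \<mu> (m + n)) = (\<integral>\<^sup>+C. (\<integral>\<^sup>+D. f (A ** (C ** D)) \<partial>conv_power \<mu> n) \<partial>conv_power \<mu> m)"
      by (rule Suc.IH) measurable
  qed
  also have "\<dots> = (\<integral>\<^sup>+A. (\<integral>\<^sup>+C. (\<integral>\<^sup>+D. f ((A ** C) ** D) \<partial>conv_power \<mu> n) \<partial>conv_power \<mu> m) \<partial>\<mu>)"
    by (simp add: matrix_mul_assoc)
  also have "\<dots> = (\<integral>\<^sup>+A. (\<integral>\<^sup>+B. f (A ** B) \<partial>conv_power \<mu> n) \<partial>conv_power \<mu> (Suc m))"
    by (rule nn_integral_conv_power_Suc[OF \<mu>, symmetric]) measurable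
  finally show ?case .
qed

text \<open>The finite logarithmic moment makes the mean logarithms finite for all energies at once.\<close>

locale random_potential = prob_space \<nu> for \<nu> :: "real measure" +
  assumes sets_nu: "sets \<nu> = sets borel"
    and ln_moment: "integrable \<nu> (\<lambda>x. ln (1 + \<bar>x\<bar>))"
begin

lemma sets_nu' [measurable_cong]: "sets \<nu> = sets borel" by (rule sets_nu)

lemma space_nu: "space \<nu> = UNIV" using sets_eq_imp_space_eq[OF sets_nu] by simp

abbreviation walk :: "real \<Rightarrow> nat \<Rightarrow> (real^2^2) measure" where
  "walk E n \<equiv> conv_power (mu_E \<nu> E) n"

abbreviation sites :: "nat \<Rightarrow> (nat \<Rightarrow> real) measure" where
  "sites n \<equiv> PiM {..<n} (\<lambda>_. \<nu>)"

lemma mu: "prob_space (mu_E \<nu> E)" "sets (mu_E \<nu> E) = sets SL2_borel"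
  using prob_space_mu_E[OF prob_space_axioms sets_nu] mu_E_eq_distr[OF prob_space_axioms sets_nu] by auto

lemma prob_space_walk: "prob_space (walk E n)" and sets_walk: "sets (walk E n) = sets SL2_borel"
  using prob_space_conv_power[OF mu] by auto

lemma space_walk: "space (walk E n) = SL2"
  using sets_eq_imp_space_eq[OF sets_walk] space_SL2_borel by simp

lemma product_sigma_finite_nu: "product_sigma_finite (\<lambda>_::nat. \<nu>)"
  by (simp add: product_sigma_finite_def sigma_finite_measure_axioms)

lemma nn_integral_mu:
  assumes "f \<in> borel_measurable SL2_borel"
  shows "(\<integral>\<^sup>+A. f A \<partial>mu_E \<nu> E) = (\<integral>\<^sup>+x. f (S_mat (x - E)) \<partial>\<nu>)"
  unfolding mu_E_eq_distr[OF prob_space_axioms sets_nu]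
  by (rule nn_integral_distr) (use assms in measurable)

lemma integral_mu:
  fixes f :: "real^2^2 \<Rightarrow> real"
  assumes "f \<in> borel_measurable SL2_borel"
  shows "(\<integral>A. f A \<partial>mu_E \<nu> E) = (\<integral>x. f (S_mat (x - E)) \<partial>\<nu>)"
  unfolding mu_E_eq_distr[OF prob_space_axioms sets_nu]
  by (rule integral_distr) (use assms in measurable)

lemma integrable_mu:
  fixes f :: "real^2^2 \<Rightarrow> real"
  assumes "f \<in> borel_measurable SL2_borel"
  shows "integrable (mu_E \<nu> E) f \<longleftrightarrow> integrable \<nu> (\<lambda>x. f (S_mat (x - E)))"
  unfolding mu_E_eq_distr[OF prob_space_axioms sets_nu]
  by (rule integrable_distr_eq) (use assms in measurable)

lemma measurable_transfer_sites:
  assumes "n \<le> N"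
  shows "(\<lambda>p. transfer n (fst p) (snd p)) \<in> borel \<Otimes>\<^sub>M sites N \<rightarrow>\<^sub>M SL2_borel"
proof (rule measurable_transfer)
  fix j assume "j < n"
  then have j: "j \<in> {..<N}" using assms by auto
  show "(\<lambda>\<omega>. snd \<omega> j) \<in> borel_measurable (borel \<Otimes>\<^sub>M sites N)"
    using measurable_compose[OF measurable_snd measurable_component_singleton[OF j, of "\<lambda>_. \<nu>"]] measurable_cong_sets[OF refl sets_nu]
    by auto
qed simp

lemma measurable_transfer_sites' [measurable]:
  shows "transfer n E \<in> sites n \<rightarrow>\<^sub>M SL2_borel"
  using measurable_compose[OF measurable_Pair1' measurable_transfer_sites[OF order_refl, of n], of E] by simp

text \<open>All energies are realised on one space of potentials, so that the pointwise inequality between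
  transfer matrices at different energies can be integrated.\<close>

lemma nn_integral_walk:
  assumes f: "f \<in> borel_measurable SL2_borel"
  shows "(\<integral>\<^sup>+A. f A \<partial>walk E n) = (\<integral>\<^sup>+x. f (transfer n E x) \<partial>sites n)"
  using f
proof (induction n arbitrary: f)
  case 0
  interpret S: prob_space "PiM {} (\<lambda>_::nat. \<nu>)" by (intro prob_space_PiM prob_space_axioms)
  show ?case using 0
    by simp (subst nn_integral_return, auto simp: space_SL2_borel SL2_1 S.emeasure_space_1)
next
  case (Suc n)
  note [measurable] = Suc.prems
  interpret product_sigma_finite "\<lambda>_::nat. \<nu>" by (rule product_sigma_finite_nu)
  interpret W: prob_space "walk E n" by (rule prob_space_walk)
  note [measurable_cong] = sets_walk
  have "(\<integral>\<^sup>+A. f A \<partial>walk E (Suc n)) = (\<integral>\<^sup>+A. (\<integral>\<^sup>+B. f (A ** B) \<partial>walk E n) \<partial>mu_E \<nu> E)"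
    by (rule nn_integral_conv_power_Suc[OF mu]) fact
  also have "\<dots> = (\<integral>\<^sup>+v. (\<integral>\<^sup>+B. f (S_mat (v - E) ** B) \<partial>walk E n) \<partial>\<nu>)"
    by (rule nn_integral_mu) measurable
  also have "\<dots> = (\<integral>\<^sup>+v. (\<integral>\<^sup>+x. f (S_mat (v - E) ** transfer n E x) \<partial>sites n) \<partial>\<nu>)"
  proof (rule nn_integral_cong)
    fix v
    have [measurable]: "(\<lambda>x. S_mat (v - E)) \<in> SL2_borel \<rightarrow>\<^sub>M SL2_borel" by (simp add: space_SL2_borel S_mat_in_SL2)
    show "(\<integral>\<^sup>+B. f (S_mat (v - E) ** B) \<partial>walk E n) = (\<integral>\<^sup>+x. f (S_mat (v - E) ** transfer n E x) \<partial>sites n)"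
      by (rule Suc.IH) measurable
  qed
  also have "\<dots> = (\<integral>\<^sup>+v. (\<integral>\<^sup>+x. f (transfer (Suc n) E (x(n := v))) \<partial>sites n) \<partial>\<nu>)"
    by (simp add: transfer_cong[of n _ "\<lambda>_. _"] cong: transfer_cong)
  also have "\<dots> = (\<integral>\<^sup>+x. f (transfer (Suc n) E x) \<partial>sites (Suc n))"
  proof -
    have "(\<lambda>x. f (transfer (Suc n) E x)) \<in> borel_measurable (sites (Suc n))"
      by (rule measurable_compose[OF measurable_transfer_sites' Suc.prems])
    then show ?thesis
      unfolding lessThan_Suc by (subst product_nn_integral_insert_rev) auto
  qed
  finally show ?case .
qed

definition mean_log :: "real \<Rightarrow> nat \<Rightarrow> real" where
  "mean_log E n = (\<integral>A. ln (op_norm A) \<partial>walk E n)"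

lemma mean_log_nonneg: "0 \<le> mean_log E n"
  unfolding mean_log_def
  by (intro integral_nonneg_AE AE_I2 ln_ge_zero op_norm_ge_1) (simp add: space_walk)

text \<open>An explicit majorant of the exponent. Its logarithmic growth in \<open>E\<close> is what makes it
  integrable against the heavy-tailed Cauchy law.\<close>

definition ln_bound :: "real \<Rightarrow> real" where
  "ln_bound E = (\<integral>x. ln (1 + \<bar>x\<bar>) \<partial>\<nu>) + ln (2 + \<bar>E\<bar>)"

lemma nn_mean_log_subadditive:
  "(\<integral>\<^sup>+A. ennreal (ln (op_norm A)) \<partial>walk E (m + n)) \<le>
   (\<integral>\<^sup>+A. ennreal (ln (op_norm A)) \<partial>walk E m) + (\<integral>\<^sup>+A. ennreal (ln (op_norm A)) \<partial>walk E n)"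
proof -
  interpret W: prob_space "walk E n" by (rule prob_space_walk)
  interpret W': prob_space "walk E m" by (rule prob_space_walk)
  note [measurable_cong] = sets_walk
  have "(\<integral>\<^sup>+A. ennreal (ln (op_norm A)) \<partial>walk E (m + n)) =
    (\<integral>\<^sup>+A. (\<integral>\<^sup>+B. ennreal (ln (op_norm (A ** B))) \<partial>walk E n) \<partial>walk E m)"
    by (rule nn_integral_conv_power_add[OF mu]) measurable
  also have "\<dots> \<le> (\<integral>\<^sup>+A. (\<integral>\<^sup>+B. ennreal (ln (op_norm A)) + ennreal (ln (op_norm B)) \<partial>walk E n) \<partial>walk E m)"
  proof (intro nn_integral_mono)
    fix A B assume "A \<in> space (walk E m)" "B \<in> space (walk E n)"
    then have AB: "A \<in> SL2" "B \<in> SL2" by (auto simp: space_walk)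
    note g = op_norm_ge_1[OF AB(1)] op_norm_ge_1[OF AB(2)] op_norm_ge_1[OF SL2_mult[OF AB]]
    have "ln (op_norm (A ** B)) \<le> ln (op_norm A * op_norm B)"
      using g op_norm_mult[of A B] by simp
    also have "\<dots> = ln (op_norm A) + ln (op_norm B)" using g by (intro ln_mult_pos) auto
    finally show "ennreal (ln (op_norm (A ** B))) \<le> ennreal (ln (op_norm A)) + ennreal (ln (op_norm B))"
      using g by (simp flip: ennreal_plus add: ennreal_leI)
  qed
  also have "\<dots> = (\<integral>\<^sup>+A. ennreal (ln (op_norm A)) + (\<integral>\<^sup>+B. ennreal (ln (op_norm B)) \<partial>walk E n) \<partial>walk E m)"
    by (simp add: nn_integral_add W.emeasure_space_1)
  also have "\<dots> = (\<integral>\<^sup>+A. ennreal (ln (op_norm A)) \<partial>walk E m) + (\<integral>\<^sup>+A. ennreal (ln (op_norm A)) \<partial>walk E n)"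
    by (simp add: nn_integral_add W'.emeasure_space_1)
  finally show ?thesis .
qed

lemma ln_op_norm_S_mat: "ln (op_norm (S_mat (x - E))) \<le> ln (1 + \<bar>x\<bar>) + ln (2 + \<bar>E\<bar>)"
proof -
  have "ln (op_norm (S_mat (x - E))) \<le> ln ((1 + \<bar>x\<bar>) * (2 + \<bar>E\<bar>))"
    using op_norm_S_mat[of x E] op_norm_ge_1[OF S_mat_in_SL2, of "x - E"] by simp
  then show ?thesis by (simp add: ln_mult_pos)
qed

lemma nn_mean_log_le: "(\<integral>\<^sup>+A. ennreal (ln (op_norm A)) \<partial>walk E n) \<le> ennreal (real n * ln_bound E)"
proof (induction n)
  case 0
  have "op_norm (mat 1 :: real^2^2) \<le> 1"
    unfolding op_norm_def by (rule onorm_le) simp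
  then have "op_norm (mat 1 :: real^2^2) = 1" using op_norm_ge_1[OF SL2_1] by simp
  then show ?case by (simp add: nn_integral_return space_SL2_borel SL2_1)
next
  case (Suc n)
  have 0: "0 \<le> ln_bound E" unfolding ln_bound_def by (intro add_nonneg_nonneg integral_nonneg_AE) auto
  have "(\<integral>\<^sup>+A. ennreal (ln (op_norm A)) \<partial>walk E 1) = (\<integral>\<^sup>+A. (\<integral>\<^sup>+B. ennreal (ln (op_norm (A ** B))) \<partial>walk E 0) \<partial>mu_E \<nu> E)"
    using nn_integral_conv_power_Suc[OF mu, of "\<lambda>A. ennreal (ln (op_norm A))" E 0] by simp
  also have "\<dots> = (\<integral>\<^sup>+A. ennreal (ln (op_norm A)) \<partial>mu_E \<nu> E)"
  proof (rule nn_integral_cong)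
    fix A assume "A \<in> space (mu_E \<nu> E)"
    then have A: "(\<lambda>B. A) \<in> SL2_borel \<rightarrow>\<^sub>M SL2_borel" using sets_eq_imp_space_eq[OF mu(2)] by simp
    note [measurable] = A
    show "(\<integral>\<^sup>+B. ennreal (ln (op_norm (A ** B))) \<partial>walk E 0) = ennreal (ln (op_norm A))"
      by (subst conv_power.simps, subst nn_integral_return) (auto simp: space_SL2_borel SL2_1)
  qed
  also have "\<dots> = (\<integral>\<^sup>+x. ennreal (ln (op_norm (S_mat (x - E)))) \<partial>\<nu>)"
    by (rule nn_integral_mu) measurable
  also have "\<dots> \<le> (\<integral>\<^sup>+x. ennreal (ln (1 + \<bar>x\<bar>) + ln (2 + \<bar>E\<bar>)) \<partial>\<nu>)"
    by (intro nn_integral_mono ennreal_leI ln_op_norm_S_mat)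
  also have "\<dots> = ennreal (\<integral>x. ln (1 + \<bar>x\<bar>) + ln (2 + \<bar>E\<bar>) \<partial>\<nu>)"
    using ln_moment by (intro nn_integral_eq_integral) auto
  also have "(\<integral>x. ln (1 + \<bar>x\<bar>) + ln (2 + \<bar>E\<bar>) \<partial>\<nu>) = ln_bound E"
    using ln_moment by (simp add: ln_bound_def prob_space)
  finally have 1: "(\<integral>\<^sup>+A. ennreal (ln (op_norm A)) \<partial>walk E 1) \<le> ennreal (ln_bound E)" .
  have "(\<integral>\<^sup>+A. ennreal (ln (op_norm A)) \<partial>walk E (1 + n)) \<le> ennreal (ln_bound E) + ennreal (real n * ln_bound E)"
    by (rule order_trans[OF nn_mean_log_subadditive add_mono[OF 1 Suc]])
  also have "\<dots> = ennreal (real (Suc n) * ln_bound E)"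
    using 0 by (simp flip: ennreal_plus add: algebra_simps)
  finally show ?case by simp
qed

lemma integrable_ln_op_norm: "integrable (walk E n) (\<lambda>A. ln (op_norm A))"
proof (rule integrableI_nonneg)
  note [measurable_cong] = sets_walk
  show "(\<lambda>A. ln (op_norm A)) \<in> borel_measurable (walk E n)" by measurable
  show "AE A in walk E n. 0 \<le> ln (op_norm A)"
    by (intro AE_I2 ln_ge_zero op_norm_ge_1) (simp add: space_walk)
  show "(\<integral>\<^sup>+A. ennreal (ln (op_norm A)) \<partial>walk E n) < \<infinity>"
    by (rule le_less_trans[OF nn_mean_log_le]) simp
qed

lemma nn_mean_log: "(\<integral>\<^sup>+A. ennreal (ln (op_norm A)) \<partial>walk E n) = ennreal (mean_log E n)"
  unfolding mean_log_def
  by (intro nn_integral_eq_integral integrable_ln_op_norm AE_I2 ln_ge_zero op_norm_ge_1) (simp add: space_walk)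

lemma mean_log_sites: "(\<integral>\<^sup>+x. ennreal (ln (op_norm (transfer n E x))) \<partial>sites n) = ennreal (mean_log E n)"
  unfolding nn_mean_log[symmetric] by (rule nn_integral_walk[symmetric]) measurable

lemma mean_log_le: "mean_log E n \<le> real n * ln_bound E"
proof -
  have "0 \<le> ln_bound E" unfolding ln_bound_def by (intro add_nonneg_nonneg integral_nonneg_AE) auto
  then show ?thesis using nn_mean_log_le[of E n] unfolding nn_mean_log by (simp add: ennreal_le_iff)
qed

lemma mean_log_tendsto: "(\<lambda>n. mean_log E n / real n) \<longlonglongrightarrow> lyapunov1 (mu_E \<nu> E)"
proof -
  have "convergent (\<lambda>n. mean_log E n / real n)"
  proof (rule convergent_subadditive_average)
    fix m n
    show "mean_log E (m + n) \<le> mean_log E m + mean_log E n"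
      using nn_mean_log_subadditive[of E m n] mean_log_nonneg
      unfolding nn_mean_log by (simp flip: ennreal_plus)
  qed (rule mean_log_nonneg)
  then have "(\<lambda>n. mean_log E n / real n) \<longlonglongrightarrow> lim (\<lambda>n. mean_log E n / real n)"
    by (simp add: convergent_LIMSEQ_iff)
  then show ?thesis unfolding lyapunov1_def mean_log_def by simp
qed

lemma lyapunov1_nonneg: "0 \<le> lyapunov1 (mu_E \<nu> E)"
  by (rule LIMSEQ_le_const[OF mean_log_tendsto]) (simp add: mean_log_nonneg)

lemma lyapunov1_le: "lyapunov1 (mu_E \<nu> E) \<le> ln_bound E"
proof (rule LIMSEQ_le_const2[OF mean_log_tendsto], intro exI allI impI)
  fix n :: nat assume "1 \<le> n"
  then show "mean_log E n / real n \<le> ln_bound E" using mean_log_le[of E n] by (simp add: field_simps)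
qed

lemma measurable_mean_log: "(\<lambda>E. mean_log E n) \<in> borel_measurable borel"
proof -
  interpret S: prob_space "sites n" by (intro prob_space_PiM prob_space_axioms)
  note M = measurable_transfer_sites[OF order_refl, of n]
  have "(\<lambda>E. enn2real (\<integral>\<^sup>+x. ennreal (ln (op_norm (transfer n E x))) \<partial>sites n)) \<in> borel_measurable borel"
    using measurable_compose[OF M measurable_op_norm]
    by (intro borel_measurable_enn2real borel_measurable_nn_integral) (simp add: case_prod_beta)
  then show ?thesis by (simp add: mean_log_sites mean_log_nonneg)
qed

lemma measurable_lyapunov1: "(\<lambda>E. lyapunov1 (mu_E \<nu> E)) \<in> borel_measurable borel"
proof (rule borel_measurable_LIMSEQ_metric)
  show "(\<lambda>E. mean_log E n / real n) \<in> borel_measurable borel" for n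
    using measurable_mean_log[of n] by measurable
  show "(\<lambda>n. mean_log E n / real n) \<longlonglongrightarrow> lyapunov1 (mu_E \<nu> E)" for E by (rule mean_log_tendsto)
qed

end

section \<open>The gain of the Lyapunov exponent under averaging\<close>

lemma ln_one_plus_le_sqrt:
  fixes t :: real assumes "0 \<le> t" shows "ln (1 + t) \<le> 2 * t powr (1/2)"
proof -
  have "1 + t \<le> (1 + sqrt t)\<^sup>2" using assms by (simp add: power2_eq_square algebra_simps)
  then have "ln (1 + t) \<le> ln ((1 + sqrt t)\<^sup>2)" using assms by (intro ln_mono) auto
  also have "\<dots> = 2 * ln (1 + sqrt t)" using assms by (simp add: ln_realpow add_pos_nonneg)
  also have "\<dots> \<le> 2 * sqrt t" using assms ln_add_one_self_le_self[of "sqrt t"] by simp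
  finally show ?thesis using assms by (simp add: powr_half_sqrt)
qed

context random_potential begin

lemma integrable_ln_bound: "integrable cauchy_law (\<lambda>s. ln_bound (\<epsilon> * s))"
proof -
  interpret C: prob_space cauchy_law by (rule prob_space_cauchy_law)
  have "integrable cauchy_law (\<lambda>s. ln (2 + \<bar>\<epsilon> * s\<bar>))"
  proof (rule Bochner_Integration.integrable_bound)
    show "integrable cauchy_law (\<lambda>s. ln 2 + 2 * \<bar>\<epsilon>\<bar> powr (1/2) * \<bar>s\<bar> powr (1/2))"
      using cauchy_law_integrable_sqrt by simp
    have "ln (2 + \<bar>\<epsilon> * s\<bar>) \<le> ln 2 + 2 * \<bar>\<epsilon>\<bar> powr (1/2) * \<bar>s\<bar> powr (1/2)" for s
    proof -
      have "ln (2 + \<bar>\<epsilon> * s\<bar>) \<le> ln (2 * (1 + \<bar>\<epsilon> * s\<bar>))" by (intro ln_mono) auto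
      also have "\<dots> = ln 2 + ln (1 + \<bar>\<epsilon> * s\<bar>)" by (intro ln_mult_pos) auto
      also have "ln (1 + \<bar>\<epsilon> * s\<bar>) \<le> 2 * \<bar>\<epsilon> * s\<bar> powr (1/2)" by (rule ln_one_plus_le_sqrt) simp
      also have "\<bar>\<epsilon> * s\<bar> powr (1/2) = \<bar>\<epsilon>\<bar> powr (1/2) * \<bar>s\<bar> powr (1/2)" by (simp add: abs_mult powr_mult)
      finally show ?thesis by simp
    qed
    moreover have "0 \<le> ln (2 + \<bar>\<epsilon> * s\<bar>)" for s by simp
    ultimately show "AE s in cauchy_law. norm (ln (2 + \<bar>\<epsilon> * s\<bar>)) \<le> norm (ln 2 + 2 * \<bar>\<epsilon>\<bar> powr (1/2) * \<bar>s\<bar> powr (1/2))"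
      by (intro AE_I2) (smt (verit) real_norm_def)
  qed simp
  then show ?thesis unfolding ln_bound_def by simp
qed

lemma integrable_lyapunov1: "integrable cauchy_law (\<lambda>s. lyapunov1 (mu_E \<nu> (\<epsilon> * s)))"
proof (rule Bochner_Integration.integrable_bound[OF integrable_ln_bound[of \<epsilon>]])
  note measurable_lyapunov1[measurable]
  show "(\<lambda>s. lyapunov1 (mu_E \<nu> (\<epsilon> * s))) \<in> borel_measurable cauchy_law" by measurable
  show "AE s in cauchy_law. norm (lyapunov1 (mu_E \<nu> (\<epsilon> * s))) \<le> norm (ln_bound (\<epsilon> * s))"
    using lyapunov1_nonneg lyapunov1_le by (intro AE_I2) (smt (verit) real_norm_def)
qed

definition isolation_prob :: "real \<Rightarrow> real" where
  "isolation_prob \<eta> = prob {x. \<bar>x\<bar> \<le> \<eta>} * (prob {x. \<bar>x\<bar> \<ge> 3 / \<eta>})\<^sup>2"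

text \<open>The event concerns three different sites, which are independent.\<close>

lemma emeasure_isolated:
  assumes j: "0 < j" "Suc j < n"
  shows "{x \<in> space (sites n). isolated \<eta> n x j} \<in> sets (sites n)"
    and "emeasure (sites n) {x \<in> space (sites n). isolated \<eta> n x j} = ennreal (isolation_prob \<eta>)"
proof -
  interpret P: product_sigma_finite "\<lambda>_::nat. \<nu>" by (rule product_sigma_finite_nu)
  define S B where "S = {x::real. \<bar>x\<bar> \<le> \<eta>}" and "B = {x::real. \<bar>x\<bar> \<ge> 3 / \<eta>}"
  define A where "A i = (if i = j then S else if i = j - 1 \<or> i = Suc j then B else UNIV)" for i
  have SB: "S \<in> sets \<nu>" "B \<in> sets \<nu>" unfolding S_def B_def sets_nu by measurable
  have A: "A i \<in> sets \<nu>" for i using SB sets.top[of \<nu>] by (auto simp: A_def space_nu)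
  have eq: "{x \<in> space (sites n). isolated \<eta> n x j} = PiE {..<n} A"
  proof (intro set_eqI iffI)
    fix x assume "x \<in> {x \<in> space (sites n). isolated \<eta> n x j}"
    then show "x \<in> PiE {..<n} A"
      by (auto simp: isolated_def A_def S_def B_def space_PiM PiE_iff)
  next
    fix x assume x: "x \<in> PiE {..<n} A"
    have "x j \<in> A j" "x (j - 1) \<in> A (j - 1)" "x (Suc j) \<in> A (Suc j)"
      using x j by (auto simp: PiE_iff)
    then show "x \<in> {x \<in> space (sites n). isolated \<eta> n x j}"
      using x j by (auto simp: isolated_def A_def S_def B_def space_PiM PiE_iff space_nu split: if_splits)
  qed
  show "{x \<in> space (sites n). isolated \<eta> n x j} \<in> sets (sites n)"
    unfolding eq by (rule sets_PiM_I_finite) (use A in auto)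
  have "emeasure (sites n) {x \<in> space (sites n). isolated \<eta> n x j} = (\<Prod>i\<in>{..<n}. emeasure \<nu> (A i))"
    unfolding eq by (rule P.emeasure_PiM) (use A in auto)
  also have "\<dots> = (\<Prod>i\<in>{j - 1, j, Suc j}. emeasure \<nu> (A i))"
    by (rule prod.mono_neutral_right) (use j emeasure_space_1 in \<open>auto simp: A_def space_nu\<close>)
  also have "\<dots> = emeasure \<nu> B * (emeasure \<nu> S * emeasure \<nu> B)"
    using j by (cases j) (auto simp: A_def)
  also have "\<dots> = ennreal (isolation_prob \<eta>)"
    by (simp add: emeasure_eq_measure isolation_prob_def S_def B_def power2_eq_square ac_simps flip: ennreal_mult)
  finally show "emeasure (sites n) {x \<in> space (sites n). isolated \<eta> n x j} = ennreal (isolation_prob \<eta>)" .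
qed

lemma isolation_prob_nonneg: "0 \<le> isolation_prob \<eta>"
  by (simp add: isolation_prob_def)

lemma mean_log_growth:
  assumes \<eta>: "0 < \<eta>" "\<eta> \<le> 1"
  shows "mean_log 0 n + ln 2 * (real (n - 2) * isolation_prob \<eta>)
    \<le> (\<integral>s. mean_log (6 * \<eta> * s) n \<partial>cauchy_law) + ln (4 / \<eta>\<^sup>2)"
proof -
  interpret C: prob_space cauchy_law by (rule prob_space_cauchy_law)
  interpret S: prob_space "sites n" by (intro prob_space_PiM prob_space_axioms)
  interpret CS: pair_sigma_finite cauchy_law "sites n" ..
  define I where "I j = {x \<in> space (sites n). isolated \<eta> n x j}" for j
  define J where "J = {j. 0 < j \<and> Suc j < n}"
  have fJ: "finite J" unfolding J_def by (rule finite_subset[of _ "{..<n}"]) auto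
  have cJ: "card J = n - 2"
  proof -
    have "J = {1..<n - 1}" by (auto simp: J_def)
    then show ?thesis by simp
  qed
  have ln4: "0 \<le> ln (4 / \<eta>\<^sup>2)"
  proof -
    have "\<eta>\<^sup>2 \<le> 1" using \<eta> by (simp add: power_le_one)
    then show ?thesis using \<eta> by (intro ln_ge_zero) (auto simp: field_simps)
  qed
  have Im[measurable]: "I j \<in> sets (sites n)" if "j \<in> J" for j
    using emeasure_isolated(1) that by (auto simp: I_def J_def)
  have lnm [measurable]: "(\<lambda>x. ln (op_norm (transfer n E x))) \<in> borel_measurable (sites n)" for E
    by measurable
  have ln0: "0 \<le> ln (op_norm (transfer n E x))" for E x
    by (intro ln_ge_zero op_norm_ge_1 transfer_SL2)
  have "(\<integral>\<^sup>+x. ennreal (ln (op_norm (transfer n 0 x)) + ln 2 * (\<Sum>j<n. of_bool (isolated \<eta> n x j))) \<partial>sites n)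
    = (\<integral>\<^sup>+x. ennreal (ln (op_norm (transfer n 0 x))) + (\<Sum>j\<in>J. ennreal (ln 2) * indicator (I j) x) \<partial>sites n)"
  proof (rule nn_integral_cong)
    fix x assume x: "x \<in> space (sites n)"
    have "(\<Sum>j<n. of_bool (isolated \<eta> n x j)) = (\<Sum>j\<in>J. of_bool (isolated \<eta> n x j) :: real)"
      by (rule sum.mono_neutral_right) (auto simp: J_def isolated_def)
    then have "ln 2 * (\<Sum>j<n. of_bool (isolated \<eta> n x j)) = (\<Sum>j\<in>J. ln 2 * indicator (I j) x :: real)"
      using x by (simp add: sum_distrib_left I_def indicator_def of_bool_def del: sum.inter_filter)
    moreover have "ennreal (\<Sum>j\<in>J. ln 2 * indicator (I j) x :: real) = (\<Sum>j\<in>J. ennreal (ln 2) * indicator (I j) x)"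
      by (subst sum_ennreal[symmetric]) (auto simp: ennreal_mult ennreal_indicator intro!: sum.cong)
    moreover have "0 \<le> (\<Sum>j\<in>J. ln 2 * indicator (I j) x :: real)" by (intro sum_nonneg) auto
    ultimately show "ennreal (ln (op_norm (transfer n 0 x)) + ln 2 * (\<Sum>j<n. of_bool (isolated \<eta> n x j))) =
      ennreal (ln (op_norm (transfer n 0 x))) + (\<Sum>j\<in>J. ennreal (ln 2) * indicator (I j) x)"
      using ln0 by simp
  qed
  also have "\<dots> = ennreal (mean_log 0 n) + (\<Sum>j\<in>J. ennreal (ln 2) * emeasure (sites n) (I j))"
    using Im by (subst nn_integral_add) (auto simp: nn_integral_sum nn_integral_cmult_indicator mean_log_sites)
  also have "\<dots> = ennreal (mean_log 0 n) + (\<Sum>j\<in>J. ennreal (ln 2 * isolation_prob \<eta>))"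
    using emeasure_isolated(2) isolation_prob_nonneg by (simp add: I_def J_def ennreal_mult)
  also have "\<dots> = ennreal (mean_log 0 n + ln 2 * (real (n - 2) * isolation_prob \<eta>))"
    using isolation_prob_nonneg mean_log_nonneg
    by (simp add: cJ ennreal_of_nat_eq_real_of_nat flip: ennreal_mult ennreal_plus add: mult.left_commute)
  finally have L: "(\<integral>\<^sup>+x. ennreal (ln (op_norm (transfer n 0 x)) + ln 2 * (\<Sum>j<n. of_bool (isolated \<eta> n x j))) \<partial>sites n)
    = ennreal (mean_log 0 n + ln 2 * (real (n - 2) * isolation_prob \<eta>))" .
  have mp: "(\<lambda>p. ln (op_norm (transfer n (6 * \<eta> * fst p) (snd p)))) \<in> borel_measurable (cauchy_law \<Otimes>\<^sub>M sites n)"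
  proof -
    have "(\<lambda>p. (6 * \<eta> * fst p, snd p)) \<in> cauchy_law \<Otimes>\<^sub>M sites n \<rightarrow>\<^sub>M borel \<Otimes>\<^sub>M sites n" by measurable
    from measurable_compose[OF measurable_compose[OF this measurable_transfer_sites[OF order_refl]] measurable_op_norm]
    show ?thesis by simp
  qed
  have int: "integrable cauchy_law (\<lambda>s. mean_log (6 * \<eta> * s) n)"
  proof (rule Bochner_Integration.integrable_bound)
    show "integrable cauchy_law (\<lambda>s. real n * ln_bound (6 * \<eta> * s))"
      using integrable_ln_bound[of "6 * \<eta>"] by simp
    show "(\<lambda>s. mean_log (6 * \<eta> * s) n) \<in> borel_measurable cauchy_law"
      using measurable_mean_log[of n] by measurable
    show "AE s in cauchy_law. norm (mean_log (6 * \<eta> * s) n) \<le> norm (real n * ln_bound (6 * \<eta> * s))"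
      using mean_log_nonneg mean_log_le by (intro AE_I2) (smt (verit) real_norm_def)
  qed
  have "ennreal (mean_log 0 n + ln 2 * (real (n - 2) * isolation_prob \<eta>)) \<le>
    (\<integral>\<^sup>+x. (\<integral>\<^sup>+s. ennreal (ln (op_norm (transfer n (6 * \<eta> * s) x))) \<partial>cauchy_law) + ennreal (ln (4 / \<eta>\<^sup>2)) \<partial>sites n)"
    unfolding L[symmetric] by (intro nn_integral_mono transfer_growth \<eta>)
  also have "\<dots> = (\<integral>\<^sup>+x. (\<integral>\<^sup>+s. ennreal (ln (op_norm (transfer n (6 * \<eta> * s) x))) \<partial>cauchy_law) \<partial>sites n) + ennreal (ln (4 / \<eta>\<^sup>2))"
  proof (subst nn_integral_add)
    show "(\<lambda>x. \<integral>\<^sup>+s. ennreal (ln (op_norm (transfer n (6 * \<eta> * s) x))) \<partial>cauchy_law) \<in> borel_measurable (sites n)"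
    proof (rule C.borel_measurable_nn_integral)
      show "(\<lambda>(x, s). ennreal (ln (op_norm (transfer n (6 * \<eta> * s) x)))) \<in> borel_measurable (sites n \<Otimes>\<^sub>M cauchy_law)"
        using measurable_pair_swap[OF measurable_compose[OF mp measurable_ennreal]] by (simp add: case_prod_beta)
    qed
  qed (auto simp: S.emeasure_space_1)
  also have "(\<integral>\<^sup>+x. (\<integral>\<^sup>+s. ennreal (ln (op_norm (transfer n (6 * \<eta> * s) x))) \<partial>cauchy_law) \<partial>sites n) =
    (\<integral>\<^sup>+s. (\<integral>\<^sup>+x. ennreal (ln (op_norm (transfer n (6 * \<eta> * s) x))) \<partial>sites n) \<partial>cauchy_law)"
    by (rule CS.Fubini') (use measurable_compose[OF mp measurable_ennreal] in \<open>simp add: case_prod_beta\<close>)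
  also have "\<dots> = (\<integral>\<^sup>+s. ennreal (mean_log (6 * \<eta> * s) n) \<partial>cauchy_law)" by (simp add: mean_log_sites)
  also have "\<dots> = ennreal (\<integral>s. mean_log (6 * \<eta> * s) n \<partial>cauchy_law)"
    by (rule nn_integral_eq_integral[OF int]) (simp add: mean_log_nonneg)
  also have "\<dots> + ennreal (ln (4 / \<eta>\<^sup>2)) = ennreal ((\<integral>s. mean_log (6 * \<eta> * s) n \<partial>cauchy_law) + ln (4 / \<eta>\<^sup>2))"
    using ln4 by (intro ennreal_plus[symmetric] integral_nonneg_AE) (auto simp: mean_log_nonneg)
  finally show ?thesis
    by (subst (asm) ennreal_le_iff) (use ln4 in \<open>auto intro!: add_nonneg_nonneg integral_nonneg_AE simp: mean_log_nonneg\<close>)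
qed

text \<open>The \<open>n - 2\<close> inner sites are isolated with the same probability, so dividing the inequality for length
  \<open>n\<close> by \<open>n\<close> leaves this probability in the limit, while the constant disappears. The majorant
  \<open>ln_bound\<close> allows passing to the limit under the Cauchy mean.\<close>

lemma lyapunov1_average_gain:
  assumes \<eta>: "0 < \<eta>" "\<eta> \<le> 1"
  shows "lyapunov1 (mu_E \<nu> 0) + ln 2 * isolation_prob \<eta> \<le> (\<integral>s. lyapunov1 (mu_E \<nu> (6 * \<eta> * s)) \<partial>cauchy_law)"
proof (rule LIMSEQ_le)
  show "(\<lambda>n. mean_log 0 n / real n + ln 2 * isolation_prob \<eta> * (real (n - 2) / real n)) \<longlonglongrightarrow> lyapunov1 (mu_E \<nu> 0) + ln 2 * isolation_prob \<eta>"
  proof -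
    have "(\<lambda>n. real (n - 2) / real n) \<longlonglongrightarrow> 1"
    proof (rule Lim_transform_eventually)
      show "(\<lambda>n. 1 - 2 / real n) \<longlonglongrightarrow> 1"
        using tendsto_diff[OF tendsto_const lim_const_over_n[of 2], of 1] by simp
      show "\<forall>\<^sub>F n in sequentially. 1 - 2 / real n = real (n - 2) / real n"
        using eventually_ge_at_top[of 2] by eventually_elim (simp add: of_nat_diff field_simps)
    qed
    from tendsto_add[OF mean_log_tendsto tendsto_mult[OF tendsto_const this]] show ?thesis by simp
  qed
  show "(\<lambda>n. (\<integral>s. mean_log (6 * \<eta> * s) n / real n \<partial>cauchy_law) + ln (4 / \<eta>\<^sup>2) / real n) \<longlonglongrightarrow> (\<integral>s. lyapunov1 (mu_E \<nu> (6 * \<eta> * s)) \<partial>cauchy_law)"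
  proof -
    have "(\<lambda>n. \<integral>s. mean_log (6 * \<eta> * s) n / real n \<partial>cauchy_law) \<longlonglongrightarrow> (\<integral>s. lyapunov1 (mu_E \<nu> (6 * \<eta> * s)) \<partial>cauchy_law)"
    proof (rule integral_dominated_convergence)
      show "integrable cauchy_law (\<lambda>s. ln_bound (6 * \<eta> * s))" by (rule integrable_ln_bound)
      show "(\<lambda>s. lyapunov1 (mu_E \<nu> (6 * \<eta> * s))) \<in> borel_measurable cauchy_law"
        using integrable_lyapunov1[of "6 * \<eta>"] by (rule borel_measurable_integrable)
      show "(\<lambda>s. mean_log (6 * \<eta> * s) n / real n) \<in> borel_measurable cauchy_law" for n
        using measurable_mean_log[of n] by measurable
      show "AE s in cauchy_law. (\<lambda>n. mean_log (6 * \<eta> * s) n / real n) \<longlonglongrightarrow> lyapunov1 (mu_E \<nu> (6 * \<eta> * s))"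
        by (intro AE_I2 mean_log_tendsto)
      show "AE s in cauchy_law. norm (mean_log (6 * \<eta> * s) n / real n) \<le> ln_bound (6 * \<eta> * s)" for n
      proof (intro AE_I2)
        fix s
        have "0 \<le> ln_bound (6 * \<eta> * s)" by (rule order_trans[OF lyapunov1_nonneg lyapunov1_le])
        then show "norm (mean_log (6 * \<eta> * s) n / real n) \<le> ln_bound (6 * \<eta> * s)"
          using mean_log_le[of "6 * \<eta> * s" n] mean_log_nonneg[of "6 * \<eta> * s" n]
          by (cases "n = 0") (auto simp: field_simps)
      qed
    qed
    from tendsto_add[OF this lim_const_over_n[of "ln (4 / \<eta>\<^sup>2)"]] show ?thesis by simp
  qed
  show "\<exists>N. \<forall>n\<ge>N. mean_log 0 n / real n + ln 2 * isolation_prob \<eta> * (real (n - 2) / real n)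
    \<le> (\<integral>s. mean_log (6 * \<eta> * s) n / real n \<partial>cauchy_law) + ln (4 / \<eta>\<^sup>2) / real n"
  proof (intro exI allI impI)
    fix n :: nat assume "1 \<le> n"
    then have "(mean_log 0 n + ln 2 * (real (n - 2) * isolation_prob \<eta>)) / real n
      \<le> ((\<integral>s. mean_log (6 * \<eta> * s) n \<partial>cauchy_law) + ln (4 / \<eta>\<^sup>2)) / real n"
      by (intro divide_right_mono mean_log_growth \<eta>) auto
    then show "mean_log 0 n / real n + ln 2 * isolation_prob \<eta> * (real (n - 2) / real n)
      \<le> (\<integral>s. mean_log (6 * \<eta> * s) n / real n \<partial>cauchy_law) + ln (4 / \<eta>\<^sup>2) / real n"
      by (simp add: add_divide_distrib algebra_simps)
  qed
qed

end

section \<open>Consequences of Hoelder continuity\<close>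

context random_potential begin

text \<open>Near 0 this is the Hoelder bound; away from 0 the logarithmic growth of the exponent is absorbed by a
  power. The Hoelder exponent is lowered to at most \<open>1/2\<close> because the Cauchy law has a finite absolute
  moment of that order, but none of order 1.\<close>

lemma holder_growth:
  assumes \<alpha>: "0 < \<alpha>" and hol: "locally_holder \<alpha> (\<lambda>E. lyapunov1 (mu_E \<nu> E))"
  defines "\<beta> \<equiv> min \<alpha> (1/2)"
  obtains K where "\<And>s. lyapunov1 (mu_E \<nu> s) \<le> lyapunov1 (mu_E \<nu> 0) + K * \<bar>s\<bar> powr \<beta>" "0 \<le> K"
proof -
  define L where "L E = lyapunov1 (mu_E \<nu> E)" for E
  obtain r0 C where r0: "0 < r0" and C: "\<And>x y. x \<in> {- r0<..<r0} \<Longrightarrow> y \<in> {- r0<..<r0} \<Longrightarrow> \<bar>L x - L y\<bar> \<le> C * \<bar>x - y\<bar> powr \<alpha>"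
    using hol unfolding locally_holder_def L_def by (metis add_0 diff_0)
  define r where "r = min r0 1"
  have r: "0 < r" "r \<le> 1" "r \<le> r0" using r0 by (auto simp: r_def)
  have \<beta>: "0 < \<beta>" "\<beta> \<le> \<alpha>" using \<alpha> by (auto simp: \<beta>_def)
  define m where "m = (\<integral>x. ln (1 + \<bar>x\<bar>) \<partial>\<nu>) + 1"
  have m: "0 \<le> m" unfolding m_def by (intro add_nonneg_nonneg integral_nonneg_AE) auto
  define K where "K = \<bar>C\<bar> + m / r powr \<beta> + (1 + 1 / r) powr \<beta> / \<beta>"
  have K0: "0 \<le> K" using m \<beta> by (auto simp: K_def)
  have "L s \<le> L 0 + K * \<bar>s\<bar> powr \<beta>" for s
  proof (cases "\<bar>s\<bar> < r")
    case True
    then have "\<bar>L s - L 0\<bar> \<le> C * \<bar>s\<bar> powr \<alpha>" using C[of s 0] r by (auto simp: abs_less_iff)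
    also have "\<dots> \<le> \<bar>C\<bar> * \<bar>s\<bar> powr \<alpha>" by (intro mult_right_mono) auto
    also have "\<dots> \<le> \<bar>C\<bar> * \<bar>s\<bar> powr \<beta>"
      using True r \<beta> by (intro mult_left_mono powr_mono') auto
    also have "\<dots> \<le> K * \<bar>s\<bar> powr \<beta>" using m \<beta> by (intro mult_right_mono) (auto simp: K_def)
    finally show ?thesis by linarith
  next
    case False
    define t where "t = \<bar>s\<bar>"
    have t: "r \<le> t" "0 < t" using False r by (auto simp: t_def)
    have "L s \<le> (m - 1) + ln (2 + t)" using lyapunov1_le[of s] by (simp add: L_def m_def ln_bound_def t_def)
    also have "ln (2 + t) \<le> 1 + ln (1 + t)"
    proof -
      have "ln (2 + t) \<le> ln (2 * (1 + t))" using t by (intro ln_mono) auto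
      also have "\<dots> = ln 2 + ln (1 + t)" using t by (intro ln_mult_pos) auto
      finally show ?thesis using ln_2_less_1 by linarith
    qed
    also have "ln (1 + t) \<le> (1 + t) powr \<beta> / \<beta>"
    proof -
      have "ln ((1 + t) powr \<beta>) \<le> (1 + t) powr \<beta> - 1" using t by (intro ln_le_minus_one) auto
      then show ?thesis using t \<beta> by (simp add: ln_powr field_simps)
    qed
    also have "(1 + t) powr \<beta> \<le> ((1 + 1 / r) * t) powr \<beta>"
      using t r \<beta> by (intro powr_mono2) (auto simp: field_simps)
    also have "\<dots> = (1 + 1 / r) powr \<beta> * t powr \<beta>" by (rule powr_mult)
    finally have "L s \<le> m + (1 + 1 / r) powr \<beta> * t powr \<beta> / \<beta>" using \<beta> by (simp add: divide_right_mono)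
    also have "m \<le> m / r powr \<beta> * t powr \<beta>"
    proof -
      have "r powr \<beta> \<le> t powr \<beta>" using t r \<beta> by (intro powr_mono2) auto
      then have "m * r powr \<beta> \<le> m * t powr \<beta>" using m by (rule mult_left_mono)
      then show ?thesis using r by (simp add: field_simps)
    qed
    finally have "L s \<le> (m / r powr \<beta> + (1 + 1 / r) powr \<beta> / \<beta>) * t powr \<beta>" by (simp add: algebra_simps)
    also have "\<dots> \<le> K * t powr \<beta>" by (intro mult_right_mono) (auto simp: K_def)
    finally show ?thesis using lyapunov1_nonneg[of 0] by (simp add: L_def t_def)
  qed
  then show thesis using that K0 unfolding L_def by blast
qed

lemma holder_isolation:
  assumes \<alpha>: "0 < \<alpha>" and hol: "locally_holder \<alpha> (\<lambda>E. lyapunov1 (mu_E \<nu> E))"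
  obtains K where "\<And>\<eta>. 0 < \<eta> \<Longrightarrow> \<eta> \<le> 1 \<Longrightarrow> isolation_prob \<eta> \<le> K * \<eta> powr (min \<alpha> (1/2))"
proof -
  interpret C: prob_space cauchy_law by (rule prob_space_cauchy_law)
  define \<beta> where "\<beta> = min \<alpha> (1/2)"
  obtain K where K: "\<And>s. lyapunov1 (mu_E \<nu> s) \<le> lyapunov1 (mu_E \<nu> 0) + K * \<bar>s\<bar> powr \<beta>" "0 \<le> K"
    using holder_growth[OF assms] unfolding \<beta>_def by blast
  have \<beta>: "0 < \<beta>" "\<beta> \<le> 1/2" using \<alpha> by (auto simp: \<beta>_def)
  define M where "M = (\<integral>s. 1 + \<bar>s\<bar> powr (1/2) \<partial>cauchy_law)"
  have iM: "integrable cauchy_law (\<lambda>s. 1 + \<bar>s\<bar> powr (1/2))" using cauchy_law_integrable_sqrt by simp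
  have "isolation_prob \<eta> \<le> (K * 6 powr \<beta> * M / ln 2) * \<eta> powr \<beta>" if \<eta>: "0 < \<eta>" "\<eta> \<le> 1" for \<eta>
  proof -
    have b: "\<bar>s\<bar> powr \<beta> \<le> 1 + \<bar>s\<bar> powr (1/2)" for s :: real
    proof (cases "\<bar>s\<bar> \<le> 1")
      case True
      then have "\<bar>s\<bar> powr \<beta> \<le> 1 powr \<beta>" using \<beta> by (intro powr_mono2) auto
      then show ?thesis by (simp add: add_increasing2)
    next
      case False
      then have "\<bar>s\<bar> powr \<beta> \<le> \<bar>s\<bar> powr (1/2)" using \<beta> by (intro powr_mono) auto
      then show ?thesis by simp
    qed
    have "lyapunov1 (mu_E \<nu> 0) + ln 2 * isolation_prob \<eta> \<le> (\<integral>s. lyapunov1 (mu_E \<nu> (6 * \<eta> * s)) \<partial>cauchy_law)"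
      by (rule lyapunov1_average_gain[OF \<eta>])
    also have "\<dots> \<le> (\<integral>s. lyapunov1 (mu_E \<nu> 0) + K * (6 * \<eta>) powr \<beta> * (1 + \<bar>s\<bar> powr (1/2)) \<partial>cauchy_law)"
    proof (rule integral_mono)
      show "integrable cauchy_law (\<lambda>s. lyapunov1 (mu_E \<nu> (6 * \<eta> * s)))" by (rule integrable_lyapunov1)
      show "integrable cauchy_law (\<lambda>s. lyapunov1 (mu_E \<nu> 0) + K * (6 * \<eta>) powr \<beta> * (1 + \<bar>s\<bar> powr (1/2)))"
        by (intro Bochner_Integration.integrable_add integrable_mult_right iM) auto
      fix s
      have "\<bar>6 * \<eta> * s\<bar> powr \<beta> = (6 * \<eta>) powr \<beta> * \<bar>s\<bar> powr \<beta>"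
        using \<eta> by (simp add: abs_mult powr_mult)
      also have "\<dots> \<le> (6 * \<eta>) powr \<beta> * (1 + \<bar>s\<bar> powr (1/2))" by (intro mult_left_mono b) auto
      finally have "K * \<bar>6 * \<eta> * s\<bar> powr \<beta> \<le> K * ((6 * \<eta>) powr \<beta> * (1 + \<bar>s\<bar> powr (1/2)))"
        using K(2) by (rule mult_left_mono)
      then show "lyapunov1 (mu_E \<nu> (6 * \<eta> * s)) \<le> lyapunov1 (mu_E \<nu> 0) + K * (6 * \<eta>) powr \<beta> * (1 + \<bar>s\<bar> powr (1/2))"
        using K(1)[of "6 * \<eta> * s"] by (simp add: mult.assoc)
    qed
    also have "\<dots> = lyapunov1 (mu_E \<nu> 0) + K * (6 * \<eta>) powr \<beta> * M"
      unfolding M_def by (subst Bochner_Integration.integral_add) (use iM in \<open>auto simp: C.prob_space\<close>)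
    finally have "ln 2 * isolation_prob \<eta> \<le> K * (6 * \<eta>) powr \<beta> * M" by linarith
    then show ?thesis using \<eta> by (simp add: powr_mult field_simps)
  qed
  then show thesis using that unfolding \<beta>_def by blast
qed

end

section \<open>Positivity of the Lyapunov exponent\<close>

context random_potential begin

lemma integral_walk_Suc:
  fixes g :: "real^2^2 \<Rightarrow> real"
  assumes gm: "g \<in> borel_measurable SL2_borel" and int: "integrable (walk E (Suc n)) g"
  shows "integrable \<nu> (\<lambda>x. \<integral>B. g (S_mat (x - E) ** B) \<partial>walk E n)"
    and "(\<integral>A. g A \<partial>walk E (Suc n)) = (\<integral>x. (\<integral>B. g (S_mat (x - E) ** B) \<partial>walk E n) \<partial>\<nu>)"
proof -
  note [measurable] = gm
  interpret W: prob_space "walk E n" by (rule prob_space_walk)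
  interpret M: prob_space "mu_E \<nu> E" by (rule mu)
  interpret P: pair_sigma_finite "mu_E \<nu> E" "walk E n" ..
  note [measurable_cong] = sets_walk mu(2)
  have i: "integrable (mu_E \<nu> E \<Otimes>\<^sub>M walk E n) (\<lambda>p. g (case p of (A, B) \<Rightarrow> A ** B))"
    using int unfolding conv_power.simps mconv_def by (subst (asm) integrable_distr_eq) measurable
  have "integrable (mu_E \<nu> E) (\<lambda>A. \<integral>B. g (A ** B) \<partial>walk E n)"
    using P.integrable_fst'[OF i] by simp
  then show "integrable \<nu> (\<lambda>x. \<integral>B. g (S_mat (x - E) ** B) \<partial>walk E n)"
    by (subst (asm) integrable_mu) measurable
  have "(\<integral>A. g A \<partial>walk E (Suc n)) = (\<integral>p. g (case p of (A, B) \<Rightarrow> A ** B) \<partial>(mu_E \<nu> E \<Otimes>\<^sub>M walk E n))"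
    unfolding conv_power.simps mconv_def by (rule integral_distr) measurable
  also have "\<dots> = (\<integral>A. (\<integral>B. g (A ** B) \<partial>walk E n) \<partial>mu_E \<nu> E)"
    using P.integral_fst'[OF i] by simp
  also have "\<dots> = (\<integral>x. (\<integral>B. g (S_mat (x - E) ** B) \<partial>walk E n) \<partial>\<nu>)"
    by (rule integral_mu) measurable
  finally show "(\<integral>A. g A \<partial>walk E (Suc n)) = (\<integral>x. (\<integral>B. g (S_mat (x - E) ** B) \<partial>walk E n) \<partial>\<nu>)" .
qed

end

text \<open>A logarithmic norm on row vectors. The small weight \<open>\<kappa>\<close> on the second coordinate prevents
  a loss in one step for vectors that are nearly parallel to the second axis.\<close>

definition log_size :: "real \<Rightarrow> real \<Rightarrow> real \<Rightarrow> real" where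
  "log_size \<kappa> a b = ln (max \<bar>a\<bar> (\<kappa> * \<bar>b\<bar>))"

definition row_size :: "real \<Rightarrow> real \<Rightarrow> real \<Rightarrow> real^2^2 \<Rightarrow> real" where
  "row_size \<kappa> a b A = log_size \<kappa> (a * A$1$1 + b * A$2$1) (a * A$1$2 + b * A$2$2)"

lemma row_size_S_mat:
  "row_size \<kappa> a b (S_mat v ** B) = row_size \<kappa> (a * v + b) (- a) B"
  by (simp add: row_size_def matrix_matrix_mult_def sum_2 S_mat_nth algebra_simps)

lemma row_size_1: "row_size \<kappa> a b (mat 1) = log_size \<kappa> a b"
  by (simp add: row_size_def mat_def)

lemma measurable_row_size: "row_size \<kappa> a b \<in> borel_measurable SL2_borel"
proof -
  have [measurable]: "(\<lambda>A::real^2^2. A $ i $ j) \<in> borel_measurable SL2_borel" for i j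
    unfolding SL2_borel_def
    by (intro measurable_restrict_space1 borel_measurable_continuous_onI continuous_intros)
  show ?thesis unfolding row_size_def [abs_def] log_size_def by measurable
qed

text \<open>Any two norms on the plane are comparable, and a matrix of determinant 1 contracts a vector at most by
  the inverse of its norm, as its inverse has the same entries up to sign and order.\<close>

lemma row_size_bound:
  assumes \<kappa>: "0 < \<kappa>" "\<kappa> \<le> 1" and ab: "a \<noteq> 0 \<or> b \<noteq> 0"
  obtains R where "0 \<le> R" "\<And>A. A \<in> SL2 \<Longrightarrow> \<bar>row_size \<kappa> a b A\<bar> \<le> ln (op_norm A) + R"
proof -
  define u where "u = \<bar>a\<bar> + \<bar>b\<bar>"
  define v where "v = \<kappa> / 4 * u"
  have u: "0 < u" using ab by (auto simp: u_def)
  have v: "0 < v" using u \<kappa> by (simp add: v_def)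
  show thesis
  proof (rule that[of "\<bar>ln u\<bar> + \<bar>ln v\<bar>"])
    fix A :: "real^2^2" assume A: "A \<in> SL2"
    define w1 w2 where "w1 = a * A$1$1 + b * A$2$1" and "w2 = a * A$1$2 + b * A$2$2"
    define N where "N = op_norm A"
    define m where "m = max \<bar>w1\<bar> (\<kappa> * \<bar>w2\<bar>)"
    have N: "1 \<le> N" using op_norm_ge_1[OF A] by (simp add: N_def)
    have e: "\<bar>A $ i $ j\<bar> \<le> N" for i j unfolding N_def by (rule entry_le_op_norm)
    have lin: "\<bar>p * A $ i $ j + q * A $ k $ l\<bar> \<le> (\<bar>p\<bar> + \<bar>q\<bar>) * N" for p q i j k l
    proof -
      have "\<bar>p * A $ i $ j + q * A $ k $ l\<bar> \<le> \<bar>p\<bar> * \<bar>A $ i $ j\<bar> + \<bar>q\<bar> * \<bar>A $ k $ l\<bar>"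
        using abs_triangle_ineq[of "p * A $ i $ j" "q * A $ k $ l"] by (simp add: abs_mult)
      also have "\<dots> \<le> \<bar>p\<bar> * N + \<bar>q\<bar> * N" by (intro add_mono mult_left_mono e) auto
      finally show ?thesis by (simp add: algebra_simps)
    qed
    have "\<bar>w1\<bar> \<le> u * N" "\<bar>w2\<bar> \<le> u * N" unfolding w1_def w2_def u_def by (rule lin)+
    moreover have "\<kappa> * \<bar>w2\<bar> \<le> 1 * \<bar>w2\<bar>" using \<kappa> by (intro mult_right_mono) auto
    ultimately have up: "m \<le> u * N" unfolding m_def by simp
    have det: "A$1$1 * A$2$2 - A$1$2 * A$2$1 = 1" using A by (simp add: SL2_def det_2)
    have "a = a * (A$1$1 * A$2$2 - A$1$2 * A$2$1)" using det by simp
    also have "\<dots> = w1 * A$2$2 + (- w2) * A$2$1" by (simp add: w1_def w2_def algebra_simps)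
    finally have a: "\<bar>a\<bar> \<le> (\<bar>w1\<bar> + \<bar>w2\<bar>) * N" using lin[of w1 2 2 "- w2" 2 1] by simp
    have "b = b * (A$1$1 * A$2$2 - A$1$2 * A$2$1)" using det by simp
    also have "\<dots> = (- w1) * A$1$2 + w2 * A$1$1" by (simp add: w1_def w2_def algebra_simps)
    finally have b: "\<bar>b\<bar> \<le> (\<bar>w1\<bar> + \<bar>w2\<bar>) * N" using lin[of "- w1" 1 2 w2 1 1] by simp
    have "\<bar>w1\<bar> \<le> m / \<kappa>" "\<bar>w2\<bar> \<le> m / \<kappa>"
    proof -
      have "\<kappa> * \<bar>w1\<bar> \<le> 1 * \<bar>w1\<bar>" using \<kappa> by (intro mult_right_mono) auto
      then show "\<bar>w1\<bar> \<le> m / \<kappa>" using \<kappa> by (simp add: m_def field_simps)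
      show "\<bar>w2\<bar> \<le> m / \<kappa>" using \<kappa> by (simp add: m_def field_simps)
    qed
    then have "u \<le> 4 * (m / \<kappa>) * N"
      using a b N mult_right_mono[of "\<bar>w1\<bar> + \<bar>w2\<bar>" "2 * (m / \<kappa>)" N] by (simp add: u_def)
    then have lo: "v \<le> m * N" using \<kappa> by (simp add: v_def field_simps)
    have m0: "0 < m"
    proof (rule ccontr)
      assume "\<not> 0 < m"
      moreover have "0 \<le> m" by (simp add: m_def)
      ultimately have "m = 0" by simp
      then show False using lo v by simp
    qed
    have "ln m \<le> ln (u * N)" using up m0 by simp
    also have "\<dots> = ln u + ln N" using u N by (intro ln_mult_pos) auto
    finally have 1: "ln m \<le> ln u + ln N" .
    have "ln v \<le> ln (m * N)" using lo v by simp
    also have "\<dots> = ln m + ln N" using m0 N by (intro ln_mult_pos) auto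
    finally have 2: "ln v \<le> ln m + ln N" .
    have "row_size \<kappa> a b A = ln m" by (simp add: row_size_def log_size_def m_def w1_def w2_def)
    then show "\<bar>row_size \<kappa> a b A\<bar> \<le> ln (op_norm A) + (\<bar>ln u\<bar> + \<bar>ln v\<bar>)"
      using 1 2 by (simp add: N_def)
  qed simp
qed

context random_potential begin

lemma integrable_row_size:
  assumes "0 < \<kappa>" "\<kappa> \<le> 1" and "a \<noteq> 0 \<or> b \<noteq> 0"
  shows "integrable (walk E n) (row_size \<kappa> a b)"
proof -
  interpret W: prob_space "walk E n" by (rule prob_space_walk)
  obtain R where R: "0 \<le> R" "\<And>A. A \<in> SL2 \<Longrightarrow> \<bar>row_size \<kappa> a b A\<bar> \<le> ln (op_norm A) + R"
    using row_size_bound[OF assms] by blast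
  show ?thesis
  proof (rule Bochner_Integration.integrable_bound)
    show "integrable (walk E n) (\<lambda>A. ln (op_norm A) + R)" using integrable_ln_op_norm by simp
    show "row_size \<kappa> a b \<in> borel_measurable (walk E n)"
      by (subst measurable_cong_sets[OF sets_walk refl]) (rule measurable_row_size)
    show "AE A in walk E n. norm (row_size \<kappa> a b A) \<le> norm (ln (op_norm A) + R)"
      using R(2) by (intro AE_I2) (force simp: space_walk)
  qed
qed

text \<open>This is the case of one factor in the integrability of \<open>row_size\<close>, as \<open>walk E 0\<close> is
  concentrated at the identity.\<close>

lemma integrable_log_size_step:
  assumes "0 < \<kappa>" "\<kappa> \<le> 1" and "a \<noteq> 0 \<or> b \<noteq> 0"
  shows "integrable \<nu> (\<lambda>x. log_size \<kappa> (a * (x - E) + b) (- a))"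
proof -
  have "integrable \<nu> (\<lambda>x. \<integral>B. row_size \<kappa> a b (S_mat (x - E) ** B) \<partial>walk E 0)"
    by (rule integral_walk_Suc(1)[OF measurable_row_size integrable_row_size[OF assms]])
  also have "(\<lambda>x. \<integral>B. row_size \<kappa> a b (S_mat (x - E) ** B) \<partial>walk E 0) = (\<lambda>x. log_size \<kappa> (a * (x - E) + b) (- a))"
    unfolding row_size_S_mat
    by (subst conv_power.simps, subst integral_return)
       (auto simp: space_SL2_borel SL2_1 measurable_row_size row_size_1)
  finally show ?thesis .
qed

text \<open>A row \<open>(a, b)\<close> is mapped to \<open>(a (x - E) + b, - a)\<close>. If the first coordinate dominates, the gain is a
  value of the logarithmic potential at a point, hence at least \<open>c\<close>. Otherwise the second
  coordinate moves to the first place, where it is no longer weighted by \<open>\<kappa>\<close>; the gain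
  \<open>ln (1 / \<kappa>)\<close> outweighs the loss \<open>C + ln 2\<close>.\<close>

lemma log_size_step:
  assumes c0: "\<And>\<kappa> a. 0 < \<kappa> \<Longrightarrow> c \<le> (\<integral>x. ln (max \<bar>x - a\<bar> \<kappa>) \<partial>\<nu>)"
    and C: "\<And>\<kappa> a. 0 < \<kappa> \<Longrightarrow> a \<noteq> 0 \<Longrightarrow> ln \<bar>a\<bar> - C \<le> (\<integral>x. ln (max \<bar>x - a\<bar> \<kappa>) \<partial>\<nu>)"
    and c: "0 < c" "0 \<le> C"
    and \<kappa>: "0 < \<kappa>" "2 * \<kappa> * \<bar>E\<bar> \<le> 1" "\<kappa> \<le> exp (- (C + c + 1))"
    and ab: "a \<noteq> 0 \<or> b \<noteq> 0"
  shows "log_size \<kappa> a b + c \<le> (\<integral>x. log_size \<kappa> (a * (x - E) + b) (- a) \<partial>\<nu>)"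
proof -
  have \<kappa>1: "\<kappa> \<le> 1" using \<kappa>(3) c by (smt (verit) exp_le_one_iff)
  have ln\<kappa>: "ln \<kappa> \<le> - (C + c + 1)" using \<kappa> by (metis ln_exp ln_mono)
  show ?thesis
  proof (cases "a = 0")
    case True
    then have "b \<noteq> 0" using ab by simp
    have "ln (\<kappa> * \<bar>b\<bar>) = ln \<kappa> + ln \<bar>b\<bar>" using \<kappa> \<open>b \<noteq> 0\<close> by (intro ln_mult_pos) auto
    moreover have "max 0 (\<kappa> * \<bar>b\<bar>) = \<kappa> * \<bar>b\<bar>" using \<kappa> by simp
    ultimately show ?thesis using True ln\<kappa> c by (simp add: log_size_def prob_space)
  next
    case False
    define e where "e = E - b / a"
    have eq: "log_size \<kappa> (a * (x - E) + b) (- a) = ln \<bar>a\<bar> + ln (max \<bar>x - e\<bar> \<kappa>)" for x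
    proof -
      have "a * (x - E) + b = a * (x - e)" using False by (simp add: e_def field_simps)
      then have "max \<bar>a * (x - E) + b\<bar> (\<kappa> * \<bar>- a\<bar>) = \<bar>a\<bar> * max \<bar>x - e\<bar> \<kappa>"
        by (simp add: abs_mult max_mult_distrib_left mult.commute)
      then show ?thesis unfolding log_size_def using False \<kappa> by (simp add: ln_mult_pos)
    qed
    have int: "integrable \<nu> (\<lambda>x. ln \<bar>a\<bar> + ln (max \<bar>x - e\<bar> \<kappa>))"
      using integrable_log_size_step[OF \<kappa>(1) \<kappa>1 ab, of E] unfolding eq .
    then have int': "integrable \<nu> (\<lambda>x. ln (max \<bar>x - e\<bar> \<kappa>))"
      using Bochner_Integration.integrable_diff[OF int, of "\<lambda>_. ln \<bar>a\<bar>"] by simp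
    have I: "(\<integral>x. log_size \<kappa> (a * (x - E) + b) (- a) \<partial>\<nu>) = ln \<bar>a\<bar> + (\<integral>x. ln (max \<bar>x - e\<bar> \<kappa>) \<partial>\<nu>)"
      unfolding eq using int' by (simp add: prob_space)
    show ?thesis
    proof (cases "\<kappa> * \<bar>b\<bar> \<le> \<bar>a\<bar>")
      case True
      then show ?thesis unfolding I using c0[OF \<kappa>(1), of e] by (simp add: log_size_def max_absorb1)
    next
      case False2: False
      then have "b \<noteq> 0" using \<kappa> by auto
      have "\<bar>b\<bar> / \<bar>a\<bar> > 1 / \<kappa>" using False2 False \<kappa> by (simp add: field_simps)
      moreover have "1 / \<kappa> \<ge> 2 * \<bar>E\<bar>" using \<kappa> by (simp add: field_simps)
      ultimately have "\<bar>b / a\<bar> / 2 \<ge> \<bar>E\<bar>" by (simp add: abs_divide)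
      then have ee: "\<bar>e\<bar> \<ge> \<bar>b / a\<bar> / 2"
        unfolding e_def using abs_triangle_ineq2[of "b / a" E] abs_minus_commute[of "b / a" E] by argo
      moreover have p: "0 < \<bar>b / a\<bar> / 2" using \<open>b \<noteq> 0\<close> False by simp
      ultimately have "e \<noteq> 0" by auto
      have "ln (\<bar>b / a\<bar> / 2) \<le> ln \<bar>e\<bar>" using ee p by (intro ln_mono) auto
      moreover have "ln (\<bar>b / a\<bar> / 2) = ln \<bar>b\<bar> - ln \<bar>a\<bar> - ln 2"
        using \<open>b \<noteq> 0\<close> False by (simp add: abs_divide ln_div ln_mult_pos)
      ultimately have "ln \<bar>b\<bar> - ln 2 - C \<le> ln \<bar>a\<bar> + (\<integral>x. ln (max \<bar>x - e\<bar> \<kappa>) \<partial>\<nu>)"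
        using C[OF \<kappa>(1) \<open>e \<noteq> 0\<close>] by linarith
      moreover have "log_size \<kappa> a b = ln \<kappa> + ln \<bar>b\<bar>"
        using False2 \<kappa> \<open>b \<noteq> 0\<close> by (simp add: log_size_def max_absorb2 ln_mult_pos)
      moreover have "ln 2 \<le> (1::real)" using ln_2_less_1 by simp
      ultimately show ?thesis unfolding I using ln\<kappa> by linarith
    qed
  qed
qed

text \<open>The gain of a single step is iterated along the product, with the factor farthest to the left peeled
  off first.\<close>

lemma lyapunov1_positive:
  assumes c0: "\<And>\<kappa> a. 0 < \<kappa> \<Longrightarrow> c \<le> (\<integral>x. ln (max \<bar>x - a\<bar> \<kappa>) \<partial>\<nu>)"
    and C: "\<And>\<kappa> a. 0 < \<kappa> \<Longrightarrow> a \<noteq> 0 \<Longrightarrow> ln \<bar>a\<bar> - C \<le> (\<integral>x. ln (max \<bar>x - a\<bar> \<kappa>) \<partial>\<nu>)"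
    and c: "0 < c" "0 \<le> C"
  shows "c \<le> lyapunov1 (mu_E \<nu> E)"
proof -
  define \<kappa> where "\<kappa> = min (1 / (2 * \<bar>E\<bar> + 1)) (exp (- (C + c + 1)))"
  have k0: "0 < \<kappa>" by (simp add: \<kappa>_def)
  have "\<kappa> \<le> 1 / (2 * \<bar>E\<bar> + 1)" by (simp add: \<kappa>_def)
  then have k1: "2 * \<kappa> * \<bar>E\<bar> \<le> 1" using k0 by (simp add: field_simps)
  have k2: "\<kappa> \<le> exp (- (C + c + 1))" by (simp add: \<kappa>_def)
  have k3: "\<kappa> \<le> 1" using k2 c by (smt (verit) exp_le_one_iff)
  have grow: "log_size \<kappa> a b + real n * c \<le> (\<integral>A. row_size \<kappa> a b A \<partial>walk E n)" if "a \<noteq> 0 \<or> b \<noteq> 0" for n a b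
    using that
  proof (induction n arbitrary: a b)
    case 0
    then show ?case
      by (subst conv_power.simps, subst integral_return)
         (auto simp: space_SL2_borel SL2_1 measurable_row_size row_size_1)
  next
    case (Suc n)
    note W = integral_walk_Suc[OF measurable_row_size integrable_row_size[OF k0 k3 Suc.prems], of E n]
    have i1: "integrable \<nu> (\<lambda>x. log_size \<kappa> (a * (x - E) + b) (- a))"
      by (rule integrable_log_size_step[OF k0 k3 Suc.prems])
    have "log_size \<kappa> a b + real (Suc n) * c \<le> (\<integral>x. log_size \<kappa> (a * (x - E) + b) (- a) \<partial>\<nu>) + real n * c"
      using log_size_step[OF c0 C c k0 k1 k2 Suc.prems] by (simp add: algebra_simps)
    also have "\<dots> = (\<integral>x. log_size \<kappa> (a * (x - E) + b) (- a) + real n * c \<partial>\<nu>)"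
      using i1 by (simp add: prob_space)
    also have "\<dots> \<le> (\<integral>x. (\<integral>B. row_size \<kappa> a b (S_mat (x - E) ** B) \<partial>walk E n) \<partial>\<nu>)"
    proof (rule integral_mono)
      show "integrable \<nu> (\<lambda>x. log_size \<kappa> (a * (x - E) + b) (- a) + real n * c)" using i1 by simp
      show "integrable \<nu> (\<lambda>x. \<integral>B. row_size \<kappa> a b (S_mat (x - E) ** B) \<partial>walk E n)" by (rule W)
      fix x
      show "log_size \<kappa> (a * (x - E) + b) (- a) + real n * c \<le> (\<integral>B. row_size \<kappa> a b (S_mat (x - E) ** B) \<partial>walk E n)"
        unfolding row_size_S_mat by (rule Suc.IH) (use Suc.prems in auto)
    qed
    also have "\<dots> = (\<integral>A. row_size \<kappa> a b A \<partial>walk E (Suc n))" by (rule W(2)[symmetric])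
    finally show ?case .
  qed
  obtain R where R: "0 \<le> R" "\<And>A. A \<in> SL2 \<Longrightarrow> \<bar>row_size \<kappa> 1 0 A\<bar> \<le> ln (op_norm A) + R"
    using row_size_bound[OF k0 k3, of 1 0] by auto
  have "real n * c \<le> mean_log E n + R" for n
  proof -
    interpret W: prob_space "walk E n" by (rule prob_space_walk)
    have "real n * c \<le> (\<integral>A. row_size \<kappa> 1 0 A \<partial>walk E n)"
      using grow[of 1 0 n] by (simp add: log_size_def)
    also have "\<dots> \<le> (\<integral>A. ln (op_norm A) + R \<partial>walk E n)"
    proof (rule integral_mono)
      fix A assume "A \<in> space (walk E n)"
      then show "row_size \<kappa> 1 0 A \<le> ln (op_norm A) + R" using R(2)[of A] by (simp add: space_walk)
    qed (use integrable_row_size[OF k0 k3, of 1 0] integrable_ln_op_norm in auto)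
    also have "\<dots> = mean_log E n + R" using integrable_ln_op_norm by (simp add: mean_log_def W.prob_space)
    finally show ?thesis .
  qed
  then have ge: "c \<le> mean_log E n / real n + R / real n" if "n \<ge> 1" for n
    using that by (simp add: field_simps)
  have "(\<lambda>n. mean_log E n / real n + R / real n) \<longlonglongrightarrow> lyapunov1 (mu_E \<nu> E) + 0"
    by (intro tendsto_add mean_log_tendsto lim_const_over_n)
  then show ?thesis by (intro LIMSEQ_le_const) (use ge in auto)
qed

end

section \<open>A single-site law with heavy tails at zero and at infinity\<close>

text \<open>Even levels produce the tail at infinity, odd levels the concentration at 0. The constant 40
  makes the mean of \<open>ln (level_scale k)\<close> large enough for a positive logarithmic potential.\<close>

definition level_scale :: "nat \<Rightarrow> real" where
  "level_scale k = exp (40 + (if even k then (real k)\<^sup>2 else - (real k)\<^sup>2))"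

abbreviation level_law :: "nat pmf" where "level_law \<equiv> geometric_pmf (1/2)"

abbreviation uniform_law :: "real measure" where "uniform_law \<equiv> uniform_measure lborel {-1..1}"

text \<open>The uniform factor removes all atoms, which keeps the logarithmic potential bounded below.\<close>

definition potential_law :: "real measure" where
  "potential_law = distr (measure_pmf level_law \<Otimes>\<^sub>M uniform_law) borel (\<lambda>(k, u). level_scale k * u)"

lemma level_scale_pos: "0 < level_scale k" by (simp add: level_scale_def)

lemma ln_level_scale: "ln (level_scale k) = 40 + (if even k then (real k)\<^sup>2 else - (real k)\<^sup>2)"
  by (simp add: level_scale_def)

lemma level_scale_le: "level_scale k \<le> exp (40 + (real k)\<^sup>2)"
  unfolding level_scale_def by (rule exp_mono) (simp add: order_trans[of _ 0])

lemma prob_space_uniform_law: "prob_space uniform_law"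
  by (intro prob_space_uniform_measure) auto

lemma uniform_law_density: "uniform_law = density lborel (\<lambda>u. ennreal (indicator {-1..1} u / 2))"
  unfolding uniform_measure_def
  by (rule arg_cong[where f = "density lborel"])
    (auto simp: fun_eq_iff indicator_def divide_ennreal[symmetric] ennreal_1[symmetric] simp del: ennreal_1)

lemma pair_prob_space_levels: "pair_prob_space (measure_pmf level_law) uniform_law"
  by (intro pair_prob_space.intro pair_sigma_finite.intro prob_space_imp_sigma_finite
      prob_space_measure_pmf prob_space_uniform_law)

lemma measurable_level_scale_mult [measurable]:
  "(\<lambda>(k, u). level_scale k * u) \<in> borel_measurable (measure_pmf level_law \<Otimes>\<^sub>M uniform_law)"
  by measurable

lemma prob_space_potential_law: "prob_space potential_law"
proof -
  interpret pair_prob_space "measure_pmf level_law" uniform_law by (rule pair_prob_space_levels)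
  show ?thesis unfolding potential_law_def by (rule prob_space_distr) (rule measurable_level_scale_mult)
qed

lemma sets_potential_law: "sets potential_law = sets borel" by (simp add: potential_law_def)

lemma nn_integral_potential_law:
  assumes [measurable]: "f \<in> borel_measurable borel"
  shows "(\<integral>\<^sup>+x. f x \<partial>potential_law) = (\<integral>\<^sup>+k. (\<integral>\<^sup>+u. f (level_scale k * u) \<partial>uniform_law) \<partial>level_law)"
proof -
  interpret P: pair_prob_space "measure_pmf level_law" uniform_law by (rule pair_prob_space_levels)
  have "(\<integral>\<^sup>+x. f x \<partial>potential_law) = (\<integral>\<^sup>+p. f (case p of (k, u) \<Rightarrow> level_scale k * u) \<partial>(measure_pmf level_law \<Otimes>\<^sub>M uniform_law))"
    unfolding potential_law_def by (rule nn_integral_distr) measurable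
  also have "\<dots> = (\<integral>\<^sup>+k. (\<integral>\<^sup>+u. f (level_scale k * u) \<partial>uniform_law) \<partial>level_law)"
    by (subst P.M2.nn_integral_fst[symmetric]) auto
  finally show ?thesis .
qed

lemma nn_integral_potential_law_le:
  assumes [measurable]: "f \<in> borel_measurable borel"
    and le: "\<And>k x. \<bar>x\<bar> \<le> level_scale k \<Longrightarrow> f x \<le> F k"
  shows "(\<integral>\<^sup>+x. f x \<partial>potential_law) \<le> (\<integral>\<^sup>+k. F k \<partial>level_law)"
proof -
  interpret U: prob_space uniform_law by (rule prob_space_uniform_law)
  have "(\<integral>\<^sup>+u. f (level_scale k * u) \<partial>uniform_law) \<le> F k" for k
  proof -
    have "AE u in uniform_law. u \<in> {-1..1}" by (rule AE_uniform_measureI) auto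
    then have "AE u in uniform_law. f (level_scale k * u) \<le> F k"
    proof (rule AE_mp, intro AE_I2 impI)
      fix u :: real assume "u \<in> {-1..1}"
      then have "\<bar>u\<bar> \<le> 1" by auto
      then have "\<bar>level_scale k * u\<bar> \<le> level_scale k" using level_scale_pos[of k] by (simp add: abs_mult mult_left_le)
      then show "f (level_scale k * u) \<le> F k" by (rule le)
    qed
    then have "(\<integral>\<^sup>+u. f (level_scale k * u) \<partial>uniform_law) \<le> (\<integral>\<^sup>+u. F k \<partial>uniform_law)" by (rule nn_integral_mono_AE)
    then show ?thesis using U.emeasure_space_1 by simp
  qed
  then show ?thesis unfolding nn_integral_potential_law[OF assms(1)] by (intro nn_integral_mono)
qed

lemma emeasure_uniform_law:
  assumes "-1 \<le> c" "c \<le> d" "d \<le> 1"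
  shows "emeasure uniform_law {c..d} = ennreal ((d - c) / 2)"
proof -
  have "{-1..1} \<inter> {c..d} = {c..d}" using assms by auto
  then have "emeasure uniform_law {c..d} = emeasure lborel {c..d} / emeasure lborel {-1..1::real}"
    by (subst emeasure_uniform_measure) auto
  also have "\<dots> = ennreal ((d - c) / 2)" using assms divide_ennreal[of "d - c" 2] by simp
  finally show ?thesis .
qed

lemma nn_integral_potential_law_ge:
  assumes fm: "f \<in> borel_measurable borel"
    and cd: "-1 \<le> c" "c \<le> d" "d \<le> 1"
    and ge: "\<And>x. level_scale k * c \<le> x \<Longrightarrow> x \<le> level_scale k * d \<Longrightarrow> L \<le> f x"
  shows "ennreal ((1/2) ^ Suc k * ((d - c) / 2)) * L \<le> (\<integral>\<^sup>+x. f x \<partial>potential_law)"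
proof -
  note [measurable] = fm
  have "ennreal ((d - c) / 2) * L = (\<integral>\<^sup>+u. L * indicator {c..d} u \<partial>uniform_law)"
    using emeasure_uniform_law[OF cd] by (subst nn_integral_cmult_indicator) (auto simp: mult.commute)
  also have "\<dots> \<le> (\<integral>\<^sup>+u. f (level_scale k * u) \<partial>uniform_law)"
  proof (rule nn_integral_mono)
    fix u show "L * indicator {c..d} u \<le> f (level_scale k * u)"
    proof (cases "u \<in> {c..d}")
      case True
      then have "L \<le> f (level_scale k * u)" using level_scale_pos[of k] by (intro ge mult_left_mono) auto
      then show ?thesis using True by simp
    qed simp
  qed
  finally have "ennreal (pmf level_law k) * (ennreal ((d - c) / 2) * L) \<le> ennreal (pmf level_law k) * (\<integral>\<^sup>+u. f (level_scale k * u) \<partial>uniform_law)"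
    by (rule mult_left_mono) simp
  also have "\<dots> \<le> (\<integral>\<^sup>+k. ennreal (pmf level_law k) * (\<integral>\<^sup>+u. f (level_scale k * u) \<partial>uniform_law) \<partial>count_space UNIV)"
    by (rule nn_integral_ge_point) simp
  also have "\<dots> = (\<integral>\<^sup>+x. f x \<partial>potential_law)"
    unfolding nn_integral_potential_law[OF fm] by (rule nn_integral_measure_pmf[symmetric])
  also have "ennreal (pmf level_law k) * (ennreal ((d - c) / 2) * L) = ennreal ((1/2) ^ Suc k * ((d - c) / 2)) * L"
    using cd by (subst ennreal_mult) (auto simp: mult.assoc)
  finally show ?thesis .
qed

lemma measure_potential_law_ge:
  assumes A: "A \<in> sets borel"
    and cd: "-1 \<le> c" "c \<le> d" "d \<le> 1"
    and sub: "\<And>x. level_scale k * c \<le> x \<Longrightarrow> x \<le> level_scale k * d \<Longrightarrow> x \<in> A"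
  shows "(1/2) ^ Suc k * ((d - c) / 2) \<le> measure potential_law A"
proof -
  interpret prob_space potential_law by (rule prob_space_potential_law)
  have "ennreal ((1/2) ^ Suc k * ((d - c) / 2)) * 1 \<le> (\<integral>\<^sup>+x. indicator A x \<partial>potential_law)"
    by (rule nn_integral_potential_law_ge[OF _ cd]) (use A sub in auto)
  also have "\<dots> = emeasure potential_law A" using A by (intro nn_integral_indicator) (simp add: sets_potential_law)
  finally show ?thesis unfolding emeasure_eq_measure by (simp add: ennreal_le_iff)
qed

text \<open>The base \<open>7/4\<close> lies between \<open>exp (1/2)\<close> and \<open>2\<close>, so that this geometric weight dominates
  \<open>exp (k / 2)\<close> and is still integrable.\<close>

lemma level_growth: "(\<integral>\<^sup>+k. ennreal ((7/4) ^ k) \<partial>level_law) = ennreal 4"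
proof -
  have "(\<integral>\<^sup>+k. ennreal ((7/4) ^ k) \<partial>level_law) = (\<integral>\<^sup>+k. ennreal (1/2 * (7/8) ^ k) \<partial>count_space UNIV)"
    unfolding nn_integral_measure_pmf
    by (rule nn_integral_cong) (simp add: ennreal_mult[symmetric] power_mult_distrib[symmetric] mult.commute)
  also have "\<dots> = (\<Sum>k. ennreal (1/2 * (7/8) ^ k))" by (rule nn_integral_count_space_nat)
  also have "\<dots> = ennreal 4"
  proof (rule suminf_ennreal_eq)
    have "(\<lambda>k. 1/2 * (7/8::real) ^ k) sums (1/2 * (1 / (1 - 7/8)))"
      by (intro sums_mult geometric_sums) simp
    then show "(\<lambda>k. 1/2 * (7/8::real) ^ k) sums 4" by simp
  qed simp
  finally show ?thesis .
qed

lemma level_growth_integral: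
  "integrable level_law (\<lambda>k. (7/4::real) ^ k)" "(\<integral>k. (7/4::real) ^ k \<partial>level_law) = 4"
proof -
  show "integrable level_law (\<lambda>k. (7/4::real) ^ k)"
    by (rule integrableI_nonneg) (auto simp: level_growth)
  then have "ennreal (\<integral>k. (7/4::real) ^ k \<partial>level_law) = ennreal 4"
    using nn_integral_eq_integral[of level_law "\<lambda>k. (7/4::real) ^ k"] level_growth by simp
  then show "(\<integral>k. (7/4::real) ^ k \<partial>level_law) = 4"
    by (subst (asm) ennreal_inj) auto
qed

lemma exp_half_level: "exp (real k / 2) \<le> (7/4) ^ k"
proof -
  have "exp (1/2) ^ 2 = exp (1::real)" by (simp add: exp_of_nat_mult[symmetric])
  also have "\<dots> \<le> 3" by (rule exp_le)
  also have "\<dots> \<le> (7/4)^2" by (simp add: power2_eq_square)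
  finally have "exp (1/2) \<le> (7/4::real)" by (rule power2_le_imp_le) simp
  then have "exp (1/2) ^ k \<le> (7/4::real) ^ k" by (intro power_mono) auto
  then show ?thesis by (simp add: exp_of_nat_mult[symmetric])
qed

lemma square_le_level: "(real k)\<^sup>2 \<le> 8 * (7/4) ^ k"
proof -
  have "(real k / 2)\<^sup>2 / 2 \<le> exp (real k / 2)"
    using exp_lower_Taylor_quadratic[of "real k / 2"] by simp
  then show ?thesis using exp_half_level[of k] by (simp add: power2_eq_square)
qed

lemma integrable_level_square: "integrable level_law (\<lambda>k. (real k)\<^sup>2)"
  by (rule Bochner_Integration.integrable_bound[OF integrable_mult_right[OF level_growth_integral(1), of 8]])
     (use square_le_level in \<open>auto\<close>)

lemma level_square_le: "(\<integral>k. (real k)\<^sup>2 \<partial>level_law) \<le> 32"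
proof -
  have "(\<integral>k. (real k)\<^sup>2 \<partial>level_law) \<le> (\<integral>k. 8 * (7/4) ^ k \<partial>level_law)"
    by (intro integral_mono integrable_level_square integrable_mult_right level_growth_integral(1) square_le_level)
  then show ?thesis using level_growth_integral by simp
qed

lemma ln_one_plus_scale:
  assumes "\<bar>x\<bar> \<le> level_scale k"
  shows "ln (1 + \<bar>x\<bar>) \<le> 41 + (real k)\<^sup>2"
proof -
  have "1 \<le> exp (40 + (real k)\<^sup>2)" by simp
  then have "1 + \<bar>x\<bar> \<le> 2 * exp (40 + (real k)\<^sup>2)" using assms level_scale_le[of k] by linarith
  then have "ln (1 + \<bar>x\<bar>) \<le> ln (2 * exp (40 + (real k)\<^sup>2))" by (intro ln_mono) auto
  also have "\<dots> = ln 2 + (40 + (real k)\<^sup>2)" by (subst ln_mult_pos) auto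
  finally show ?thesis using ln_2_less_1 by linarith
qed

lemma ln_moment_potential_law: "integrable potential_law (\<lambda>x. ln (1 + \<bar>x\<bar>))"
proof (rule integrableI_nonneg)
  show "(\<lambda>x. ln (1 + \<bar>x\<bar>)) \<in> borel_measurable potential_law" by (simp add: measurable_cong_sets[OF sets_potential_law refl])
  have "(\<integral>\<^sup>+x. ennreal (ln (1 + \<bar>x\<bar>)) \<partial>potential_law) \<le> (\<integral>\<^sup>+k. ennreal (41 + (real k)\<^sup>2) \<partial>level_law)"
    by (rule nn_integral_potential_law_le, measurable) (rule ennreal_leI, rule ln_one_plus_scale)
  also have "\<dots> = ennreal (\<integral>k. 41 + (real k)\<^sup>2 \<partial>level_law)"
    using integrable_level_square by (intro nn_integral_eq_integral) auto
  also have "\<dots> < \<infinity>" by simp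
  finally show "(\<integral>\<^sup>+x. ennreal (ln (1 + \<bar>x\<bar>)) \<partial>potential_law) < \<infinity>" .
qed auto

lemma potential_law_is_random_potential: "random_potential potential_law"
  by (intro random_potential.intro random_potential_axioms.intro prob_space_potential_law sets_potential_law ln_moment_potential_law)

interpretation pot: random_potential potential_law by (rule potential_law_is_random_potential)

text \<open>At level \<open>k\<close> the logarithm of the norm is at most \<open>C + k\<^sup>2\<close>, whose cube root is at most \<open>C + k / 2\<close>.\<close>

lemma subexponential_moment_finite:
  assumes m: "0 < m"
  shows "(SUP E\<in>{E. \<bar>E\<bar> \<le> m}. \<integral>\<^sup>+ A. ennreal (exp ((ln (op_norm A)) powr (1/3))) \<partial>mu_E potential_law E) < \<infinity>"
proof -
  define C where "C = 41 + ln (2 + m)"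
  have C: "C \<ge> 41" using m by (simp add: C_def)
  have "(\<integral>\<^sup>+ A. ennreal (exp ((ln (op_norm A)) powr (1/3))) \<partial>mu_E potential_law E) \<le> ennreal (exp C * 4)" if E: "\<bar>E\<bar> \<le> m" for E
  proof -
    have meas: "(\<lambda>A. ennreal (exp ((ln (op_norm A)) powr (1/3)))) \<in> borel_measurable SL2_borel" by measurable
    have "(\<integral>\<^sup>+ A. ennreal (exp ((ln (op_norm A)) powr (1/3))) \<partial>mu_E potential_law E) =
      (\<integral>\<^sup>+ x. ennreal (exp ((ln (op_norm (S_mat (x - E)))) powr (1/3))) \<partial>potential_law)"
      by (rule pot.nn_integral_mu[OF meas])
    also have "\<dots> \<le> (\<integral>\<^sup>+ k. ennreal (exp C * (7/4) ^ k) \<partial>level_law)"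
    proof (rule nn_integral_potential_law_le)
      have "(\<lambda>x. S_mat (x - E)) \<in> borel \<rightarrow>\<^sub>M SL2_borel" by measurable
      from measurable_compose[OF this meas] show "(\<lambda>x. ennreal (exp ((ln (op_norm (S_mat (x - E)))) powr (1/3)))) \<in> borel_measurable borel" .
    next
      fix k x assume x: "\<bar>x\<bar> \<le> level_scale k"
      define t where "t = ln (op_norm (S_mat (x - E)))"
      have t0: "0 \<le> t" unfolding t_def by (intro ln_ge_zero op_norm_ge_1 S_mat_in_SL2)
      have "ln (2 + \<bar>E\<bar>) \<le> ln (2 + m)" using E by (intro ln_mono) auto
      then have "t \<le> C + (real k)\<^sup>2"
        using pot.ln_op_norm_S_mat[of x E] ln_one_plus_scale[OF x] by (simp add: t_def C_def)
      also have "\<dots> \<le> (C + real k / 2) ^ 3"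
      proof -
        have "(C + real k / 2) ^ 3 = C ^ 3 + 3 / 2 * C\<^sup>2 * real k + 3 / 4 * C * (real k)\<^sup>2 + (real k) ^ 3 / 8"
          by (simp add: power2_eq_square power3_eq_cube field_simps)
        moreover have "C \<le> C ^ 3" using C self_le_power[of C 3] by simp
        moreover have "(real k)\<^sup>2 \<le> 3 / 4 * C * (real k)\<^sup>2" using C mult_right_mono[of 1 "3 / 4 * C" "(real k)\<^sup>2"] by simp
        moreover have "0 \<le> 3 / 2 * C\<^sup>2 * real k" "0 \<le> (real k) ^ 3 / 8" by auto
        ultimately show ?thesis by linarith
      qed
      finally have "t powr (1/3) \<le> ((C + real k / 2) ^ 3) powr (1/3)" using t0 by (intro powr_mono2) auto
      also have "\<dots> = C + real k / 2"
      proof -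
        have p: "0 < C + real k / 2" using C by (intro add_pos_nonneg) auto
        then have "(C + real k / 2) ^ 3 = (C + real k / 2) powr 3" by simp
        then show ?thesis using p by (simp only: powr_powr) simp
      qed
      finally have "exp (t powr (1/3)) \<le> exp C * exp (real k / 2)" by (simp add: exp_add[symmetric])
      also have "\<dots> \<le> exp C * (7/4) ^ k" by (intro mult_left_mono exp_half_level) auto
      finally show "ennreal (exp ((ln (op_norm (S_mat (x - E)))) powr (1/3))) \<le> ennreal (exp C * (7/4) ^ k)"
        by (simp add: t_def ennreal_leI)
    qed
    also have "\<dots> = ennreal (exp C) * ennreal 4"
      by (simp add: ennreal_mult nn_integral_cmult level_growth)
    also have "\<dots> = ennreal (exp C * 4)" by (subst ennreal_mult[symmetric]) auto
    finally show ?thesis .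
  qed
  then have "(SUP E\<in>{E. \<bar>E\<bar> \<le> m}. \<integral>\<^sup>+ A. ennreal (exp ((ln (op_norm A)) powr (1/3))) \<partial>mu_E potential_law E) \<le> ennreal (exp C * 4)"
    by (intro SUP_least) auto
  also have "\<dots> < \<infinity>" by simp
  finally show ?thesis .
qed

lemma exp_le_scale_quarter: "even k \<Longrightarrow> exp ((real k)\<^sup>2) \<le> level_scale k / 4"
proof -
  assume "even k"
  then have "level_scale k = exp 40 * exp ((real k)\<^sup>2)" by (simp add: level_scale_def exp_add)
  moreover have "(4::real) \<le> exp 40" using exp_ge_add_one_self[of 40] by simp
  ultimately show ?thesis using mult_right_mono[of 4 "exp 40" "exp ((real k)\<^sup>2)"] by simp
qed

text \<open>An even level \<open>k\<close> contributes about \<open>2\<^sup>-\<^sup>k exp (\<alpha> k\<^sup>2)\<close>, which is unbounded.\<close>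

lemma power_moment_infinite:
  assumes \<alpha>: "0 < \<alpha>"
  shows "(\<integral>\<^sup>+ A. ennreal (op_norm A powr \<alpha>) \<partial>mu_E potential_law E) = \<infinity>"
proof (rule ccontr)
  define I where "I = (\<integral>\<^sup>+ A. ennreal (op_norm A powr \<alpha>) \<partial>mu_E potential_law E)"
  assume "\<not> ?thesis"
  then obtain r where r: "0 \<le> r" "I = ennreal r" by (cases I) (auto simp: I_def)
  obtain j :: nat where j: "real j > 16 * r + 2 / \<alpha> + 4 * \<bar>E\<bar> + 1" using reals_Archimedean2 by blast
  define k where "k = 2 * j"
  have k: "even k" "real k \<ge> real j" by (auto simp: k_def)
  have r2: "0 \<le> 2 / \<alpha>" using \<alpha> by simp
  have kr: "real k > 16 * r" "real k > 2 / \<alpha>" "real k > 4 * \<bar>E\<bar>" "real k \<ge> 1" using j k(2) r(1) r2 by linarith+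
  have meas: "(\<lambda>A. ennreal (op_norm A powr \<alpha>)) \<in> borel_measurable SL2_borel" by measurable
  have I: "I = (\<integral>\<^sup>+ x. ennreal (op_norm (S_mat (x - E)) powr \<alpha>) \<partial>potential_law)"
    unfolding I_def by (rule pot.nn_integral_mu[OF meas])
  have "ennreal ((1/2) ^ Suc k * ((1 - 1/2) / 2)) * ennreal (exp (\<alpha> * (real k)\<^sup>2)) \<le> I"
    unfolding I
  proof (rule nn_integral_potential_law_ge)
    have "(\<lambda>x. S_mat (x - E)) \<in> borel \<rightarrow>\<^sub>M SL2_borel" by measurable
    from measurable_compose[OF this meas] show "(\<lambda>x. ennreal (op_norm (S_mat (x - E)) powr \<alpha>)) \<in> borel_measurable borel" .
    fix x assume "level_scale k * (1/2) \<le> x" "x \<le> level_scale k * 1"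
    then have x: "level_scale k / 2 \<le> x" by simp
    have "\<bar>E\<bar> \<le> level_scale k / 4"
    proof -
      have "\<bar>E\<bar> \<le> real k" using kr by linarith
      also have "\<dots> \<le> (real k)\<^sup>2" using kr by (simp add: power2_eq_square)
      also have "\<dots> \<le> exp ((real k)\<^sup>2)" using exp_ge_add_one_self[of "(real k)\<^sup>2"] by linarith
      finally show ?thesis using exp_le_scale_quarter[OF k(1)] by linarith
    qed
    then have "level_scale k / 4 \<le> \<bar>x - E\<bar>" using x by linarith
    also have "\<dots> \<le> op_norm (S_mat (x - E))" using entry_le_op_norm[of "S_mat (x - E)" 1 1] by (simp add: S_mat_nth)
    finally have "exp ((real k)\<^sup>2) \<le> op_norm (S_mat (x - E))" using exp_le_scale_quarter[OF k(1)] by linarith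
    then have "exp ((real k)\<^sup>2) powr \<alpha> \<le> op_norm (S_mat (x - E)) powr \<alpha>" using \<alpha> by (intro powr_mono2) auto
    then show "ennreal (exp (\<alpha> * (real k)\<^sup>2)) \<le> ennreal (op_norm (S_mat (x - E)) powr \<alpha>)"
      by (intro ennreal_leI) (simp add: powr_def mult.commute)
  qed auto
  then have "ennreal ((1/2) ^ Suc k * ((1 - 1/2) / 2) * exp (\<alpha> * (real k)\<^sup>2)) \<le> ennreal r"
    unfolding r(2) by (subst ennreal_mult) auto
  then have "(1/2) ^ Suc k * ((1 - 1/2) / 2) * exp (\<alpha> * (real k)\<^sup>2) \<le> r"
    using r(1) by (simp only: ennreal_le_iff)
  moreover have "real k \<le> (1/2) ^ k * exp (\<alpha> * (real k)\<^sup>2)"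
  proof -
    have "2 \<le> \<alpha> * real k" using kr(2) \<alpha> by (simp add: field_simps)
    then have "2 * real k \<le> \<alpha> * real k * real k" by (intro mult_right_mono) auto
    then have "exp (real k) * exp (real k) \<le> exp (\<alpha> * (real k)\<^sup>2)"
      by (simp add: exp_add[symmetric] power2_eq_square mult.assoc)
    moreover have "2 ^ k \<le> exp (real k)"
    proof -
      have "2 ^ k \<le> exp (1::real) ^ k" using exp_ge_add_one_self[of 1] by (intro power_mono) auto
      then show ?thesis by (simp add: exp_of_nat_mult[symmetric])
    qed
    moreover have "real k \<le> exp (real k)" using exp_ge_add_one_self[of "real k"] by linarith
    ultimately have "2 ^ k * real k \<le> exp (\<alpha> * (real k)\<^sup>2)"
      using mult_mono[of "2 ^ k" "exp (real k)" "real k" "exp (real k)"] by simp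
    then show ?thesis by (simp add: field_simps power_divide)
  qed
  ultimately have "real k \<le> 8 * r" by simp
  then show False using kr r by linarith
qed

lemma ln_max_bound:
  fixes x a \<kappa> :: real
  assumes \<kappa>: "0 < \<kappa>"
  shows "\<bar>ln (max \<bar>x - a\<bar> \<kappa>)\<bar> \<le> ln (1 + \<bar>x\<bar>) + (\<bar>ln \<kappa>\<bar> + ln (1 + \<bar>a\<bar>) + ln (1 + \<kappa>))"
proof -
  have lo: "ln \<kappa> \<le> ln (max \<bar>x - a\<bar> \<kappa>)" using \<kappa> by (intro ln_mono) auto
  have "max \<bar>x - a\<bar> \<kappa> \<le> (1 + \<bar>x\<bar>) * (1 + \<bar>a\<bar>) * (1 + \<kappa>)"
  proof (rule max.boundedI)
    have "\<bar>x - a\<bar> \<le> (1 + \<bar>x\<bar>) * (1 + \<bar>a\<bar>)"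
      using mult_nonneg_nonneg[OF abs_ge_zero[of x] abs_ge_zero[of a]] abs_triangle_ineq4[of x a]
      unfolding distrib_right distrib_left by linarith
    also have "\<dots> \<le> (1 + \<bar>x\<bar>) * (1 + \<bar>a\<bar>) * (1 + \<kappa>)" using \<kappa> mult_left_mono[of 1 "1 + \<kappa>" "(1 + \<bar>x\<bar>) * (1 + \<bar>a\<bar>)"] by simp
    finally show "\<bar>x - a\<bar> \<le> (1 + \<bar>x\<bar>) * (1 + \<bar>a\<bar>) * (1 + \<kappa>)" .
    have "1 \<le> (1 + \<bar>x\<bar>) * (1 + \<bar>a\<bar>)" using mult_mono[of 1 "1 + \<bar>x\<bar>" 1 "1 + \<bar>a\<bar>"] by simp
    then have "1 * (1 + \<kappa>) \<le> (1 + \<bar>x\<bar>) * (1 + \<bar>a\<bar>) * (1 + \<kappa>)"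
      using \<kappa> by (intro mult_right_mono) auto
    then show "\<kappa> \<le> (1 + \<bar>x\<bar>) * (1 + \<bar>a\<bar>) * (1 + \<kappa>)" by (rule order_trans[rotated]) simp
  qed
  then have "ln (max \<bar>x - a\<bar> \<kappa>) \<le> ln ((1 + \<bar>x\<bar>) * (1 + \<bar>a\<bar>) * (1 + \<kappa>))" using \<kappa> by (intro ln_mono) auto
  also have "\<dots> = ln (1 + \<bar>x\<bar>) + ln (1 + \<bar>a\<bar>) + ln (1 + \<kappa>)"
    using \<kappa> by (simp add: ln_mult_pos add_pos_nonneg)
  finally have "ln (max \<bar>x - a\<bar> \<kappa>) \<le> ln (1 + \<bar>x\<bar>) + ln (1 + \<bar>a\<bar>) + ln (1 + \<kappa>)" .
  moreover have "0 \<le> ln (1 + \<bar>x\<bar>)" "0 \<le> ln (1 + \<bar>a\<bar>)" "0 \<le> ln (1 + \<kappa>)" using \<kappa> by auto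
  ultimately show ?thesis using lo by (intro abs_leI) linarith+
qed

text \<open>If \<open>\<bar>a\<bar> \<ge> 2 b\<close>, then \<open>b u\<close> stays away from \<open>a\<close>. Otherwise \<open>ln \<bar>b u - a\<bar> = ln b + ln \<bar>u - a / b\<bar>\<close>,
  and the negative part of the last logarithm is dominated by the integrable function
  \<open>2 \<bar>y\<bar>\<^sup>-\<^sup>1\<^sup>/\<^sup>2\<close> on \<open>[-1, 1]\<close>, uniformly in the position of the singularity.\<close>

lemma ln_potential_uniform:
  fixes a b \<kappa> :: real
  assumes b: "0 < b" and \<kappa>: "0 < \<kappa>"
  shows "integrable uniform_law (\<lambda>u. ln (max \<bar>b * u - a\<bar> \<kappa>))"
    and "ln (max b \<bar>a\<bar>) - 5 \<le> (\<integral>u. ln (max \<bar>b * u - a\<bar> \<kappa>) \<partial>uniform_law)"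
proof -
  interpret U: prob_space uniform_law by (rule prob_space_uniform_law)
  have AE1: "AE u in uniform_law. u \<in> {-1..1}" by (rule AE_uniform_measureI) auto
  show int: "integrable uniform_law (\<lambda>u. ln (max \<bar>b * u - a\<bar> \<kappa>))"
  proof (rule Bochner_Integration.integrable_bound)
    define R where "R = ln (1 + b) + (\<bar>ln \<kappa>\<bar> + ln (1 + \<bar>a\<bar>) + ln (1 + \<kappa>))"
    show "integrable uniform_law (\<lambda>_. R)" by simp
    show "AE u in uniform_law. norm (ln (max \<bar>b * u - a\<bar> \<kappa>)) \<le> norm R"
      using AE1
    proof (rule AE_mp, intro AE_I2 impI)
      fix u :: real assume "u \<in> {-1..1}"
      then have "\<bar>b * u\<bar> \<le> b" using b by (simp add: abs_mult mult_left_le abs_le_iff)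
      then have "ln (1 + \<bar>b * u\<bar>) \<le> ln (1 + b)" by (intro ln_mono) auto
      then have "\<bar>ln (max \<bar>b * u - a\<bar> \<kappa>)\<bar> \<le> R"
        using ln_max_bound[OF \<kappa>, of "b * u" a] unfolding R_def by linarith
      then show "norm (ln (max \<bar>b * u - a\<bar> \<kappa>)) \<le> norm R" by simp
    qed
  qed simp
  define d where "d y = 2 * (indicator {0..1} y * y powr (-1/2) + indicator {0..1} (- y) * (- y) powr (-1/2))" for y :: real
  have d0: "0 \<le> d y" for y by (simp add: d_def)
  have dm [measurable]: "d \<in> borel_measurable borel" unfolding d_def [abs_def] by measurable
  have id: "integrable lborel d" and Id: "(\<integral>y. d y \<partial>lborel) = 8"
  proof -
    note i = integrable_inverse_sqrt[of 1]
    have i1: "integrable lborel (\<lambda>y::real. indicator {0..1} y * y powr (-1/2))" using i by simp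
    have i2: "integrable lborel (\<lambda>y::real. indicator {0..1} (- y) * (- y) powr (-1/2))"
      using lborel_integrable_real_affine[OF i1, of "-1" 0] by simp
    have I1: "(\<integral>y. indicator {0..1} y * y powr (-1/2) \<partial>lborel) = (2::real)" using i by simp
    have I2: "(\<integral>y. indicator {0..1} (- y) * (- y) powr (-1/2) \<partial>lborel) = (2::real)"
      using lborel_integral_real_affine[of "-1" "\<lambda>y. indicator {0..1} y * y powr (-1/2)" 0] I1 by simp
    show "integrable lborel d" unfolding d_def [abs_def]
      by (intro integrable_mult_right Bochner_Integration.integrable_add i1 i2)
    have "(\<integral>y. d y \<partial>lborel) = 2 * ((\<integral>y. indicator {0..1} y * y powr (-1/2) \<partial>lborel) + (\<integral>y. indicator {0..1} (- y) * (- y) powr (-1/2) \<partial>lborel))"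
      unfolding d_def using i1 i2 by simp
    then show "(\<integral>y. d y \<partial>lborel) = 8" unfolding I1 I2 by simp
  qed
  define \<alpha> where "\<alpha> = a / b"
  have ids: "integrable lborel (\<lambda>u. d (u - \<alpha>))" and Ids: "(\<integral>u. d (u - \<alpha>) \<partial>lborel) = 8"
    using lborel_integrable_real_affine[OF id, of 1 "- \<alpha>"] lborel_integral_real_affine[of 1 d "- \<alpha>"] Id by auto
  have idr: "integrable lborel (\<lambda>u. indicator {-1..1} u / 2 * d (u - \<alpha>))"
    by (rule Bochner_Integration.integrable_bound[OF ids]) (auto simp: indicator_def d0 intro!: AE_I2)
  have iU: "integrable uniform_law (\<lambda>u. d (u - \<alpha>))"
    unfolding uniform_law_density using idr by (subst integrable_density) auto
  have "(\<integral>u. d (u - \<alpha>) \<partial>uniform_law) = (\<integral>u. indicator {-1..1} u / 2 * d (u - \<alpha>) \<partial>lborel)"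
    unfolding uniform_law_density by (subst integral_density) auto
  also have "\<dots> \<le> (\<integral>u. 1 / 2 * d (u - \<alpha>) \<partial>lborel)"
    using idr ids d0 by (intro integral_mono) (auto simp: indicator_def)
  also have "\<dots> = 4" using Ids by simp
  finally have IU: "(\<integral>u. d (u - \<alpha>) \<partial>uniform_law) \<le> 4" .
  have neq: "AE u in uniform_law. u \<noteq> \<alpha>"
    unfolding uniform_law_density by (subst AE_density) (auto intro: AE_mp[OF AE_lborel_singleton])
  have pt: "ln (max b \<bar>a\<bar>) - 1 - d (u - \<alpha>) \<le> ln (max \<bar>b * u - a\<bar> \<kappa>)" if u: "u \<in> {-1..1}" "u \<noteq> \<alpha>" for u
  proof (cases "2 * b \<le> \<bar>a\<bar>")
    case True
    have "\<bar>b * u\<bar> \<le> b" using u b by (simp add: abs_mult mult_left_le abs_le_iff)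
    then have "\<bar>a\<bar> / 2 \<le> \<bar>b * u - a\<bar>"
      using True abs_triangle_ineq2[of a "b * u"] abs_minus_commute[of a "b * u"] by linarith
    then have "\<bar>a\<bar> / 2 \<le> max \<bar>b * u - a\<bar> \<kappa>" by (simp add: le_max_iff_disj)
    then have "ln (\<bar>a\<bar> / 2) \<le> ln (max \<bar>b * u - a\<bar> \<kappa>)" using True b by (intro ln_mono) auto
    moreover have "ln (\<bar>a\<bar> / 2) = ln \<bar>a\<bar> - ln 2" using True b by (subst ln_div) auto
    moreover have "max b \<bar>a\<bar> = \<bar>a\<bar>" using True b by simp
    ultimately show ?thesis using d0[of "u - \<alpha>"] ln_2_less_1 by simp
  next
    case False
    have "b * u - a = b * (u - \<alpha>)" using b by (simp add: \<alpha>_def field_simps)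
    then have "b * \<bar>u - \<alpha>\<bar> \<le> max \<bar>b * u - a\<bar> \<kappa>" using b by (simp add: abs_mult)
    then have "ln (b * \<bar>u - \<alpha>\<bar>) \<le> ln (max \<bar>b * u - a\<bar> \<kappa>)" using u b by (intro ln_mono) auto
    moreover have "ln (b * \<bar>u - \<alpha>\<bar>) = ln b + ln \<bar>u - \<alpha>\<bar>" using u b by (intro ln_mult_pos) auto
    moreover have "- d (u - \<alpha>) \<le> ln \<bar>u - \<alpha>\<bar>"
    proof (cases "\<bar>u - \<alpha>\<bar> \<le> 1")
      case True
      have "- ln \<bar>u - \<alpha>\<bar> \<le> 2 * \<bar>u - \<alpha>\<bar> powr (-1/2)" using u by (intro neg_ln_le_inverse_sqrt) auto
      also have "\<dots> = d (u - \<alpha>)" using True u by (cases "u < \<alpha>") (auto simp: d_def indicator_def)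
      finally show ?thesis by simp
    next
      case False
      then have "0 \<le> ln \<bar>u - \<alpha>\<bar>" by (intro ln_ge_zero) auto
      then show ?thesis using d0[of "u - \<alpha>"] by linarith
    qed
    moreover have "ln (max b \<bar>a\<bar>) \<le> ln (2 * b)" using False b by (intro ln_mono) auto
    moreover have "ln (2 * b) = ln 2 + ln b" using b by (intro ln_mult_pos) auto
    ultimately show ?thesis using ln_2_less_1 by linarith
  qed
  have "ln (max b \<bar>a\<bar>) - 5 \<le> ln (max b \<bar>a\<bar>) - 1 - (\<integral>u. d (u - \<alpha>) \<partial>uniform_law)" using IU by simp
  also have "\<dots> = (\<integral>u. ln (max b \<bar>a\<bar>) - 1 - d (u - \<alpha>) \<partial>uniform_law)"
    using iU U.prob_space by simp
  also have "\<dots> \<le> (\<integral>u. ln (max \<bar>b * u - a\<bar> \<kappa>) \<partial>uniform_law)"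
  proof (rule integral_mono_AE)
    show "AE u in uniform_law. ln (max b \<bar>a\<bar>) - 1 - d (u - \<alpha>) \<le> ln (max \<bar>b * u - a\<bar> \<kappa>)"
      using AE1 neq by eventually_elim (rule pt)
  qed (use int iU in auto)
  finally show "ln (max b \<bar>a\<bar>) - 5 \<le> (\<integral>u. ln (max \<bar>b * u - a\<bar> \<kappa>) \<partial>uniform_law)" .
qed

text \<open>The mean of the lower bounds \<open>40 - k\<^sup>2\<close> for \<open>ln (level_scale k)\<close> is at least 8, which exceeds the loss 5
  from the uniform factor.\<close>

lemma ln_potential_lower_bound:
  assumes \<kappa>: "0 < \<kappa>"
  shows "3 \<le> (\<integral>x. ln (max \<bar>x - a\<bar> \<kappa>) \<partial>potential_law)"
    and "a \<noteq> 0 \<Longrightarrow> ln \<bar>a\<bar> - 5 \<le> (\<integral>x. ln (max \<bar>x - a\<bar> \<kappa>) \<partial>potential_law)"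
proof -
  interpret P: pair_prob_space "measure_pmf level_law" uniform_law by (rule pair_prob_space_levels)
  define f where "f x = ln (max \<bar>x - a\<bar> \<kappa>)" for x
  have fm [measurable]: "f \<in> borel_measurable borel" unfolding f_def [abs_def] by measurable
  have "integrable potential_law f"
  proof (rule Bochner_Integration.integrable_bound)
    define R where "R = \<bar>ln \<kappa>\<bar> + ln (1 + \<bar>a\<bar>) + ln (1 + \<kappa>)"
    show "integrable potential_law (\<lambda>x. ln (1 + \<bar>x\<bar>) + R)" using ln_moment_potential_law pot.prob_space by simp
    show "AE x in potential_law. norm (f x) \<le> norm (ln (1 + \<bar>x\<bar>) + R)"
      using ln_max_bound[OF \<kappa>, of _ a] unfolding f_def R_def by (intro AE_I2) (smt (verit) real_norm_def)
  qed (simp add: measurable_cong_sets[OF sets_potential_law refl])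
  then have i: "integrable (measure_pmf level_law \<Otimes>\<^sub>M uniform_law) (\<lambda>p. f (case p of (k, u) \<Rightarrow> level_scale k * u))"
    unfolding potential_law_def by (subst (asm) integrable_distr_eq) measurable
  have I: "(\<integral>x. f x \<partial>potential_law) = (\<integral>k. (\<integral>u. f (level_scale k * u) \<partial>uniform_law) \<partial>level_law)"
  proof -
    have "(\<integral>x. f x \<partial>potential_law) = (\<integral>p. f (case p of (k, u) \<Rightarrow> level_scale k * u) \<partial>(measure_pmf level_law \<Otimes>\<^sub>M uniform_law))"
      unfolding potential_law_def by (rule integral_distr) measurable
    also have "\<dots> = (\<integral>k. (\<integral>u. f (level_scale k * u) \<partial>uniform_law) \<partial>level_law)"
      using P.integral_fst'[OF i] by simp
    finally show ?thesis .
  qed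
  have ik: "integrable level_law (\<lambda>k. \<integral>u. f (level_scale k * u) \<partial>uniform_law)"
    using P.integrable_fst'[OF i] by simp
  have ge: "ln (max (level_scale k) \<bar>a\<bar>) - 5 \<le> (\<integral>u. f (level_scale k * u) \<partial>uniform_law)" for k
    unfolding f_def by (rule ln_potential_uniform[OF level_scale_pos \<kappa>])
  have i40: "integrable level_law (\<lambda>k. 35 - (real k)\<^sup>2)"
    using integrable_level_square by simp
  have "3 \<le> 35 - (\<integral>k. (real k)\<^sup>2 \<partial>level_law)" using level_square_le by simp
  also have "\<dots> = (\<integral>k. 35 - (real k)\<^sup>2 \<partial>level_law)" using integrable_level_square by simp
  also have "\<dots> \<le> (\<integral>x. f x \<partial>potential_law)" unfolding I
  proof (rule integral_mono[OF i40 ik])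
    fix k
    have "40 - (real k)\<^sup>2 \<le> ln (level_scale k)" by (simp add: ln_level_scale order_trans[of _ 0])
    also have "\<dots> \<le> ln (max (level_scale k) \<bar>a\<bar>)" using level_scale_pos[of k] by (intro ln_mono) auto
    finally show "35 - (real k)\<^sup>2 \<le> (\<integral>u. f (level_scale k * u) \<partial>uniform_law)" using ge[of k] by linarith
  qed
  finally show "3 \<le> (\<integral>x. ln (max \<bar>x - a\<bar> \<kappa>) \<partial>potential_law)" unfolding f_def .
  assume a: "a \<noteq> 0"
  have "ln \<bar>a\<bar> - 5 = (\<integral>k. ln \<bar>a\<bar> - 5 \<partial>level_law)" by simp
  also have "\<dots> \<le> (\<integral>x. f x \<partial>potential_law)" unfolding I
  proof (rule integral_mono[OF _ ik])
    fix k
    have "ln \<bar>a\<bar> \<le> ln (max (level_scale k) \<bar>a\<bar>)" using a by (intro ln_mono) auto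
    then show "ln \<bar>a\<bar> - 5 \<le> (\<integral>u. f (level_scale k * u) \<partial>uniform_law)" using ge[of k] by linarith
  qed simp
  finally show "ln \<bar>a\<bar> - 5 \<le> (\<integral>x. ln (max \<bar>x - a\<bar> \<kappa>) \<partial>potential_law)" unfolding f_def .
qed

lemma lyapunov1_pos: "0 < lyapunov1 (mu_E potential_law E)"
proof -
  have "3 \<le> lyapunov1 (mu_E potential_law E)"
    by (rule pot.lyapunov1_positive[of 3 5]) (use ln_potential_lower_bound in auto)
  then show ?thesis by simp
qed

text \<open>Smallness at scale \<open>level_scale N\<close> is provided by the odd level \<open>N\<close>, and the large neighbours by the
  next level \<open>N + 1\<close>, whose scale beats the inverse of \<open>level_scale N\<close>.\<close>

lemma isolation_prob_lower_bound:
  assumes N: "odd N" "7 \<le> N"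
  shows "level_scale N \<le> 1" "(1/2) ^ (3 * N + 9) \<le> pot.isolation_prob (level_scale N)"
proof -
  have "7 * 7 \<le> (real N)\<^sup>2" using N unfolding power2_eq_square by (intro mult_mono) auto
  then show "level_scale N \<le> 1" using N by (simp add: level_scale_def)
  have small: "(1/2) ^ Suc N * ((1 - (- 1)) / 2) \<le> measure potential_law {x. \<bar>x\<bar> \<le> level_scale N}"
    by (rule measure_potential_law_ge) (auto simp: abs_le_iff)
  have big: "(1/2) ^ Suc (Suc N) * ((1 - 1 / 2) / 2) \<le> measure potential_law {x. \<bar>x\<bar> \<ge> 3 / level_scale N}"
  proof (rule measure_potential_law_ge)
    fix x assume "level_scale (Suc N) * (1 / 2) \<le> x"
    moreover have "6 / level_scale N \<le> level_scale (Suc N)"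
    proof -
      have "level_scale N * level_scale (Suc N) = exp (80 + (1 + 2 * real N))"
        using N by (simp add: level_scale_def exp_add[symmetric] power2_eq_square algebra_simps)
      moreover have "6 \<le> exp (80 + (1 + 2 * real N))"
        using exp_ge_add_one_self[of "80 + (1 + 2 * real N)"] by linarith
      ultimately show ?thesis using level_scale_pos[of N] by (simp add: field_simps)
    qed
    ultimately show "x \<in> {x. \<bar>x\<bar> \<ge> 3 / level_scale N}" by (simp add: field_simps)
  qed auto
  have "(1/2) ^ (3 * N + 9) = (1/2::real) ^ Suc N * ((1/2) ^ (N + 4))\<^sup>2"
  proof -
    have "3 * N + 9 = Suc N + (N + 4) * 2" by simp
    then show ?thesis by (simp only: power_add power_mult)
  qed
  also have "\<dots> \<le> pot.isolation_prob (level_scale N)"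
    unfolding pot.isolation_prob_def
  proof (intro mult_mono power_mono)
    show "(1/2) ^ Suc N \<le> measure potential_law {x. \<bar>x\<bar> \<le> level_scale N}" using small by simp
    show "(1/2) ^ (N + 4) \<le> measure potential_law {x. \<bar>x\<bar> \<ge> 3 / level_scale N}" using big by (simp add: power_add power_divide)
  qed auto
  finally show "(1/2) ^ (3 * N + 9) \<le> pot.isolation_prob (level_scale N)" .
qed

text \<open>Hoelder continuity would bound the isolation probability at scale \<open>exp (40 - N\<^sup>2)\<close> by a power of this
  scale, whereas it is only exponentially small in \<open>N\<close>.\<close>

lemma lyapunov1_not_holder:
  assumes \<alpha>: "0 < \<alpha>"
  shows "\<not> locally_holder \<alpha> (\<lambda>E. lyapunov1 (mu_E potential_law E))"
proof
  assume "locally_holder \<alpha> (\<lambda>E. lyapunov1 (mu_E potential_law E))"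
  then obtain K where K: "\<And>\<eta>. 0 < \<eta> \<Longrightarrow> \<eta> \<le> 1 \<Longrightarrow> pot.isolation_prob \<eta> \<le> K * \<eta> powr (min \<alpha> (1/2))"
    using pot.holder_isolation[OF \<alpha>] by blast
  define \<beta> where "\<beta> = min \<alpha> (1/2)"
  have \<beta>: "0 < \<beta>" "\<beta> \<le> 1/2" using \<alpha> by (auto simp: \<beta>_def)
  obtain j :: nat where j: "real j > \<bar>K\<bar> + 4 / \<beta> + 50" using reals_Archimedean2 by blast
  define N where "N = 2 * j + 1"
  have "0 \<le> 4 / \<beta>" using \<beta> by simp
  then have "real j > \<bar>K\<bar> + 50" "real j > 4 / \<beta>" using j by linarith+
  then have N: "odd N" "7 \<le> N" "real N > \<bar>K\<bar> + 50" "real N > 4 / \<beta>"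
    unfolding N_def by simp_all
  have "exp (- (3 * real N + 9)) \<le> (1/2) ^ (3 * N + 9)"
  proof -
    have "exp (- 1) \<le> (1/2::real)" using exp_ge_add_one_self[of 1] by (simp add: exp_minus field_simps)
    then have "exp (- 1) ^ (3 * N + 9) \<le> (1/2::real) ^ (3 * N + 9)" by (intro power_mono) auto
    then show ?thesis by (simp add: exp_of_nat_mult[symmetric])
  qed
  also have "\<dots> \<le> K * level_scale N powr \<beta>"
    using isolation_prob_lower_bound[OF N(1,2)] K[OF level_scale_pos, of N] unfolding \<beta>_def by linarith
  also have "\<dots> \<le> \<bar>K\<bar> * exp (20 - \<beta> * (real N)\<^sup>2)"
  proof -
    have "level_scale N powr \<beta> = exp (\<beta> * (40 - (real N)\<^sup>2))" using N(1) by (simp add: level_scale_def powr_def)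
    also have "\<dots> \<le> exp (20 - \<beta> * (real N)\<^sup>2)" using \<beta> by (simp add: algebra_simps)
    finally show ?thesis by (intro mult_mono) auto
  qed
  also have "\<dots> \<le> \<bar>K\<bar> * exp (20 - 4 * real N)"
  proof -
    have "4 \<le> \<beta> * real N" using N(4) \<beta> by (simp add: field_simps)
    then have "4 * real N \<le> \<beta> * real N * real N" by (intro mult_right_mono) auto
    then show ?thesis by (intro mult_left_mono) (auto simp: power2_eq_square mult.assoc)
  qed
  finally have "exp (- (3 * real N + 9)) * exp (4 * real N - 20) \<le> \<bar>K\<bar> * exp (20 - 4 * real N) * exp (4 * real N - 20)"
    by (rule mult_right_mono) simp
  then have "exp (real N - 29) \<le> \<bar>K\<bar>" by (simp add: exp_add[symmetric] mult.assoc)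
  then show False using exp_ge_add_one_self[of "real N - 29"] N(3) by linarith
qed

section \<open>Strong irreducibility\<close>

text \<open>Levels with an arbitrarily large scale are uniform on arbitrarily long intervals, so every open
  interval has positive measure.\<close>

lemma S_mat_supp: "S_mat v \<in> SL2_supp (mu_E potential_law E)"
  unfolding SL2_supp_def
proof (intro CollectI conjI allI impI S_mat_in_SL2)
  fix U :: "(real^2^2) set" assume U: "open U \<and> S_mat v \<in> U"
  define y where "y = v + E"
  have "open (S_mat -` U)" using U continuous_S_mat by (blast intro: open_vimage)
  moreover have "v \<in> S_mat -` U" using U by simp
  ultimately obtain e where e: "0 < e" "ball v e \<subseteq> S_mat -` U" by (metis open_contains_ball)
  have UB: "U \<inter> SL2 \<in> sets SL2_borel" unfolding SL2_borel_def using U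
    by (auto simp: sets_restrict_space)
  obtain j :: nat where j: "real j > \<bar>y\<bar>" using reals_Archimedean2 by blast
  define k where "k = 2 * j"
  have k: "\<bar>y\<bar> < level_scale k"
  proof -
    have "\<bar>y\<bar> < real k + 1" using j by (simp add: k_def)
    also have "\<dots> \<le> (real k)\<^sup>2 + 1" by (cases "k = 0") (auto simp: power2_eq_square)
    also have "\<dots> \<le> exp ((real k)\<^sup>2)" using exp_ge_add_one_self[of "(real k)\<^sup>2"] by linarith
    also have "\<dots> \<le> level_scale k" by (simp add: level_scale_def k_def)
    finally show ?thesis .
  qed
  define c where "c = y / level_scale k"
  define d where "d = min 1 (c + e / (2 * level_scale k))"
  have c: "- 1 < c" "c < 1" using k level_scale_pos[of k] by (auto simp: c_def field_simps abs_less_iff)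
  have cd: "c < d" using c e level_scale_pos[of k] by (auto simp: d_def)
  have "0 < (1/2) ^ Suc k * ((d - c) / 2)" using cd by simp
  also have "\<dots> \<le> measure potential_law {x. S_mat (x - E) \<in> U}"
  proof (rule measure_potential_law_ge)
    have "{x. S_mat (x - E) \<in> U} = (\<lambda>x. x - E) -` (S_mat -` U)" by auto
    moreover have "open \<dots>" by (rule open_vimage[OF \<open>open (S_mat -` U)\<close>]) (intro continuous_intros)
    ultimately show "{x. S_mat (x - E) \<in> U} \<in> sets borel" by simp
    fix x assume "level_scale k * c \<le> x" "x \<le> level_scale k * d"
    moreover have "level_scale k * d \<le> level_scale k * (c + e / (2 * level_scale k))"
      using level_scale_pos[of k] by (intro mult_left_mono) (auto simp: d_def)
    moreover have "level_scale k * (c + e / (2 * level_scale k)) = y + e / 2" "level_scale k * c = y"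
      using level_scale_pos[of k] by (auto simp: c_def field_simps)
    ultimately have "y \<le> x" "x \<le> y + e / 2" by auto
    then have "x - E \<in> ball v e" using e by (auto simp: y_def dist_real_def)
    then show "x \<in> {x. S_mat (x - E) \<in> U}" using e by auto
  qed (use c cd in \<open>auto simp: d_def\<close>)
  finally have "0 < emeasure potential_law {x. S_mat (x - E) \<in> U}"
    by (simp add: pot.emeasure_eq_measure)
  also have "\<dots> = emeasure (mu_E potential_law E) (U \<inter> SL2)"
    unfolding mu_E_eq_distr[OF prob_space_potential_law sets_potential_law]
  proof (subst emeasure_distr)
    show "(\<lambda>x. S_mat (x - E)) \<in> potential_law \<rightarrow>\<^sub>M SL2_borel"
      unfolding measurable_cong_sets[OF sets_potential_law refl] by measurable
    show "U \<inter> SL2 \<in> sets SL2_borel" by (rule UB)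
    have "{x. S_mat (x - E) \<in> U} = (\<lambda>x. S_mat (x - E)) -` (U \<inter> SL2) \<inter> space potential_law"
      by (auto simp: S_mat_in_SL2 pot.space_nu)
    then show "emeasure potential_law {x. S_mat (x - E) \<in> U} = emeasure potential_law ((\<lambda>x. S_mat (x - E)) -` (U \<inter> SL2) \<inter> space potential_law)" by simp
  qed
  finally show "emeasure (mu_E potential_law E) (U \<inter> SL2) > 0" .
qed

text \<open>One application of \<open>S_mat 0\<close> produces a line in the invariant set that is not the second axis. The images
  of such a line under \<open>S_mat v\<close> are pairwise different for different \<open>v\<close>, so the set is infinite.\<close>

lemma strongly_irreducible_of_all_S_mat:
  assumes "\<And>v. S_mat v \<in> SL2_supp \<mu>"
  shows "strongly_irreducible \<mu>"
  unfolding strongly_irreducible_def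
proof
  assume "\<exists>F. F \<subseteq> proj_line \<and> finite F \<and> F \<noteq> {} \<and> (\<forall>A\<in>SL2_supp \<mu>. proj_act A ` F \<subseteq> F)"
  then obtain F where F: "F \<subseteq> proj_line" "finite F" "F \<noteq> {}"
    and inv: "\<forall>A\<in>SL2_supp \<mu>. proj_act A ` F \<subseteq> F" by (elim exE conjE)
  have F4: "proj_act (S_mat v) L \<in> F" if "L \<in> F" for v L
    using bspec[OF inv assms[of v]] that by (rule subsetD[OF _ imageI])
  have act: "S_mat v *v u = vector [v * u$1 - u$2, u$1]" for v u
    by (simp add: vec_eq_iff forall_2 matrix_vector_mult_def sum_2 S_mat_nth)
  have "\<exists>L\<in>F. \<exists>u\<in>L. u$1 \<noteq> 0"
  proof (rule ccontr)
    assume neg: "\<not> ?thesis"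
    obtain L where L: "L \<in> F" using F by auto
    have "L \<noteq> {0}" using L F(1) by (auto simp: proj_line_def)
    moreover have "subspace L" using L F(1) by (auto simp: proj_line_def)
    ultimately obtain u where u: "u \<in> L" "u \<noteq> 0" using subspace_0 by blast
    have "u$1 = 0" using neg L u by auto
    then have "u$2 \<noteq> 0" using u by (auto simp: vec_eq_iff forall_2)
    moreover have "S_mat 0 *v u \<in> proj_act (S_mat 0) L" using u by (auto simp: proj_act_def)
    moreover have "(S_mat 0 *v u)$1 = - u$2" by (simp add: act)
    ultimately show False using neg F4[OF L, of 0] by (metis neg_equal_0_iff_equal)
  qed
  then obtain L u where L: "L \<in> F" "u \<in> L" "u$1 \<noteq> 0" by blast
  have line: "\<exists>c. w = c *\<^sub>R u" if "w \<in> L" for w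
  proof -
    have "dim L = 1" "subspace L" using L F(1) by (auto simp: proj_line_def)
    have "u \<noteq> 0" using L by auto
    have "L \<subseteq> span {u}"
      using card_ge_dim_independent[of "{u}" L] L \<open>dim L = 1\<close> \<open>u \<noteq> 0\<close> by auto
    then show ?thesis using that by (auto simp: span_singleton)
  qed
  have "inj (\<lambda>v. proj_act (S_mat v) L)"
  proof (rule injI)
    fix v w assume eq: "proj_act (S_mat v) L = proj_act (S_mat w) L"
    have "S_mat v *v u \<in> proj_act (S_mat w) L" unfolding eq[symmetric] using L by (auto simp: proj_act_def)
    then obtain z where z: "z \<in> L" "S_mat v *v u = S_mat w *v z" by (auto simp: proj_act_def)
    obtain c where c: "z = c *\<^sub>R u" using line[OF z(1)] by blast
    have e1: "v * u$1 - u$2 = w * z$1 - z$2"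
      using arg_cong[OF z(2)[unfolded act], of "\<lambda>x. x$1"] by (simp only: vector_2)
    have e2: "u$1 = z$1"
      using arg_cong[OF z(2)[unfolded act], of "\<lambda>x. x$2"] by (simp only: vector_2)
    have "c = 1" using e2 L(3) unfolding c by simp
    then have "z = u" using c by simp
    then show "v = w" using e1 L(3) by simp
  qed
  moreover have "range (\<lambda>v. proj_act (S_mat v) L) \<subseteq> F" using F4 L(1) by auto
  ultimately have "finite (UNIV :: real set)" using F(2) by (meson finite_imageD finite_subset)
  then show False using infinite_UNIV_char_0 by blast
qed

theorem corollary2p3:
  shows "\<exists>\<nu> :: real measure. prob_space \<nu> \<and> sets \<nu> = sets borel \<and>
    (\<forall>m>0. (SUP E\<in>{E. \<bar>E\<bar> \<le> m}.
        \<integral>\<^sup>+ A. ennreal (exp ((ln (op_norm A)) powr (1/3))) \<partial>mu_E \<nu> E) < \<infinity>) \<and>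
    (\<forall>\<alpha>>0. \<forall>E. (\<integral>\<^sup>+ A. ennreal (op_norm A powr \<alpha>) \<partial>mu_E \<nu> E) = \<infinity>) \<and>
    (\<forall>E. strongly_irreducible (mu_E \<nu> E) \<and> lyapunov1 (mu_E \<nu> E) > lyapunov2 (mu_E \<nu> E)) \<and>
    (\<forall>\<alpha>>0. \<not> locally_holder \<alpha> (\<lambda>E. lyapunov1 (mu_E \<nu> E)))"
proof (intro exI[of _ potential_law] conjI allI impI)
  show "lyapunov2 (mu_E potential_law E) < lyapunov1 (mu_E potential_law E)" for E
    using lyapunov1_pos[of E] by (simp add: lyapunov2_def)
qed (fact prob_space_potential_law sets_potential_law subexponential_moment_finite power_moment_infinite lyapunov1_not_holder
      strongly_irreducible_of_all_S_mat[OF S_mat_supp])+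

end
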